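(* Let $\mathcal{LL}_\hbar$ be the Livernet--Loday operad with the Hopf operad structure described in the context, and let $n\ge 1$. The associative algebra dual to the $n$-th component $\mathcal{LL}_\hbar(n)$ can be presented, as an associative commutative unital algebra, by generators $x_{ij}$, $1\le i,j\le n$, $i\ne j$, and relations (for pairwise distinct indices $i,j,k$) $$x_{ij}+x_{ji}=\hbar,$$ $$x_{ij}x_{jk}+\hbar x_{ik}=x_{ij}x_{ik}+x_{jk}x_{ik},$$ $$x_{ij}^2=\hbar x_{ij}.$$ Thus for $\hbar\neq 0$ (i.e. when $\hbar$ is specialized to a nonzero element of $\mathbb{k}$) it is isomorphic to the Gelfand--Varchenko algebra of locally constant functions on the complement of the real hyperplane arrangement $A_{n-1}$.
   Context: $\mathbb{k}$ is a field of characteristic zero. The Livernet--Loday operad $\mathcal{LL}_\hbar$ is the quadratic operad over $\mathbb{k}[[\hbar]]$ generated by a commutative binary operation $a,b\mapsto a\cdot b$ and a skew-commutative binary operation $a,b\mapsto [a,b]$ satisfying (i) $[a\cdot b,c]=a\cdot[b,c]+[a,c]\cdot b$; (ii) $[a,[b,c]]+[b,[c,a]]+[c,[a,b]]=0$; (iii) $(a\cdot b)\cdot c-a\cdot(b\cdot c)=\hbar^2[b,[a,c]]$. Since these relations are polynomial in $\hbar$, $\hbar$ may be specialized to any element of $\mathbb{k}$, giving an operad over $\mathbb{k}$. $\mathcal{LL}_\hbar$ is a Hopf operad (an operad in the category of coassociative counital coalgebras): the coproduct is the operad morphism $\Delta:\mathcal{LL}_\hbar\to\mathcal{LL}_\hbar\otimes\mathcal{LL}_\hbar$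 (arity-wise tensor product) with $\Delta(\cdot)=(\cdot)\otimes(\cdot)+\hbar^2\,[\,,]\otimes[\,,]$ and $\Delta([\,,])=[\,,]\otimes(\cdot)+(\cdot)\otimes[\,,]$. Hence the dual $\mathcal{LL}_\hbar(n)^*$ of the coalgebra $\mathcal{LL}_\hbar(n)$ is an associative (commutative, unital) algebra; this is the algebra dual to the $n$-th component. The arrangement $A_{n-1}$ is the set of hyperplanes $\{t_i=t_j\}$, $1\le i<j\le n$, in $\mathbb{R}^n$. The Gelfand--Varchenko algebra is the algebra of $\mathbb{k}$-valued locally constant functions on the complement of the union of these hyperplanes, with pointwise operations. *)

theory Defs
  imports
    "HOL-Analysis.Analysis"
    "HOL-Algebra.QuotRing"
    "HOL-Algebra.Module"
    "HOL-Library.Poly_Mapping"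
    "HOL-Combinatorics.Permutations"
    "HOL-Computational_Algebra.Formal_Power_Series"
begin

section \<open>Formal linear combinations\<close>

abbreviation monom1 :: "'a \<Rightarrow> 'a \<Rightarrow>\<^sub>0 'r::comm_ring_1"
  where "monom1 a \<equiv> Poly_Mapping.single a 1"

definition scale :: "'r \<Rightarrow> ('a \<Rightarrow>\<^sub>0 'r) \<Rightarrow> ('a \<Rightarrow>\<^sub>0 'r::comm_ring_1)"
  where "scale c p = Poly_Mapping.map ((*) c) p"

definition lin_ext :: "('a \<Rightarrow> 'b \<Rightarrow>\<^sub>0 'r) \<Rightarrow> ('a \<Rightarrow>\<^sub>0 'r) \<Rightarrow> ('b \<Rightarrow>\<^sub>0 'r::comm_ring_1)"
  where "lin_ext g p = (\<Sum>a\<in>Poly_Mapping.keys p. scale (Poly_Mapping.lookup p a) (g a))"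

definition bilin_ext ::
    "('a \<Rightarrow> 'b \<Rightarrow> 'c) \<Rightarrow> ('a \<Rightarrow>\<^sub>0 'r) \<Rightarrow> ('b \<Rightarrow>\<^sub>0 'r) \<Rightarrow> ('c \<Rightarrow>\<^sub>0 'r::comm_ring_1)"
  where "bilin_ext g p q = lin_ext (\<lambda>a. lin_ext (\<lambda>b. monom1 (g a b)) q) p"


section \<open>The free operad on two binary operations\<close>

datatype 'l tree = Leaf 'l | Dot "'l tree" "'l tree" | Brk "'l tree" "'l tree"

primrec leaves :: "'l tree \<Rightarrow> 'l list" where
  "leaves (Leaf l) = [l]"
| "leaves (Dot s t) = leaves s @ leaves t"
| "leaves (Brk s t) = leaves s @ leaves t"

primrec graft :: "('l \<Rightarrow> 'm tree) \<Rightarrow> 'l tree \<Rightarrow> 'm tree" where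
  "graft \<sigma> (Leaf l) = \<sigma> l"
| "graft \<sigma> (Dot s t) = Dot (graft \<sigma> s) (graft \<sigma> t)"
| "graft \<sigma> (Brk s t) = Brk (graft \<sigma> s) (graft \<sigma> t)"

text \<open>
  Tree monomials of arity \<open>n\<close>: each of the inputs \<open>1, \<dots>, n\<close> occurs exactly once.  No symmetry of
  the two operations is built in: their commutativity and skew-commutativity are among the
  relations imposed below.
\<close>
definition tree_monomials :: "nat \<Rightarrow> nat tree set"
  where "tree_monomials n = {t. distinct (leaves t) \<and> set (leaves t) = {1..n}}"

definition free_op :: "nat \<Rightarrow> (nat tree \<Rightarrow>\<^sub>0 'r::comm_ring_1) set"
  where "free_op n = {p. Poly_Mapping.keys p \<subseteq> tree_monomials n}"

definition perm_act :: "(nat \<Rightarrow> nat) \<Rightarrow> (nat tree \<Rightarrow>\<^sub>0 'r) \<Rightarrow> (nat tree \<Rightarrow>\<^sub>0 'r::comm_ring_1)"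
  where "perm_act \<sigma> = lin_ext (\<lambda>t. monom1 (map_tree \<sigma> t))"

text \<open>
  Partial composition at the input \<open>i\<close> with an operation of arity \<open>m\<close>: the inputs of the latter
  become \<open>i, \<dots>, i + m - 1\<close>, and the inputs \<open>j > i\<close> of the former become \<open>j + m - 1\<close>.
\<close>
definition tree_comp :: "nat \<Rightarrow> nat \<Rightarrow> nat tree \<Rightarrow> nat tree \<Rightarrow> nat tree"
  where "tree_comp i m t s =
    graft (\<lambda>j. if j < i then Leaf j
               else if j = i then map_tree (\<lambda>l. l + i - 1) s
               else Leaf (j + m - 1)) t"

definition op_comp ::
    "nat \<Rightarrow> nat \<Rightarrow> (nat tree \<Rightarrow>\<^sub>0 'r) \<Rightarrow> (nat tree \<Rightarrow>\<^sub>0 'r) \<Rightarrow> (nat tree \<Rightarrow>\<^sub>0 'r::comm_ring_1)"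
  where "op_comp i m = bilin_ext (tree_comp i m)"

inductive operad_ideal ::
    "(nat \<Rightarrow> (nat tree \<Rightarrow>\<^sub>0 'r) set) \<Rightarrow> nat \<Rightarrow> (nat tree \<Rightarrow>\<^sub>0 'r::comm_ring_1) \<Rightarrow> bool"
  for G where
  gen: "p \<in> G n \<Longrightarrow> operad_ideal G n p"
| zero: "operad_ideal G n 0"
| add: "operad_ideal G n p \<Longrightarrow> operad_ideal G n q \<Longrightarrow> operad_ideal G n (p + q)"
| scale: "operad_ideal G n p \<Longrightarrow> operad_ideal G n (scale c p)"
| perm: "operad_ideal G n p \<Longrightarrow> \<sigma> permutes {1..n} \<Longrightarrow> operad_ideal G n (perm_act \<sigma> p)"
| comp_left: "operad_ideal G n p \<Longrightarrow> q \<in> free_op m \<Longrightarrow> i \<in> {1..n} \<Longrightarrow>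
    operad_ideal G (n + m - 1) (op_comp i m p q)"
| comp_right: "p \<in> free_op n \<Longrightarrow> operad_ideal G m q \<Longrightarrow> i \<in> {1..n} \<Longrightarrow>
    operad_ideal G (n + m - 1) (op_comp i m p q)"


section \<open>The Livernet--Loday operad\<close>

text \<open>
  The parameter \<open>h\<close> is an element of an arbitrary commutative ring of scalars \<open>'r\<close>.  The operad
  over formal power series is the case \<open>h = fps_X\<close>; its specializations are the cases where \<open>h\<close>
  is an element of the base field.
\<close>
definition LL_relations :: "'r \<Rightarrow> nat \<Rightarrow> (nat tree \<Rightarrow>\<^sub>0 'r::comm_ring_1) set"
  where "LL_relations h n =
    (let a = Leaf 1; b = Leaf 2; c = Leaf 3 in
     if n = 2 then
       {monom1 (Dot a b) - monom1 (Dot b a),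
        monom1 (Brk a b) + monom1 (Brk b a)}
     else if n = 3 then
       {monom1 (Brk (Dot a b) c) - (monom1 (Dot a (Brk b c)) + monom1 (Dot (Brk a c) b)),
        monom1 (Brk a (Brk b c)) + monom1 (Brk b (Brk c a)) + monom1 (Brk c (Brk a b)),
        monom1 (Dot (Dot a b) c) - monom1 (Dot a (Dot b c))
          - scale (h\<^sup>2) (monom1 (Brk b (Brk a c)))}
     else {})"

definition LL_rel :: "'r \<Rightarrow> nat \<Rightarrow> (nat tree \<Rightarrow>\<^sub>0 'r::comm_ring_1) rel"
  where "LL_rel h n =
    {(p, q). p \<in> free_op n \<and> q \<in> free_op n \<and> operad_ideal (LL_relations h) n (p - q)}"

definition LL :: "'r \<Rightarrow> nat \<Rightarrow> (nat tree \<Rightarrow>\<^sub>0 'r::comm_ring_1) set set"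
  where "LL h n = free_op n // LL_rel h n"

definition LL_class :: "'r \<Rightarrow> nat \<Rightarrow> (nat tree \<Rightarrow>\<^sub>0 'r) \<Rightarrow> (nat tree \<Rightarrow>\<^sub>0 'r::comm_ring_1) set"
  where "LL_class h n p = LL_rel h n `` {p}"


section \<open>The Hopf structure\<close>

text \<open>
  The arity-wise tensor square of the free operad has the pairs of tree monomials as a basis, and
  its composition is componentwise.  A morphism out of a free operad is determined by the images of
  the generators: the root operation \<open>\<mu>\<close> of a tree with subtrees \<open>s\<close>, \<open>t\<close> contributes
  \<open>\<Delta>(\<mu>)(\<Delta> s, \<Delta> t)\<close>, where \<open>\<Delta>(Dot) = Dot \<otimes> Dot + h\<^sup>2 Brk \<otimes> Brk\<close> and
  \<open>\<Delta>(Brk) = Brk \<otimes> Dot + Dot \<otimes> Brk\<close>.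
\<close>
definition tensor_op ::
    "('l tree \<Rightarrow> 'l tree \<Rightarrow> 'l tree) \<Rightarrow> ('l tree \<Rightarrow> 'l tree \<Rightarrow> 'l tree) \<Rightarrow>
     ('l tree \<times> 'l tree \<Rightarrow>\<^sub>0 'r) \<Rightarrow> ('l tree \<times> 'l tree \<Rightarrow>\<^sub>0 'r) \<Rightarrow>
     ('l tree \<times> 'l tree \<Rightarrow>\<^sub>0 'r::comm_ring_1)"
  where "tensor_op \<mu> \<nu> = bilin_ext (\<lambda>(s, s') (t, t'). (\<mu> s t, \<nu> s' t'))"

primrec tree_coprod :: "'r \<Rightarrow> 'l tree \<Rightarrow> ('l tree \<times> 'l tree \<Rightarrow>\<^sub>0 'r::comm_ring_1)" where
  "tree_coprod h (Leaf l) = monom1 (Leaf l, Leaf l)"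
| "tree_coprod h (Dot s t) =
     tensor_op Dot Dot (tree_coprod h s) (tree_coprod h t)
     + scale (h\<^sup>2) (tensor_op Brk Brk (tree_coprod h s) (tree_coprod h t))"
| "tree_coprod h (Brk s t) =
     tensor_op Brk Dot (tree_coprod h s) (tree_coprod h t)
     + tensor_op Dot Brk (tree_coprod h s) (tree_coprod h t)"

definition coprod :: "'r \<Rightarrow> ('l tree \<Rightarrow>\<^sub>0 'r) \<Rightarrow> ('l tree \<times> 'l tree \<Rightarrow>\<^sub>0 'r::comm_ring_1)"
  where "coprod h = lin_ext (tree_coprod h)"

text \<open>
  The counit is the morphism to the operad of commutative algebras with \<open>\<epsilon>(Dot) = 1\<close> and
  \<open>\<epsilon>(Brk) = 0\<close>; these values are forced by the counit axiom.
\<close>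
primrec tree_counit :: "'l tree \<Rightarrow> 'r::comm_ring_1" where
  "tree_counit (Leaf l) = 1"
| "tree_counit (Dot s t) = tree_counit s * tree_counit t"
| "tree_counit (Brk s t) = 0"

definition counit :: "('l tree \<Rightarrow>\<^sub>0 'r) \<Rightarrow> 'r::comm_ring_1"
  where "counit p = (\<Sum>t\<in>Poly_Mapping.keys p. Poly_Mapping.lookup p t * tree_counit t)"


section \<open>The algebra dual to a component\<close>

definition LL_dual :: "'r \<Rightarrow> nat \<Rightarrow> ((nat tree \<Rightarrow>\<^sub>0 'r) set \<Rightarrow> 'r::comm_ring_1) set"
  where "LL_dual h n =
    {f \<in> LL h n \<rightarrow>\<^sub>E UNIV.
      (\<forall>p\<in>free_op n. \<forall>q\<in>free_op n.
        f (LL_class h n (p + q)) = f (LL_class h n p) + f (LL_class h n q)) \<and>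
      (\<forall>a. \<forall>p\<in>free_op n. f (LL_class h n (scale a p)) = a * f (LL_class h n p))}"

text \<open>The functional \<open>f \<otimes> g\<close> on (representatives of) elements of the tensor square.\<close>
definition tensor_eval ::
    "'r \<Rightarrow> nat \<Rightarrow> ((nat tree \<Rightarrow>\<^sub>0 'r) set \<Rightarrow> 'r) \<Rightarrow> ((nat tree \<Rightarrow>\<^sub>0 'r) set \<Rightarrow> 'r) \<Rightarrow>
     (nat tree \<times> nat tree \<Rightarrow>\<^sub>0 'r) \<Rightarrow> 'r::comm_ring_1"
  where "tensor_eval h n f g P =
    (\<Sum>(s, t)\<in>Poly_Mapping.keys P. Poly_Mapping.lookup P (s, t)
        * f (LL_class h n (monom1 s)) * g (LL_class h n (monom1 t)))"

text \<open>
  The product of \<open>f\<close> and \<open>g\<close> is \<open>(f \<otimes> g) \<circ> \<Delta>\<close> and the unit is \<open>\<epsilon>\<close>.  Both are computed on the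
  representatives of a class; \<open>the_elem\<close> extracts the common value.
\<close>
definition LL_dual_algebra ::
    "'r \<Rightarrow> nat \<Rightarrow> ('r, (nat tree \<Rightarrow>\<^sub>0 'r) set \<Rightarrow> 'r::comm_ring_1) module"
  where "LL_dual_algebra h n = \<lparr>
    carrier = LL_dual h n,
    mult = (\<lambda>f g. \<lambda>X\<in>LL h n. the_elem ((\<lambda>p. tensor_eval h n f g (coprod h p)) ` X)),
    one = (\<lambda>X\<in>LL h n. the_elem (counit ` X)),
    zero = (\<lambda>X\<in>LL h n. 0),
    add = (\<lambda>f g. \<lambda>X\<in>LL h n. f X + g X),
    smult = (\<lambda>a f. \<lambda>X\<in>LL h n. a * f X)\<rparr>"


section \<open>Algebras given by generators and relations\<close>

definition alg_hom :: "('r, 'a) module \<Rightarrow> ('r, 'b) module \<Rightarrow> ('a \<Rightarrow> 'b) set"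
  where "alg_hom A B =
    {\<phi> \<in> ring_hom A B. \<forall>a. \<forall>x\<in>carrier A. \<phi> (a \<odot>\<^bsub>A\<^esub> x) = a \<odot>\<^bsub>B\<^esub> \<phi> x}"

definition alg_isomorphic :: "('r, 'a) module \<Rightarrow> ('r, 'b) module \<Rightarrow> bool"
  where "alg_isomorphic A B \<longleftrightarrow> (\<exists>\<phi>\<in>alg_hom A B. bij_betw \<phi> (carrier A) (carrier B))"

text \<open>
  A polynomial is a linear combination of commutative monomials, a monomial being given by its
  exponents; the product of type class \<^class>\<open>times\<close> on this type is the convolution product.
\<close>
type_synonym ('v, 'r) polynomial = "('v \<Rightarrow>\<^sub>0 nat) \<Rightarrow>\<^sub>0 'r"

definition poly_algebra :: "'v set \<Rightarrow> ('r, ('v, 'r::comm_ring_1) polynomial) module"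
  where "poly_algebra V = \<lparr>
    carrier = {p. \<forall>m\<in>Poly_Mapping.keys p. Poly_Mapping.keys m \<subseteq> V},
    mult = (*), one = 1, zero = 0, add = (+), smult = scale\<rparr>"

definition presented_by ::
    "('r, 'b) module \<Rightarrow> 'v set \<Rightarrow> ('v, 'r::comm_ring_1) polynomial set \<Rightarrow> bool"
  where "presented_by B V rels \<longleftrightarrow>
    (\<exists>\<phi>\<in>alg_hom (poly_algebra V) B.
       \<phi> ` carrier (poly_algebra V) = carrier B \<and>
       a_kernel (poly_algebra V) B \<phi> = Idl\<^bsub>poly_algebra V\<^esub> rels)"

definition gen_indices :: "nat \<Rightarrow> (nat \<times> nat) set"
  where "gen_indices n = {(i, j). i \<in> {1..n} \<and> j \<in> {1..n} \<and> i \<noteq> j}"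

abbreviation gen_x :: "nat \<Rightarrow> nat \<Rightarrow> (nat \<times> nat, 'r::comm_ring_1) polynomial"
  where "gen_x i j \<equiv> monom1 (Poly_Mapping.single (i, j) 1)"

definition dual_relations :: "'r \<Rightarrow> nat \<Rightarrow> (nat \<times> nat, 'r::comm_ring_1) polynomial set"
  where "dual_relations h n =
    {gen_x i j + gen_x j i - scale h 1 |i j. (i, j) \<in> gen_indices n}
    \<union> {gen_x i j * gen_x j k + scale h (gen_x i k)
          - (gen_x i j * gen_x i k + gen_x j k * gen_x i k) |i j k.
        i \<in> {1..n} \<and> j \<in> {1..n} \<and> k \<in> {1..n} \<and> i \<noteq> j \<and> j \<noteq> k \<and> i \<noteq> k}
    \<union> {(gen_x i j)\<^sup>2 - scale h (gen_x i j) |i j. (i, j) \<in> gen_indices n}"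


section \<open>The Gelfand--Varchenko algebra of the braid arrangement\<close>

text \<open>Points of \<open>n\<close>-dimensional real space are extensional functions on \<open>{1..n}\<close>.\<close>
definition braid_arrangement :: "nat \<Rightarrow> (nat \<Rightarrow> real) set set"
  where "braid_arrangement n =
    {{t \<in> topspace (powertop_real {1..n}). t i = t j} |i j. 1 \<le> i \<and> i < j \<and> j \<le> n}"

definition braid_complement :: "nat \<Rightarrow> (nat \<Rightarrow> real) set"
  where "braid_complement n = topspace (powertop_real {1..n}) - \<Union>(braid_arrangement n)"

definition locally_constant_on :: "'a topology \<Rightarrow> ('a \<Rightarrow> 'b) \<Rightarrow> bool"
  where "locally_constant_on T f \<longleftrightarrow>
    (\<forall>x\<in>topspace T. \<exists>U. openin T U \<and> x \<in> U \<and> f constant_on U)"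

definition GV_algebra :: "nat \<Rightarrow> ('k, (nat \<Rightarrow> real) \<Rightarrow> 'k::field) module"
  where "GV_algebra n = (let C = braid_complement n in \<lparr>
    carrier = {f \<in> C \<rightarrow>\<^sub>E UNIV. locally_constant_on (subtopology (powertop_real {1..n}) C) f},
    mult = (\<lambda>f g. \<lambda>t\<in>C. f t * g t),
    one = (\<lambda>t\<in>C. 1),
    zero = (\<lambda>t\<in>C. 0),
    add = (\<lambda>f g. \<lambda>t\<in>C. f t + g t),
    smult = (\<lambda>a f. \<lambda>t\<in>C. a * f t)\<rparr>)"

end

theory Submission
  imports Defs
begin

text \<open>
  If \<open>h\<close> and \<open>2\<close> are invertible, \<open>a * b = a \<cdot> b + h [a, b]\<close> is an associative product, it is
  group-like for the coproduct, and it turns the \<open>n\<close>-th component into the span of the linear orders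
  of \<open>{1..n}\<close>.  The generator \<open>x\<^sub>i\<^sub>j\<close> is the function with value \<open>h\<close> on the orders in which \<open>i\<close>
  precedes \<open>j\<close>, and value \<open>0\<close> elsewhere.  Written in terms of the original operations, the value of
  a monomial in the \<open>x\<^sub>i\<^sub>j\<close> on a tree is a product over the nodes in which \<open>h\<close> is no longer
  inverted, so the resulting pairing makes sense over every ring in which \<open>2\<close> is invertible.
  It vanishes on the operadic ideal, and it makes the coproduct of trees adjoint to the product of
  monomials.

  Let \<open>y\<^sub>i\<^sub>j = 2 x\<^sub>i\<^sub>j - h\<close>.  The \<open>n!\<close> products of factors \<open>1\<close> or \<open>y\<^sub>i\<^sub>m\<close> with \<open>i < m\<close>, one
  factor for each \<open>m\<close> in \<open>{2..n}\<close>, are dual to the \<open>n!\<close> trees that arise by attaching the leaves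
  \<open>m = 2, \<dots>, n\<close> one by one, either multiplying the whole tree by \<open>m\<close> or replacing a leaf \<open>i\<close> by
  \<open>[i, m]\<close>.  The relations of the operad show that these trees span the component, and the
  relations among the \<open>x\<^sub>i\<^sub>j\<close> show that these products span the presented algebra.  Hence both
  are bases and the pairing is perfect.
\<close>

section \<open>Linear functionals on formal linear combinations\<close>

text \<open>Over the power series \<open>h\<close> is not a unit, and it is not known beforehand
  that the components are free. The linear orders then fail to span (already for n = 2), so they
  only guide the construction: what associativity would give for free is rechecked on weights, by
  cases on vanishing exponents. Freeness is bypassed by functionals: one that respects the relations
  and vanishes on the chosen trees is zero. Subtracting from a given functional that of a suitable
  polynomial yields surjectivity; reading the coefficients of a normal form off the same trees
  yields the kernel. Modulo the relations \<open>y_ij\<close> is \<open>x_ij - x_ji\<close>.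
  Attaching a leaf by a product contributes 2 (h/2) - h = 0 to it, attaching it by a bracket 2 (1/2)
  = 1, so the pairing matrix is the identity without any division by \<open>h\<close>. A second
  obstacle is bookkeeping: the operadic ideal only knows the inputs 1, ..., n with shifted
  numbering, and has to be carried over to relations placed inside arbitrary trees.\<close>

definition eval_lin :: "('a \<Rightarrow> 'r) \<Rightarrow> ('a \<Rightarrow>\<^sub>0 'r) \<Rightarrow> 'r::comm_ring_1"
  where "eval_lin f p = (\<Sum>a\<in>Poly_Mapping.keys p. Poly_Mapping.lookup p a * f a)"

lemma eval_lin_superset:
  assumes "finite A" "Poly_Mapping.keys p \<subseteq> A"
  shows "eval_lin f p = (\<Sum>a\<in>A. Poly_Mapping.lookup p a * f a)"
  unfolding eval_lin_def
  by (rule sum.mono_neutral_left) (use assms in \<open>auto simp: in_keys_iff\<close>)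

lemma eval_lin_zero [simp]: "eval_lin f 0 = 0"
  by (simp add: eval_lin_def)

lemma eval_lin_add [simp]: "eval_lin f (p + q) = eval_lin f p + eval_lin f q"
proof -
  let ?A = "Poly_Mapping.keys p \<union> Poly_Mapping.keys q"
  have "eval_lin f (p + q) = (\<Sum>a\<in>?A. Poly_Mapping.lookup (p + q) a * f a)"
    by (rule eval_lin_superset) (auto dest: subsetD[OF keys_add])
  moreover have "eval_lin f p = (\<Sum>a\<in>?A. Poly_Mapping.lookup p a * f a)"
    by (rule eval_lin_superset) auto
  moreover have "eval_lin f q = (\<Sum>a\<in>?A. Poly_Mapping.lookup q a * f a)"
    by (rule eval_lin_superset) auto
  ultimately show ?thesis
    by (simp add: lookup_add algebra_simps sum.distrib)
qed

lemma lookup_scale [simp]: "Poly_Mapping.lookup (scale c p) a = c * Poly_Mapping.lookup p a"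
  by (simp add: scale_def Poly_Mapping.map.rep_eq when_def)

lemma scale_simps [simp]:
  "scale 1 p = p" "scale 0 p = 0" "scale c 0 = 0" "scale a (scale b p) = scale (a * b) p"
  "scale c (Poly_Mapping.single x b) = Poly_Mapping.single x (c * b)"
  by (rule poly_mapping_eqI; simp add: lookup_single when_def mult.assoc)+

lemma scale_distrib:
  "scale c (p + q) = scale c p + scale c q" "scale c (p - q) = scale c p - scale c q"
  "scale (a + b) p = scale a p + scale b p" "scale (a - b) p = scale a p - scale b p"
  by (rule poly_mapping_eqI; simp add: lookup_add lookup_minus algebra_simps)+

lemma scale_minus_one: "scale (- 1) p = - p"
  by (rule poly_mapping_eqI) simp

lemma scale_eq_mult: "scale c p = Poly_Mapping.single 0 c * p"
  unfolding scale_def by (rule mult_map_scale_conv_mult)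

lemma scale_mult [simp]:
  fixes p q :: "'a::comm_monoid_add \<Rightarrow>\<^sub>0 'r::comm_ring_1"
  shows "scale c p * q = scale c (p * q)" "p * scale c q = scale c (p * q)"
  by (simp_all add: scale_eq_mult mult_ac)

lemma keys_scale: "Poly_Mapping.keys (scale c p) \<subseteq> Poly_Mapping.keys p"
  by (auto simp: in_keys_iff)

lemma eval_lin_scale [simp]: "eval_lin f (scale c p) = c * eval_lin f p"
proof -
  have "eval_lin f (scale c p) = (\<Sum>a\<in>Poly_Mapping.keys p. Poly_Mapping.lookup (scale c p) a * f a)"
    by (rule eval_lin_superset) (auto dest: subsetD[OF keys_scale])
  thus ?thesis
    by (simp add: eval_lin_def sum_distrib_left mult.assoc)
qed

lemma eval_lin_uminus [simp]: "eval_lin f (- p) = - eval_lin f p"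
  using eval_lin_scale[of f "- 1" p] by (simp add: scale_minus_one)

lemma eval_lin_diff [simp]: "eval_lin f (p - q) = eval_lin f p - eval_lin f q"
  using eval_lin_add[of f p "- q"] by simp

lemma eval_lin_sum: "eval_lin f (sum g A) = (\<Sum>a\<in>A. eval_lin f (g a))"
  by (induction A rule: infinite_finite_induct) auto

lemma eval_lin_single [simp]: "eval_lin f (Poly_Mapping.single a c) = c * f a"
  by (simp add: eval_lin_def)

lemma eval_lin_one: "eval_lin f 1 = f 0"
  unfolding single_one[symmetric] eval_lin_single by simp

lemma eval_lin_cong:
  "(\<And>a. a \<in> Poly_Mapping.keys p \<Longrightarrow> f a = g a) \<Longrightarrow> eval_lin f p = eval_lin g p"
  by (simp add: eval_lin_def)

lemma eval_lin_fun_add: "eval_lin (\<lambda>a. f a + g a) p = eval_lin f p + eval_lin g p"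
  by (simp add: eval_lin_def algebra_simps sum.distrib)

lemma eval_lin_fun_diff: "eval_lin (\<lambda>a. f a - g a) p = eval_lin f p - eval_lin g p"
  by (simp add: eval_lin_def algebra_simps sum_subtractf)

lemma eval_lin_fun_mult: "eval_lin (\<lambda>a. c * f a) p = c * eval_lin f p"
  by (simp add: eval_lin_def sum_distrib_left mult.left_commute)

lemma eval_lin_fun_mult_right: "eval_lin (\<lambda>a. f a * c) p = eval_lin f p * c"
  by (simp add: eval_lin_def sum_distrib_right mult.assoc)

lemma eval_lin_fun_zero [simp]: "eval_lin (\<lambda>a. 0) p = 0"
  by (simp add: eval_lin_def)

lemma eval_lin_swap:
  "eval_lin (\<lambda>a. eval_lin (f a) q) p = eval_lin (\<lambda>b. eval_lin (\<lambda>a. f a b) p) q"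
proof -
  have "eval_lin (\<lambda>a. eval_lin (f a) q) p = (\<Sum>a\<in>Poly_Mapping.keys p. \<Sum>b\<in>Poly_Mapping.keys q.
      Poly_Mapping.lookup p a * (Poly_Mapping.lookup q b * f a b))"
    by (simp add: eval_lin_def sum_distrib_left)
  also have "\<dots> = (\<Sum>b\<in>Poly_Mapping.keys q. \<Sum>a\<in>Poly_Mapping.keys p.
      Poly_Mapping.lookup p a * (Poly_Mapping.lookup q b * f a b))"
    by (rule sum.swap)
  finally show ?thesis
    by (simp add: eval_lin_def sum_distrib_left mult.left_commute)
qed

lemma poly_mapping_eq_sum_single:
  fixes p :: "'a \<Rightarrow>\<^sub>0 'r::comm_monoid_add"
  shows "p = (\<Sum>a\<in>Poly_Mapping.keys p. Poly_Mapping.single a (Poly_Mapping.lookup p a))"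
  by (rule poly_mapping_eqI) (auto simp: lookup_sum lookup_single when_def in_keys_iff)

text \<open>Keeping \<open>a\<close> in the support of the given \<open>p\<close> hands membership
  facts about \<open>p\<close>, such as lying in \<open>free_op n\<close>, to the single terms,
  although the induction itself passes through other formal sums.\<close>

lemma linear_induct [case_names zero single add]:
  fixes p :: "'a \<Rightarrow>\<^sub>0 'r::comm_monoid_add"
  assumes "P 0" "\<And>a c. a \<in> Poly_Mapping.keys p \<Longrightarrow> P (Poly_Mapping.single a c)"
    "\<And>p q. P p \<Longrightarrow> P q \<Longrightarrow> P (p + q)"
  shows "P p"
proof -
  have "A \<subseteq> Poly_Mapping.keys p \<Longrightarrow>
      P (\<Sum>a\<in>A. Poly_Mapping.single a (Poly_Mapping.lookup p a))" for A
    by (induction A rule: infinite_finite_induct) (auto intro: assms)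
  thus ?thesis
    by (subst poly_mapping_eq_sum_single) simp
qed

lemma eval_lin_mult:
  fixes p q :: "'a::comm_monoid_add \<Rightarrow>\<^sub>0 'r::comm_ring_1"
  shows "eval_lin f (p * q) = eval_lin (\<lambda>a. eval_lin (\<lambda>b. f (a + b)) q) p"
proof (induction p rule: linear_induct)
  case (single a c)
  show ?case
    by (induction q rule: linear_induct) (auto simp: mult_single algebra_simps)
qed (auto simp: algebra_simps)

lemma eval_lin_lin_ext [simp]: "eval_lin f (lin_ext g p) = eval_lin (\<lambda>a. eval_lin f (g a)) p"
  by (simp add: lin_ext_def eval_lin_sum) (simp add: eval_lin_def)

lemma lookup_lin_ext:
  "Poly_Mapping.lookup (lin_ext g p) x = eval_lin (\<lambda>a. Poly_Mapping.lookup (g a) x) p"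
  by (simp add: lin_ext_def lookup_sum eval_lin_def)

lemma lin_ext_simps [simp]:
  "lin_ext g 0 = 0" "lin_ext g (p + q) = lin_ext g p + lin_ext g q"
  "lin_ext g (p - q) = lin_ext g p - lin_ext g q"
  "lin_ext g (scale c p) = scale c (lin_ext g p)"
  "lin_ext g (Poly_Mapping.single a c) = scale c (g a)"
  by (rule poly_mapping_eqI; simp add: lookup_lin_ext lookup_add lookup_minus)+

lemma keys_lin_ext:
  "Poly_Mapping.keys (lin_ext g p) \<subseteq> (\<Union>a\<in>Poly_Mapping.keys p. Poly_Mapping.keys (g a))"
proof
  fix x assume x: "x \<in> Poly_Mapping.keys (lin_ext g p)"
  show "x \<in> (\<Union>a\<in>Poly_Mapping.keys p. Poly_Mapping.keys (g a))"
  proof (rule ccontr)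
    assume "x \<notin> (\<Union>a\<in>Poly_Mapping.keys p. Poly_Mapping.keys (g a))"
    hence "Poly_Mapping.lookup (lin_ext g p) x = 0"
      unfolding lookup_lin_ext eval_lin_def by (intro sum.neutral) (auto simp: in_keys_iff)
    thus False using x by (simp add: in_keys_iff)
  qed
qed

lemma lin_ext_cong:
  "(\<And>a. a \<in> Poly_Mapping.keys p \<Longrightarrow> f a = g a) \<Longrightarrow> lin_ext f p = lin_ext g p"
  by (simp add: lin_ext_def)

abbreviation map_basis :: "('a \<Rightarrow> 'b) \<Rightarrow> ('a \<Rightarrow>\<^sub>0 'r) \<Rightarrow> ('b \<Rightarrow>\<^sub>0 'r::comm_ring_1)"
  where "map_basis g \<equiv> lin_ext (\<lambda>a. monom1 (g a))"

lemma map_basis_map_basis: "map_basis f (map_basis g p) = map_basis (\<lambda>a. f (g a)) p"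
  by (rule poly_mapping_eqI) (simp add: lookup_lin_ext lookup_single)

lemma map_basis_id: "(\<And>a. a \<in> Poly_Mapping.keys p \<Longrightarrow> f a = a) \<Longrightarrow> map_basis f p = p"
proof -
  assume "\<And>a. a \<in> Poly_Mapping.keys p \<Longrightarrow> f a = a"
  hence "map_basis f p = lin_ext (\<lambda>a. monom1 a) p"
    by (intro lin_ext_cong) simp
  also have "\<dots> = p"
    by (simp add: lin_ext_def poly_mapping_eq_sum_single[symmetric])
  finally show ?thesis .
qed

lemma keys_map_basis: "Poly_Mapping.keys (map_basis f p) \<subseteq> f ` Poly_Mapping.keys p"
  using keys_lin_ext[of "\<lambda>a. monom1 (f a)" p] by (auto split: if_splits)

section \<open>Leaves of grafted trees\<close>

lemma leaves_ne [simp]: "leaves t \<noteq> []"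
  by (induction t) auto

lemma map_tree_graft: "map_tree f t = graft (\<lambda>l. Leaf (f l)) t"
  by (induction t) auto

lemma leaves_map_tree [simp]: "leaves (map_tree f t) = map f (leaves t)"
  by (induction t) auto

lemma set_leaves_graft [simp]:
  "set (leaves (graft \<sigma> t)) = (\<Union>j\<in>set (leaves t). set (leaves (\<sigma> j)))"
  by (induction t) auto

lemma distinct_leaves_graft:
  assumes "distinct (leaves t)" "\<And>j. j \<in> set (leaves t) \<Longrightarrow> distinct (leaves (\<sigma> j))"
    "disjoint_family_on (\<lambda>j. set (leaves (\<sigma> j))) (set (leaves t))"
  shows "distinct (leaves (graft \<sigma> t))"
  using assms
proof (induction t)
  case (Dot s t)
  have "disjoint_family_on (\<lambda>j. set (leaves (\<sigma> j))) (set (leaves s))"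
    "disjoint_family_on (\<lambda>j. set (leaves (\<sigma> j))) (set (leaves t))"
    by (rule disjoint_family_on_mono[OF _ Dot.prems(3)]; simp)+
  moreover have "set (leaves (\<sigma> i)) \<inter> set (leaves (\<sigma> j)) = {}"
    if "i \<in> set (leaves s)" "j \<in> set (leaves t)" for i j
    using Dot.prems that by (intro disjoint_family_onD[OF Dot.prems(3)]) auto
  ultimately show ?case using Dot by auto
next
  case (Brk s t)
  have "disjoint_family_on (\<lambda>j. set (leaves (\<sigma> j))) (set (leaves s))"
    "disjoint_family_on (\<lambda>j. set (leaves (\<sigma> j))) (set (leaves t))"
    by (rule disjoint_family_on_mono[OF _ Brk.prems(3)]; simp)+
  moreover have "set (leaves (\<sigma> i)) \<inter> set (leaves (\<sigma> j)) = {}"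
    if "i \<in> set (leaves s)" "j \<in> set (leaves t)" for i j
    using Brk.prems that by (intro disjoint_family_onD[OF Brk.prems(3)]) auto
  ultimately show ?case using Brk by auto
qed auto

text \<open>The leaf set that replaces the input \<open>j\<close> under partial composition at
  \<open>i\<close> with an operation of arity \<open>m\<close>.\<close>

definition comp_block :: "nat \<Rightarrow> nat \<Rightarrow> nat \<Rightarrow> nat set"
  where "comp_block i m j = (if j < i then {j} else if j = i then {i..<i+m} else {j+m-1})"

lemma disjoint_comp_block:
  assumes "m \<ge> 1"
  shows "disjoint_family_on (comp_block i m) J"
  unfolding disjoint_family_on_def
proof (intro ballI impI)
  fix j k :: nat assume "j \<noteq> k"
  thus "comp_block i m j \<inter> comp_block i m k = {}"
    using assms by (cases j i rule: linorder_cases; cases k i rule: linorder_cases)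
      (auto simp: comp_block_def)
qed

lemma UN_comp_block:
  assumes i: "i \<in> {1..n}" and m: "m \<ge> 1"
  shows "(\<Union>j\<in>{1..n}. comp_block i m j) = {1..n+m-1}"
proof (intro equalityI subsetI)
  fix x assume x: "x \<in> {1..n+m-1}"
  consider "x < i" | "i \<le> x" "x < i + m" | "x \<ge> i + m" by linarith
  thus "x \<in> (\<Union>j\<in>{1..n}. comp_block i m j)"
  proof cases
    case 1 thus ?thesis using x i by (intro UN_I[of x]) (auto simp: comp_block_def)
  next
    case 2 thus ?thesis using x i by (intro UN_I[of i]) (auto simp: comp_block_def)
  next
    case 3
    hence "x + 1 - m > i" using m by linarith
    hence "x \<in> comp_block i m (x + 1 - m)" using m by (simp add: comp_block_def)
    thus ?thesis using x i m by (intro UN_I[of "x + 1 - m"]) (use \<open>x + 1 - m > i\<close> in auto)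
  qed
next
  fix x assume "x \<in> (\<Union>j\<in>{1..n}. comp_block i m j)"
  then obtain j where "j \<in> {1..n}" "x \<in> comp_block i m j" by blast
  thus "x \<in> {1..n+m-1}"
    using i m by (cases j i rule: linorder_cases) (auto simp: comp_block_def)
qed

lemma tree_monomials_arity:
  assumes "s \<in> tree_monomials m"
  shows "m \<ge> 1"
  using assms leaves_ne[of s] by (cases m) (auto simp: tree_monomials_def)

definition comp_leaf :: "nat \<Rightarrow> nat \<Rightarrow> nat tree \<Rightarrow> nat \<Rightarrow> nat tree" where
  "comp_leaf i m s j = (if j < i then Leaf j else if j = i then map_tree (\<lambda>l. l + i - 1) s
    else Leaf (j + m - 1))"

lemma tree_comp_eq_graft: "tree_comp i m t s = graft (comp_leaf i m s) t"
  by (simp add: tree_comp_def comp_leaf_def[abs_def])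

lemma leaves_comp_leaf:
  assumes "s \<in> tree_monomials m" "i \<ge> 1"
  shows "set (leaves (comp_leaf i m s j)) = comp_block i m j"
      "distinct (leaves (comp_leaf i m s j))"
proof -
  have "(\<lambda>l. l + i - 1) ` {1..m} = {i..<i+m}"
  proof (intro equalityI subsetI)
    fix x assume "x \<in> {i..<i+m}"
    hence "x = (x - i + 1) + i - 1" "x - i + 1 \<in> {1..m}" by auto
    thus "x \<in> (\<lambda>l. l + i - 1) ` {1..m}" by (rule image_eqI)
  qed (use assms in auto)
  thus "set (leaves (comp_leaf i m s j)) = comp_block i m j"
    using assms(1) by (simp add: comp_leaf_def comp_block_def tree_monomials_def)
  show "distinct (leaves (comp_leaf i m s j))"
    using assms by (auto simp: comp_leaf_def tree_monomials_def distinct_map inj_on_def)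
qed

lemma tree_comp_in_tree_monomials:
  assumes t: "t \<in> tree_monomials n" and s: "s \<in> tree_monomials m" and i: "i \<in> {1..n}"
  shows "tree_comp i m t s \<in> tree_monomials (n + m - 1)"
proof -
  have m: "m \<ge> 1" using s by (rule tree_monomials_arity)
  have lv: "set (leaves (comp_leaf i m s j)) = comp_block i m j"
    "distinct (leaves (comp_leaf i m s j))" for j
    using leaves_comp_leaf[OF s] i by auto
  have t': "set (leaves t) = {1..n}" "distinct (leaves t)" using t
      by (auto simp: tree_monomials_def)
  have "distinct (leaves (graft (comp_leaf i m s) t))"
    using t'(2) lv disjoint_comp_block[OF m] by (intro distinct_leaves_graft) simp_all
  moreover have "set (leaves (graft (comp_leaf i m s) t)) = {1..n+m-1}"
    unfolding set_leaves_graft t'(1) lv by (rule UN_comp_block[OF i m])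
  ultimately show ?thesis
    by (simp add: tree_monomials_def tree_comp_eq_graft)
qed

lemma keys_tensor_op:
  assumes "x \<in> Poly_Mapping.keys (tensor_op \<mu> \<nu> P Q)"
  obtains a a' b b' where "x = (\<mu> a b, \<nu> a' b')" "(a, a') \<in> Poly_Mapping.keys P"
    "(b, b') \<in> Poly_Mapping.keys Q"
proof -
  let ?g = "\<lambda>(s, s') (t, t'). (\<mu> s t, \<nu> s' t')"
  from subsetD[OF keys_lin_ext, OF assms[unfolded tensor_op_def bilin_ext_def]]
  obtain p where p: "p \<in> Poly_Mapping.keys P" "x \<in> Poly_Mapping.keys (map_basis (?g p) Q)"
    by (rule UN_E)
  from subsetD[OF keys_map_basis p(2)]
  obtain q where "x = ?g p q" "q \<in> Poly_Mapping.keys Q"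
    by (rule imageE)
  thus ?thesis using p(1) that[of "fst p" "fst q" "snd p" "snd q"] by (simp add: split_beta)
qed

lemma leaves_tensor_op:
  assumes "(s, s') \<in> Poly_Mapping.keys (tensor_op \<mu> \<nu> P Q)"
    and P: "\<And>a a'. (a, a') \<in> Poly_Mapping.keys P \<Longrightarrow> leaves a = K \<and> leaves a' = K"
    and Q: "\<And>b b'. (b, b') \<in> Poly_Mapping.keys Q \<Longrightarrow> leaves b = L \<and> leaves b' = L"
    and "\<And>a b. leaves (\<mu> a b) = leaves a @ leaves b" "\<And>a b. leaves (\<nu> a b) = leaves a @ leaves b"
  shows "leaves s = K @ L \<and> leaves s' = K @ L"
proof -
  from assms(1) obtain a a' b b' where "(s, s') = (\<mu> a b, \<nu> a' b')"
    "(a, a') \<in> Poly_Mapping.keys P" "(b, b') \<in> Poly_Mapping.keys Q"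
    by (rule keys_tensor_op)
  thus ?thesis using P[of a a'] Q[of b b'] assms(4,5) by simp
qed

text \<open>Every term of the coproduct acts on the two subtrees in place, so the planar leaf word
  survives in both tensor factors. Hence the factors are tree monomials of the same arity, and
  \<open>cross\<close> takes the same values on them as on \<open>t\<close>.\<close>

lemma keys_coprod:
  "(s, s') \<in> Poly_Mapping.keys (tree_coprod h t) \<Longrightarrow> leaves s = leaves t \<and> leaves s' = leaves t"
proof (induction t arbitrary: s s')
  case (Leaf l)
  thus ?case by (auto split: if_splits)
next
  case (Dot t u)
  from Dot.prems have "(s, s') \<in> Poly_Mapping.keys (tensor_op Dot Dot (tree_coprod h t) (tree_coprod
      h u)) \<or>
      (s, s') \<in> Poly_Mapping.keys (tensor_op Brk Brk (tree_coprod h t) (tree_coprod h u))"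
    unfolding tree_coprod.simps by (blast dest: subsetD[OF keys_add] subsetD[OF keys_scale])
  thus ?case unfolding leaves.simps by (elim disjE leaves_tensor_op[OF _ Dot.IH]) simp_all
next
  case (Brk t u)
  from Brk.prems have "(s, s') \<in> Poly_Mapping.keys (tensor_op Brk Dot (tree_coprod h t) (tree_coprod
      h u)) \<or>
      (s, s') \<in> Poly_Mapping.keys (tensor_op Dot Brk (tree_coprod h t) (tree_coprod h u))"
    unfolding tree_coprod.simps by (blast dest: subsetD[OF keys_add])
  thus ?case unfolding leaves.simps by (elim disjE leaves_tensor_op[OF _ Brk.IH]) simp_all
qed

section \<open>The pairing of monomials with trees\<close>

text \<open>For the exponent function \<open>w\<close> of a monomial, this is its degree in the
  variables that point from \<open>A\<close> to \<open>B\<close>.\<close>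

definition cross :: "('l \<times> 'l \<Rightarrow> nat) \<Rightarrow> 'l set \<Rightarrow> 'l set \<Rightarrow> nat"
  where "cross w A B = (\<Sum>a\<in>A. \<Sum>b\<in>B. w (a, b))"

lemma cross_simps [simp]:
  "cross (\<lambda>e. 0) A B = 0"
  "cross (\<lambda>e. v e + w e) A B = cross v A B + cross w A B"
  "cross w {a} {b} = w (a, b)" "cross w {} B = 0" "cross w A {} = 0"
  by (simp_all add: cross_def sum.distrib)

lemma cross_insert:
  "finite A \<Longrightarrow> a \<notin> A \<Longrightarrow> cross w (insert a A) B = cross w {a} B + cross w A B"
  "finite B \<Longrightarrow> b \<notin> B \<Longrightarrow> cross w A (insert b B) = cross w A {b} + cross w A B"
  by (simp_all add: cross_def sum.distrib)

lemma cross_Un: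
  "finite A \<Longrightarrow> finite A' \<Longrightarrow> A \<inter> A' = {} \<Longrightarrow> cross w (A \<union> A') B = cross w A B + cross w A' B"
  "finite B \<Longrightarrow> finite B' \<Longrightarrow> B \<inter> B' = {} \<Longrightarrow> cross w A (B \<union> B') = cross w A B + cross w A B'"
  by (simp_all add: cross_def sum.union_disjoint sum.distrib)

lemma cross_cong:
  "(\<And>a b. a \<in> A \<Longrightarrow> b \<in> B \<Longrightarrow> v (a, b) = w (a, b)) \<Longrightarrow> cross v A B = cross w A B"
  by (simp add: cross_def cong: sum.cong)

text \<open>Used to push the exponents on the leaves of a grafted tree down to the inputs of the
  outer tree, by summing over blocks.\<close>

lemma cross_UNION:
  assumes "finite J" "finite K" "\<And>j. j \<in> J \<union> K \<Longrightarrow> finite (B j)" "disjoint_family_on B (J \<union> K)"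
  shows "cross w (\<Union>j\<in>J. B j) (\<Union>k\<in>K. B k) = cross (\<lambda>(j, k). cross w (B j) (B k)) J K"
proof -
  have *: "sum f (\<Union>j\<in>I. B j) = (\<Sum>j\<in>I. sum f (B j))" if "I = J \<or> I = K" for I and f :: "_ \<Rightarrow> nat"
    using assms that by (intro sum.UNION_disjoint) (auto simp: disjoint_family_on_def)
  have "cross w (\<Union>j\<in>J. B j) (\<Union>k\<in>K. B k) = (\<Sum>j\<in>J. \<Sum>a\<in>B j. \<Sum>k\<in>K. \<Sum>b\<in>B k. w (a, b))"
    unfolding cross_def by (simp add: *)
  also have "\<dots> = (\<Sum>j\<in>J. \<Sum>k\<in>K. \<Sum>a\<in>B j. \<Sum>b\<in>B k. w (a, b))"
    by (intro sum.cong refl sum.swap)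
  finally show ?thesis by (simp add: cross_def)
qed

definition unit_wt :: "'l \<times> 'l \<Rightarrow> 'l \<times> 'l \<Rightarrow> nat"
  where "unit_wt e x = (if x = e then 1 else 0)"

lemma cross_unit_wt [simp]:
  assumes "finite A" "finite B"
  shows "cross (unit_wt (i, j)) A B = (if i \<in> A \<and> j \<in> B then 1 else 0)"
proof -
  have "unit_wt (i, j) (a, b) = (if b = j then if a = i then 1 else 0 else 0)" for a b
    by (simp add: unit_wt_def)
  thus ?thesis
    using assms by (auto simp: cross_def sum.delta)
qed

lemma lookup_unit_wt: "Poly_Mapping.lookup (Poly_Mapping.single e (Suc 0)) = unit_wt e"
  by (auto simp: unit_wt_def lookup_single when_def fun_eq_iff)

text \<open>Only 2 is inverted, so that the locale covers the non-unit \<open>fps_X\<close> as well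
  as every specialization, including 0.\<close>

locale half_scalar =
  fixes h half :: "'r::comm_ring_1"
  assumes half: "2 * half = 1"
begin

text \<open>
  \<open>fwd a b\<close> is the factor with which a monomial having \<open>a\<close> variables \<open>x\<^sub>i\<^sub>j\<close> with \<open>i\<close> on the left
  and \<open>j\<close> on the right, and \<open>b\<close> variables in the opposite direction, is evaluated on an associative
  product.  The bracket is the commutator divided by \<open>2 h\<close>; the constant terms at \<open>a = b = 0\<close>
  cancel, so that the division by \<open>h\<close> lowers an exponent.
\<close>

definition fwd :: "nat \<Rightarrow> nat \<Rightarrow> 'r"
  where "fwd a b = (if b = 0 then h ^ a else 0)"

definition fwd_quot :: "nat \<Rightarrow> nat \<Rightarrow> 'r"
  where "fwd_quot a b = (if b = 0 \<and> a > 0 then h ^ (a - 1) else 0)"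

definition dot_wt :: "nat \<Rightarrow> nat \<Rightarrow> 'r"
  where "dot_wt a b = half * (fwd a b + fwd b a)"

definition brk_wt :: "nat \<Rightarrow> nat \<Rightarrow> 'r"
  where "brk_wt a b = half * (fwd_quot a b - fwd_quot b a)"

text \<open>On a tree with distinct leaves, an off-diagonal variable between two of them is counted
  at exactly one node: the one where its two indices part.\<close>

primrec pairing :: "('l \<times> 'l \<Rightarrow> nat) \<Rightarrow> 'l tree \<Rightarrow> 'r" where
  "pairing w (Leaf l) = 1"
| "pairing w (Dot s t) =
     dot_wt (cross w (set (leaves s)) (set (leaves t))) (cross w (set (leaves t)) (set (leaves s)))
     * pairing w s * pairing w t"
| "pairing w (Brk s t) =
     brk_wt (cross w (set (leaves s)) (set (leaves t))) (cross w (set (leaves t)) (set (leaves s)))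
     * pairing w s * pairing w t"

lemma half_add_half: "half + half = 1"
  using half by (simp only: mult_2)

lemma half_mult_add: "half * x + half * x = x"
  by (metis distrib_right half_add_half mult_1)

lemma half_two [simp]: "half * 2 = 1" "half * (2 * x) = x"
  by (metis half mult.commute, metis half mult.assoc mult.commute mult_1)

lemma mult_half_mult_add: "a * (half * x) + a * (half * x) = a * x"
  using distrib_left[of a "half * x" "half * x"] by (simp only: half_mult_add)

lemma wt_simps:
  "dot_wt 0 0 = 1" "brk_wt 0 0 = 0"
  "dot_wt (Suc a) 0 = half * h ^ Suc a" "dot_wt 0 (Suc a) = half * h ^ Suc a"
  "dot_wt (Suc a) (Suc b) = 0" "brk_wt (Suc a) (Suc b) = 0"
  "brk_wt (Suc a) 0 = half * h ^ a" "brk_wt 0 (Suc a) = - (half * h ^ a)"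
  by (simp_all add: dot_wt_def brk_wt_def fwd_def fwd_quot_def distrib_left half_add_half)

lemma wt_sym: "dot_wt a b = dot_wt b a" "brk_wt a b = - brk_wt b a"
  by (simp_all add: dot_wt_def brk_wt_def right_diff_distrib add.commute)

text \<open>The weight form of \<open>a * b = a . b + h [a, b]\<close>.\<close>

lemma wt_fwd: "dot_wt a b + h * brk_wt a b = fwd a b"
  by (cases a; cases b) (simp_all add: wt_simps fwd_def mult.left_commute half_mult_add)

text \<open>The shape of the coproduct of the dot, with sums of exponents in place of tensor
  factors: it reflects that \<open>fwd\<close> turns sums into products, i.e. that the associative
  product is group-like. As \<open>h\<close> cannot be cancelled, the cases of zero and nonzero
  exponents are checked directly. \<open>brk_wt_add\<close> is the counterpart for the
  bracket.\<close>

lemma dot_wt_add: "dot_wt (a + a') (b + b') =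
    dot_wt a b * dot_wt a' b' + h\<^sup>2 * (brk_wt a b * brk_wt a' b')"
  by (cases a; cases b; cases a'; cases b')
     (simp_all add: wt_simps power_add power2_eq_square mult_ac half_mult_add mult_half_mult_add)

lemma brk_wt_add: "brk_wt (a + a') (b + b') = brk_wt a b * dot_wt a' b' + dot_wt a b * brk_wt a' b'"
  by (cases a; cases b; cases a'; cases b')
     (simp_all add: wt_simps power_add mult_ac half_mult_add mult_half_mult_add
         minus_add_distrib[symmetric]
        del: minus_add_distrib)

lemma pairing_cong:
  "(\<And>a b. a \<in> set (leaves t) \<Longrightarrow> b \<in> set (leaves t) \<Longrightarrow> v (a, b) = w (a, b)) \<Longrightarrow>
    pairing v t = pairing w t"
proof (induction t)
  case (Dot s t)
  have "cross v (set (leaves s)) (set (leaves t)) = cross w (set (leaves s)) (set (leaves t))"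
    "cross v (set (leaves t)) (set (leaves s)) = cross w (set (leaves t)) (set (leaves s))"
    by (intro cross_cong; use Dot.prems in auto)+
  thus ?case using Dot by auto
next
  case (Brk s t)
  have "cross v (set (leaves s)) (set (leaves t)) = cross w (set (leaves s)) (set (leaves t))"
    "cross v (set (leaves t)) (set (leaves s)) = cross w (set (leaves t)) (set (leaves s))"
    by (intro cross_cong; use Brk.prems in auto)+
  thus ?case using Brk by auto
qed auto

lemma pairing_counit: "pairing (\<lambda>e. 0) t = tree_counit t"
  by (induction t) (auto simp: wt_simps)

text \<open>The weights \<open>c\<close> and \<open>d\<close> must be the same for all terms. For
  coproducts they are, because the leaf sets are constant over the support.\<close>

lemma eval_tensor_op:
  assumes "\<And>s s' t t'. (s, s') \<in> Poly_Mapping.keys P \<Longrightarrow> (t, t') \<in> Poly_Mapping.keys Q \<Longrightarrow>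
      f (\<mu> s t) = c * f s * f t \<and> g (\<nu> s' t') = d * g s' * g t'"
  shows "eval_lin (\<lambda>(s, s'). f s * g s') (tensor_op \<mu> \<nu> P Q) =
    c * d * eval_lin (\<lambda>(s, s'). f s * g s') P * eval_lin (\<lambda>(s, s'). f s * g s') Q"
proof -
  have "eval_lin (\<lambda>(s, s'). f s * g s') (tensor_op \<mu> \<nu> P Q) =
      eval_lin (\<lambda>a. eval_lin (\<lambda>b. (c * d * (f (fst a) * g (snd a))) * (f (fst b) * g (snd b))) Q) P"
    unfolding tensor_op_def bilin_ext_def
    by (simp add: split_beta, intro eval_lin_cong)
       (use assms in \<open>auto simp: mult_ac simp flip: prod.collapse\<close>)
  also have "\<dots> = c * d * eval_lin (\<lambda>(s, s'). f s * g s') P * eval_lin (\<lambda>(s, s'). f s * g s') Q"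
    by (simp add: eval_lin_fun_mult eval_lin_fun_mult_right split_def)
  finally show ?thesis .
qed

text \<open>At each node the two terms of the coproduct yield the two terms of
  \<open>dot_wt_add\<close> or \<open>brk_wt_add\<close>, so adding exponents is adjoint to the
  coproduct.\<close>

lemma pairing_coprod:
  "eval_lin (\<lambda>(s, s'). pairing v s * pairing w s') (tree_coprod h t) = pairing (\<lambda>e. v e + w e) t"
proof (induction t)
  case (Dot s t)
  let ?c = "\<lambda>w. cross w (set (leaves s)) (set (leaves t))" and ?c' =
      "\<lambda>w. cross w (set (leaves t)) (set (leaves s))"
  have d: "eval_lin (\<lambda>(s, s').
      pairing v s * pairing w s') (tensor_op Dot Dot (tree_coprod h s) (tree_coprod h t)) =
      dot_wt (?c v) (?c' v) * dot_wt (?c w) (?c' w) * pairing (\<lambda>e. v e + w e) s * pairing (\<lambda>e.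
          v e + w e) t"
    unfolding Dot.IH[symmetric] by (rule eval_tensor_op) (auto dest!: keys_coprod)
  have b: "eval_lin (\<lambda>(s, s').
      pairing v s * pairing w s') (tensor_op Brk Brk (tree_coprod h s) (tree_coprod h t)) =
      brk_wt (?c v) (?c' v) * brk_wt (?c w) (?c' w) * pairing (\<lambda>e. v e + w e) s * pairing (\<lambda>e.
          v e + w e) t"
    unfolding Dot.IH[symmetric] by (rule eval_tensor_op) (auto dest!: keys_coprod)
  show ?case
    by (simp add: d b dot_wt_add algebra_simps)
next
  case (Brk s t)
  let ?c = "\<lambda>w. cross w (set (leaves s)) (set (leaves t))" and ?c' =
      "\<lambda>w. cross w (set (leaves t)) (set (leaves s))"
  have d: "eval_lin (\<lambda>(s, s').
      pairing v s * pairing w s') (tensor_op Brk Dot (tree_coprod h s) (tree_coprod h t)) =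
      brk_wt (?c v) (?c' v) * dot_wt (?c w) (?c' w) * pairing (\<lambda>e. v e + w e) s * pairing (\<lambda>e.
          v e + w e) t"
    unfolding Brk.IH[symmetric] by (rule eval_tensor_op) (auto dest!: keys_coprod)
  have b: "eval_lin (\<lambda>(s, s').
      pairing v s * pairing w s') (tensor_op Dot Brk (tree_coprod h s) (tree_coprod h t)) =
      dot_wt (?c v) (?c' v) * brk_wt (?c w) (?c' w) * pairing (\<lambda>e. v e + w e) s * pairing (\<lambda>e.
          v e + w e) t"
    unfolding Brk.IH[symmetric] by (rule eval_tensor_op) (auto dest!: keys_coprod)
  show ?case
    by (simp add: d b brk_wt_add algebra_simps)
qed auto

end

section \<open>Closure properties of the free operad\<close>

lemma keys_minus_subset:
  fixes p q :: "'a \<Rightarrow>\<^sub>0 'r::ab_group_add"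
  shows "Poly_Mapping.keys (p - q) \<subseteq> Poly_Mapping.keys p \<union> Poly_Mapping.keys q"
  by (auto simp: in_keys_iff lookup_minus)

lemma free_op_closed [intro]:
  "0 \<in> free_op n"
  "p \<in> free_op n \<Longrightarrow> q \<in> free_op n \<Longrightarrow> p + q \<in> free_op n"
  "p \<in> free_op n \<Longrightarrow> q \<in> free_op n \<Longrightarrow> p - q \<in> free_op n"
  "p \<in> free_op n \<Longrightarrow> scale c p \<in> free_op n"
  "t \<in> tree_monomials n \<Longrightarrow> Poly_Mapping.single t c \<in> free_op n"
  unfolding free_op_def
  using keys_add[of p q] keys_minus_subset[of p q] keys_scale[of c p] by auto

lemma map_basis_free_op:
  assumes "p \<in> free_op n" "\<And>t. t \<in> tree_monomials n \<Longrightarrow> f t \<in> tree_monomials m"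
  shows "map_basis f p \<in> free_op m"
  using assms keys_map_basis[of f p] by (fastforce simp: free_op_def)

lemma op_comp_free_op:
  assumes "p \<in> free_op n" "q \<in> free_op m" "i \<in> {1..n}"
  shows "op_comp i m p q \<in> free_op (n + m - 1)"
proof -
  have "Poly_Mapping.keys (op_comp i m p q) \<subseteq>
    (\<Union>t\<in>Poly_Mapping.keys p. tree_comp i m t ` Poly_Mapping.keys q)"
    unfolding op_comp_def bilin_ext_def
    by (intro order_trans[OF keys_lin_ext] UN_mono order_refl keys_map_basis)
  thus ?thesis
    using assms tree_comp_in_tree_monomials[of _ n _ m i] by (fastforce simp: free_op_def)
qed

lemma map_tree_in_tree_monomials:
  "\<sigma> permutes {1..n} \<Longrightarrow> t \<in> tree_monomials n \<Longrightarrow> map_tree \<sigma> t \<in> tree_monomials n"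
  by (auto simp: tree_monomials_def distinct_map permutes_image permutes_inj_on)

lemma tree_monomials_3:
  "t \<in> tree_monomials 3 \<longleftrightarrow> distinct (leaves t) \<and> set (leaves t) = {1, 2, 3}"
  "t \<in> tree_monomials 2 \<longleftrightarrow> distinct (leaves t) \<and> set (leaves t) = {1, 2}"
proof -
  have "{1..3::nat} = {1, 2, 3}" "{1..2::nat} = {1, 2}" by auto
  thus "t \<in> tree_monomials 3 \<longleftrightarrow> distinct (leaves t) \<and> set (leaves t) = {1, 2, 3}"
    "t \<in> tree_monomials 2 \<longleftrightarrow> distinct (leaves t) \<and> set (leaves t) = {1, 2}"
    by (simp_all add: tree_monomials_def)
qed

lemma LL_relations_free_op: "p \<in> LL_relations h n \<Longrightarrow> p \<in> free_op n"
  by (auto simp: LL_relations_def Let_def tree_monomials_3 insert_commute split: if_splits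
      intro!: free_op_closed)

lemma operad_ideal_free_op: "operad_ideal (LL_relations h) n p \<Longrightarrow> p \<in> free_op n"
proof (induction rule: operad_ideal.induct)
  case (perm n p \<sigma>)
  thus ?case unfolding perm_act_def
    by (intro map_basis_free_op[OF perm.IH] map_tree_in_tree_monomials)
qed (auto intro: LL_relations_free_op op_comp_free_op simp del: One_nat_def)

section \<open>The pairing vanishes on the operadic ideal\<close>

context half_scalar
begin

text \<open>A variable inside one inserted tree only meets nodes of that tree. A variable between
  two inserted trees only meets a node of the outer tree, where it acts like a variable between the
  two inputs. So the pairing factors once exponents are summed over blocks.\<close>

lemma pairing_graft:
  assumes "\<And>j. j \<in> set (leaves t) \<Longrightarrow> set (leaves (\<sigma> j)) = B j" "distinct (leaves t)"
    "disjoint_family_on B (set (leaves t))"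
  shows "pairing w (graft \<sigma> t) =
    pairing (\<lambda>(j, k). cross w (B j) (B k)) t * (\<Prod>j\<in>set (leaves t). pairing w (\<sigma> j))"
proof -
  have cr: "cross w (set (leaves (graft \<sigma> s))) (set (leaves (graft \<sigma> s'))) =
      cross (\<lambda>(j, k). cross w (B j) (B k)) (set (leaves s)) (set (leaves s'))"
    if "set (leaves s) \<subseteq> set (leaves t)" "set (leaves s') \<subseteq> set (leaves t)" for s s'
  proof -
    have fin: "finite (B j)" if "j \<in> set (leaves t)" for j
      using assms(1)[OF that] by (metis finite_set)
    have "cross w (set (leaves (graft \<sigma> s))) (set (leaves (graft \<sigma> s'))) =
        cross w (\<Union>j\<in>set (leaves s). B j) (\<Union>j\<in>set (leaves s'). B j)"
      unfolding set_leaves_graft using assms(1) that by (intro arg_cong2[of _ _ _ _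
          "cross w"] SUP_cong) auto
    also have "\<dots> = cross (\<lambda>(j, k). cross w (B j) (B k)) (set (leaves s)) (set (leaves s'))"
      using that fin by (intro cross_UNION disjoint_family_on_mono[OF _ assms(3)]) auto
    finally show ?thesis .
  qed
  have "set (leaves u) \<subseteq> set (leaves t) \<Longrightarrow> distinct (leaves u) \<Longrightarrow> pairing w (graft \<sigma> u) =
      pairing (\<lambda>(j, k). cross w (B j) (B k)) u * (\<Prod>j\<in>set (leaves u). pairing w (\<sigma> j))" for u
    by (induction u) (simp_all add: cr prod.union_disjoint mult_ac del: set_leaves_graft)
  thus ?thesis using assms(2) by blast
qed

lemma pairing_map_tree:
  assumes "inj_on f (set (leaves t))" "distinct (leaves t)"
  shows "pairing w (map_tree f t) = pairing (\<lambda>(j, k). w (f j, f k)) t"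
  using pairing_graft[of t "\<lambda>l. Leaf (f l)" "\<lambda>j. {f j}" w] assms
  by (simp add: map_tree_graft disjoint_family_on_def inj_on_eq_iff)

text \<open>One factor depends on \<open>t\<close> alone and the other on \<open>s\<close> alone.
  This is what makes the vanishing of the pairing stable under composition on either side.\<close>

lemma pairing_tree_comp:
  assumes t: "t \<in> tree_monomials n" and s: "s \<in> tree_monomials m" and i: "i \<in> {1..n}"
  shows "pairing w (tree_comp i m t s) =
    pairing (\<lambda>(j, k). cross w (comp_block i m j) (comp_block i m k)) t
    * pairing (\<lambda>(j, k). w (j + i - 1, k + i - 1)) s"
proof -
  have "(\<Prod>j\<in>{1..n}. pairing w (comp_leaf i m s j)) =
      (\<Prod>j\<in>{1..n}. if j = i then pairing w (map_tree (\<lambda>l. l + i - 1) s) else 1)"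
    by (intro prod.cong) (auto simp: comp_leaf_def)
  also have "\<dots> = pairing (\<lambda>(j, k). w (j + i - 1, k + i - 1)) s"
    using i s by (subst prod.delta, simp, subst pairing_map_tree) (auto
        simp: tree_monomials_def inj_on_def)
  finally have *: "(\<Prod>j\<in>{1..n}. pairing w (comp_leaf i m s j)) =
    pairing (\<lambda>(j, k). w (j + i - 1, k + i - 1)) s" .
  have t': "set (leaves t) = {1..n}" "distinct (leaves t)" using t
      by (auto simp: tree_monomials_def)
  show ?thesis unfolding tree_comp_eq_graft *[symmetric] t'(1)[symmetric]
    using leaves_comp_leaf(1)[OF s, of i] i disjoint_comp_block[OF tree_monomials_arity[OF s]] t'
    by (intro pairing_graft) auto
qed

lemma cross_pair:
  "a \<noteq> b \<Longrightarrow> cross w {a, b} {c} = w (a, c) + w (b, c)"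
  "a \<noteq> b \<Longrightarrow> cross w {c} {a, b} = w (c, a) + w (c, b)"
  by (simp_all add: cross_def)

lemma pairing_LL_relations:
  assumes "p \<in> LL_relations h n"
  shows "eval_lin (pairing w) p = 0"
proof -
  \<comment> \<open>The addition rules reduce all weights to those of single pairs of inputs. Once
    these are oriented with the smaller input first, each relation becomes a polynomial
    identity.\<close>
  have d: "dot_wt (w (2, 1)) (w (1, 2)) = dot_wt (w (1, 2)) (w (2, 1))"
    "dot_wt (w (3, 2)) (w (2, 3)) = dot_wt (w (2, 3)) (w (3, 2))"
    "dot_wt (w (3, 1)) (w (1, 3)) = dot_wt (w (1, 3)) (w (3, 1))"
    "brk_wt (w (2, 1)) (w (1, 2)) = - brk_wt (w (1, 2)) (w (2, 1))"
    "brk_wt (w (3, 2)) (w (2, 3)) = - brk_wt (w (2, 3)) (w (3, 2))"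
    "brk_wt (w (3, 1)) (w (1, 3)) = - brk_wt (w (1, 3)) (w (3, 1))"
    by (rule wt_sym)+
  show ?thesis
    using assms
    by (auto simp only: LL_relations_def Let_def insert_iff empty_iff split: if_splits)
      (simp_all add: cross_pair dot_wt_add brk_wt_add d algebra_simps del: One_nat_def)
qed

theorem pairing_operad_ideal:
  "operad_ideal (LL_relations h) n p \<Longrightarrow> eval_lin (pairing w) p = 0"
\<comment> \<open>The exponents must vary: permutations relabel them, and compositions sum them over
  blocks or shift them.\<close>
proof (induction arbitrary: w rule: operad_ideal.induct)
  case (gen p n)
  thus ?case by (rule pairing_LL_relations)
next
  case (perm n p \<sigma>)
  have "eval_lin (pairing w) (perm_act \<sigma> p) = eval_lin (\<lambda>t. pairing (\<lambda>(j, k). w (\<sigma> j, \<sigma> k)) t) p"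
    unfolding perm_act_def eval_lin_lin_ext using operad_ideal_free_op[OF perm.hyps(1)] perm.hyps(2)
    by (intro eval_lin_cong)
       (auto simp: free_op_def tree_monomials_def permutes_inj_on intro!: pairing_map_tree)
  thus ?case using perm.IH by simp
next
  case (comp_left n p q m i)
  have "eval_lin (pairing w) (op_comp i m p q) = eval_lin (\<lambda>t. eval_lin (\<lambda>s.
      pairing (\<lambda>(j, k). cross w (comp_block i m j) (comp_block i m k)) t
      * pairing (\<lambda>(j, k). w (j + i - 1, k + i - 1)) s) q) p"
    unfolding op_comp_def bilin_ext_def eval_lin_lin_ext eval_lin_single mult_1
    using operad_ideal_free_op[OF comp_left.hyps(1)] comp_left.hyps(2,3)
    by (intro eval_lin_cong pairing_tree_comp[of _ n]) (auto simp: free_op_def)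
  thus ?case using comp_left.IH by (simp add: eval_lin_fun_mult eval_lin_fun_mult_right)
next
  case (comp_right p n m q i)
  have "eval_lin (pairing w) (op_comp i m p q) = eval_lin (\<lambda>t. eval_lin (\<lambda>s.
      pairing (\<lambda>(j, k). cross w (comp_block i m j) (comp_block i m k)) t
      * pairing (\<lambda>(j, k). w (j + i - 1, k + i - 1)) s) q) p"
    unfolding op_comp_def bilin_ext_def eval_lin_lin_ext eval_lin_single mult_1
    using operad_ideal_free_op[OF comp_right.hyps(2)] comp_right.hyps(1,3)
    by (intro eval_lin_cong pairing_tree_comp[of _ n]) (auto simp: free_op_def)
  thus ?case using comp_right.IH by (simp add: eval_lin_fun_mult eval_lin_fun_mult_right)
qed auto

section \<open>The relations among the generators, evaluated on trees\<close>

lemma pairing_unit_wt_irrelevant: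
  assumes "i \<notin> set (leaves t) \<or> j \<notin> set (leaves t)"
  shows "pairing (unit_wt (i, j)) t = pairing (\<lambda>e. 0) t"
    "pairing (\<lambda>e. unit_wt (i, j) e + v e) t = pairing v t"
    "pairing (\<lambda>e. v e + unit_wt (i, j) e) t = pairing v t"
  using assms by (auto intro!: pairing_cong simp: unit_wt_def)

text \<open>At the node that separates \<open>i\<close> and \<open>j\<close>, the two weights add up
  to \<open>h\<close> for \<open>Dot\<close> and cancel for \<open>Brk\<close>, in agreement with
  the counit. When both leaves lie in one subtree, the node has weight 1 or 0.\<close>

lemma pairing_skew:
  assumes "distinct (leaves t)" "i \<in> set (leaves t)" "j \<in> set (leaves t)" "i \<noteq> j"
  shows "pairing (unit_wt (i, j)) t + pairing (unit_wt (j, i)) t = h * pairing (\<lambda>e. 0) t"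
  using assms
proof (induction t)
  case (Dot s t)
  have *: "x \<notin> set (leaves t)" if "x \<in> set (leaves s)" for x using that Dot.prems by auto
  show ?case
    using Dot *
    by (cases "i \<in> set (leaves s)"; cases "j \<in> set (leaves s)")
       (auto simp: wt_simps pairing_unit_wt_irrelevant half_mult_add mult_half_mult_add
           algebra_simps
          simp flip: distrib_left)
next
  case (Brk s t)
  have *: "x \<notin> set (leaves t)" if "x \<in> set (leaves s)" for x using that Brk.prems by auto
  show ?case
    using Brk *
    by (cases "i \<in> set (leaves s)"; cases "j \<in> set (leaves s)")
       (auto simp: wt_simps pairing_unit_wt_irrelevant algebra_simps simp flip: distrib_left)
qed auto

text \<open>At the separating node a second variable in the same direction multiplies either weight
  by \<open>h\<close>.\<close>

lemma pairing_square:
  assumes "distinct (leaves t)" "i \<in> set (leaves t)" "j \<in> set (leaves t)" "i \<noteq> j"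
  shows "pairing (\<lambda>e. unit_wt (i, j) e + unit_wt (i, j) e) t = h * pairing (unit_wt (i, j)) t"
  using assms
proof (induction t)
  case (Dot s t)
  have *: "x \<notin> set (leaves t)" if "x \<in> set (leaves s)" for x using that Dot.prems by auto
  show ?case
    using Dot *
    by (cases "i \<in> set (leaves s)"; cases "j \<in> set (leaves s)")
       (auto simp: wt_simps numeral_2_eq_2 pairing_unit_wt_irrelevant algebra_simps)
next
  case (Brk s t)
  have *: "x \<notin> set (leaves t)" if "x \<in> set (leaves s)" for x using that Brk.prems by auto
  show ?case
    using Brk *
    by (cases "i \<in> set (leaves s)"; cases "j \<in> set (leaves s)")
       (auto simp: wt_simps numeral_2_eq_2 pairing_unit_wt_irrelevant algebra_simps)
qed auto

text \<open>Look at the node where the three leaves part. If \<open>j\<close> splits off,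
  \<open>x_ij x_jk\<close> has variables in both directions and vanishes, while the two halves on
  the right add up to \<open>h\<close> for \<open>Dot\<close> and cancel for \<open>Brk\<close>. If
  \<open>i\<close> or \<open>k\<close> splits off, one term on each side agrees at once, and the
  other two by the rule behind \<open>pairing_square\<close>. If all three stay together, the
  induction hypothesis applies under \<open>Dot\<close>, and everything is 0 under
  \<open>Brk\<close>.\<close>

lemma pairing_triple:
  assumes "distinct (leaves t)" "i \<in> set (leaves t)" "j \<in> set (leaves t)" "k \<in> set (leaves t)"
    "i \<noteq> j" "j \<noteq> k" "i \<noteq> k"
  shows "pairing (\<lambda>e. unit_wt (i, j) e + unit_wt (j, k) e) t + h * pairing (unit_wt (i, k)) t =
    pairing (\<lambda>e. unit_wt (i, j) e + unit_wt (i, k) e) t + pairing (\<lambda>e.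
        unit_wt (j, k) e + unit_wt (i, k) e) t"
  using assms
proof (induction t)
  case (Dot s t)
  have *: "x \<notin> set (leaves t)" if "x \<in> set (leaves s)" for x using that Dot.prems by auto
  \<comment> \<open>Multiplied by the counit of the other subtree, because this factor accompanies
    the hypothesis when all three leaves lie in one subtree.\<close>
  have IH: "pairing (\<lambda>e. 0) v * (pairing (\<lambda>e. unit_wt (i, j) e + unit_wt (j, k) e) u + h *
      pairing (unit_wt (i, k)) u) =
      pairing (\<lambda>e. 0) v * (pairing (\<lambda>e. unit_wt (i, j) e + unit_wt (i, k) e) u + pairing (\<lambda>e.
          unit_wt (j, k) e + unit_wt (i, k) e) u)"
    if "i \<in> set (leaves u)" "j \<in> set (leaves u)" "k \<in> set (leaves u)" "u = s \<or> u = t" for u v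
    using Dot that by (auto intro!: arg_cong[of _ _ "(*) _"])
  show ?case
    using IH[of s t] IH[of t s] Dot.prems *
    by (cases "i \<in> set (leaves s)"; cases "j \<in> set (leaves s)"; cases "k \<in> set (leaves s)")
       (auto simp: wt_simps numeral_2_eq_2 pairing_unit_wt_irrelevant half_mult_add
           mult_half_mult_add algebra_simps)
next
  case (Brk s t)
  have *: "x \<notin> set (leaves t)" if "x \<in> set (leaves s)" for x using that Brk.prems by auto
  have IH: "pairing (\<lambda>e. 0) v * (pairing (\<lambda>e. unit_wt (i, j) e + unit_wt (j, k) e) u + h *
      pairing (unit_wt (i, k)) u) =
      pairing (\<lambda>e. 0) v * (pairing (\<lambda>e. unit_wt (i, j) e + unit_wt (i, k) e) u + pairing (\<lambda>e.
          unit_wt (j, k) e + unit_wt (i, k) e) u)"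
    if "i \<in> set (leaves u)" "j \<in> set (leaves u)" "k \<in> set (leaves u)" "u = s \<or> u = t" for u v
    using Brk that by (auto intro!: arg_cong[of _ _ "(*) _"])
  show ?case
    using IH[of s t] IH[of t s] Brk.prems *
    by (cases "i \<in> set (leaves s)"; cases "j \<in> set (leaves s)"; cases "k \<in> set (leaves s)")
       (auto simp: wt_simps numeral_2_eq_2 pairing_unit_wt_irrelevant half_mult_add
           mult_half_mult_add algebra_simps)
qed auto

end

section \<open>Tree monomials on arbitrary finite sets of labels\<close>

definition trees_on :: "'l set \<Rightarrow> 'l tree set"
  where "trees_on L = {t. distinct (leaves t) \<and> set (leaves t) = L}"

lemma tree_monomials_eq: "tree_monomials n = trees_on {1..n}"
  by (simp add: tree_monomials_def trees_on_def)

lemma finite_trees_on: "t \<in> trees_on L \<Longrightarrow> finite L"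
  by (auto simp: trees_on_def)

text \<open>Turns membership into an equation of multisets, so that rearranging subtrees inside a
  context is settled by associativity and commutativity of addition.\<close>

lemma trees_on_iff_mset:
  assumes "finite L"
  shows "t \<in> trees_on L \<longleftrightarrow> mset (leaves t) = mset_set L"
proof
  assume "t \<in> trees_on L"
  thus "mset (leaves t) = mset_set L"
    using mset_set_set[of "leaves t"] by (simp add: trees_on_def)
next
  assume *: "mset (leaves t) = mset_set L"
  hence "set (leaves t) = L"
    by (metis assms finite_set_mset_mset_set set_mset_mset)
  moreover have "distinct (leaves t)"
    using * assms by (simp add: distinct_count_atmost_1 count_mset_set' calculation)
  ultimately show "t \<in> trees_on L" by (simp add: trees_on_def)
qed

lemma set_tree_leaves: "set_tree t = set (leaves t)"
  by (induction t) auto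

lemma map_tree_cong_leaves:
  "(\<And>l. l \<in> set (leaves t) \<Longrightarrow> f l = g l) \<Longrightarrow> map_tree f t = map_tree g t"
  by (intro tree.map_cong) (auto simp: set_tree_leaves)

lemma graft_cong:
  "(\<And>l. l \<in> set (leaves t) \<Longrightarrow> \<sigma> l = \<tau> l) \<Longrightarrow> graft \<sigma> t = graft \<tau> t"
  by (induction t) auto

lemma graft_Leaf: "(\<And>l. l \<in> set (leaves t) \<Longrightarrow> \<sigma> l = Leaf l) \<Longrightarrow> graft \<sigma> t = t"
  by (induction t) auto

lemma graft_graft: "graft \<sigma> (graft \<tau> t) = graft (\<lambda>l. graft \<sigma> (\<tau> l)) t"
  by (induction t) auto

lemma graft_map_tree: "graft \<sigma> (map_tree f t) = graft (\<lambda>l. \<sigma> (f l)) t"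
  by (induction t) auto

lemma map_tree_graft': "map_tree f (graft \<sigma> t) = graft (\<lambda>l. map_tree f (\<sigma> l)) t"
  by (induction t) auto

lemma map_tree_map_tree: "map_tree f (map_tree g t) = map_tree (\<lambda>l. f (g l)) t"
  by (simp add: tree.map_comp comp_def)

lemma map_tree_trees_on: "inj_on f L \<Longrightarrow> t \<in> trees_on L \<Longrightarrow> map_tree f t \<in> trees_on (f ` L)"
  by (auto simp: trees_on_def distinct_map)

lemma disjoint_family_on_Un:
  assumes "disjoint_family_on B I" "disjoint_family_on B J" "(\<Union>i\<in>I. B i) \<inter> (\<Union>j\<in>J. B j) = {}"
  shows "disjoint_family_on B (I \<union> J)"
  using assms unfolding disjoint_family_on_def by blast

lemma distinct_leaves_graftD:
  assumes "distinct (leaves (graft \<sigma> t))"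
  shows "\<And>j. j \<in> set (leaves t) \<Longrightarrow> distinct (leaves (\<sigma> j))"
    "disjoint_family_on (\<lambda>j. set (leaves (\<sigma> j))) (set (leaves t))"
proof -
  show "\<And>j. j \<in> set (leaves t) \<Longrightarrow> distinct (leaves (\<sigma> j))"
    using assms by (induction t) auto
  show "disjoint_family_on (\<lambda>j. set (leaves (\<sigma> j))) (set (leaves t))"
    using assms by (induction t) (auto intro!: disjoint_family_on_Un simp: disjoint_family_on_def[of
        _ "{_}"])
qed

lemma graft_trees_on:
  assumes "t \<in> trees_on L" "\<And>l. l \<in> L \<Longrightarrow> \<sigma> l \<in> trees_on (S l)" "disjoint_family_on S L"
  shows "graft \<sigma> t \<in> trees_on (\<Union>l\<in>L. S l)"
proof -
  have "disjoint_family_on (\<lambda>j. set (leaves (\<sigma> j))) L"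
    using assms(2,3) by (simp add: disjoint_family_on_def trees_on_def)
  thus ?thesis using assms(1,2) by (auto simp: trees_on_def intro!: distinct_leaves_graft)
qed

lemma graft1_trees_on:
  assumes "t \<in> trees_on L" "x \<in> L" "s \<in> trees_on S" "(L - {x}) \<inter> S = {}"
  shows "graft (Leaf(x := s)) t \<in> trees_on (L - {x} \<union> S)"
proof -
  have "graft (Leaf(x := s)) t \<in> trees_on (\<Union>l\<in>L. if l = x then S else {l})"
    using assms by (intro graft_trees_on) (auto simp: trees_on_def disjoint_family_on_def)
  also have "(\<Union>l\<in>L. if l = x then S else {l}) = L - {x} \<union> S"
    using assms(2) by (auto split: if_splits)
  finally show ?thesis .
qed

section \<open>The operadic ideal, up to relabelling\<close>

text \<open>\<open>operad_ideal\<close> lives on the inputs {1..n} in the shifted numbering of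
  \<open>tree_comp\<close>. Here it is transported to any finite set of labels along some bijection;
  the choice is immaterial by \<open>null_on_relabel\<close>.\<close>

definition null_on ::
    "(nat \<Rightarrow> (nat tree \<Rightarrow>\<^sub>0 'r) set) \<Rightarrow> nat set \<Rightarrow> (nat tree \<Rightarrow>\<^sub>0 'r::comm_ring_1) \<Rightarrow> bool" where
  "null_on G L p \<longleftrightarrow> finite L \<and> Poly_Mapping.keys p \<subseteq> trees_on L \<and>
    (\<exists>\<rho>. bij_betw \<rho> L {1..card L} \<and> operad_ideal G (card L) (map_basis (map_tree \<rho>) p))"

lemma map_basis_cong:
  "(\<And>a. a \<in> Poly_Mapping.keys p \<Longrightarrow> f a = g a) \<Longrightarrow> map_basis f p = map_basis g p"
  by (rule lin_ext_cong) simp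

text \<open>Two bijections onto {1..card L} differ by a permutation, and the ideal is closed under
  permutations.\<close>

lemma null_on_relabel:
  assumes "null_on G L p" and \<rho>': "bij_betw \<rho>' L {1..card L}"
  shows "operad_ideal G (card L) (map_basis (map_tree \<rho>') p)"
proof -
  from assms(1) obtain \<rho> where \<rho>: "bij_betw \<rho> L {1..card L}"
      "operad_ideal G (card L) (map_basis (map_tree \<rho>) p)" and k: "Poly_Mapping.keys p \<subseteq> trees_on L"
    by (auto simp: null_on_def)
  define \<sigma> where "\<sigma> x = (if x \<in> {1..card L} then \<rho>' (inv_into L \<rho> x) else x)" for x
  have "bij_betw (\<rho>' \<circ> inv_into L \<rho>) {1..card L} {1..card L}"
    using bij_betw_inv_into[OF \<rho>(1)] \<rho>' by (rule bij_betw_trans)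
  hence "bij_betw \<sigma> {1..card L} {1..card L}"
    by (subst bij_betw_cong[of _ _ "\<rho>' \<circ> inv_into L \<rho>"]) (simp_all add: \<sigma>_def)
  hence "\<sigma> permutes {1..card L}"
    by (rule bij_imp_permutes) (auto simp: \<sigma>_def)
  hence "operad_ideal G (card L) (perm_act \<sigma> (map_basis (map_tree \<rho>) p))"
    by (rule operad_ideal.perm[OF \<rho>(2)])
  also have "perm_act \<sigma> (map_basis (map_tree \<rho>) p) = map_basis (map_tree \<rho>') p"
    unfolding perm_act_def map_basis_map_basis
  proof (rule map_basis_cong)
    fix t assume "t \<in> Poly_Mapping.keys p"
    hence "set (leaves t) = L" using k by (auto simp: trees_on_def)
    thus "map_tree \<sigma> (map_tree \<rho> t) = map_tree \<rho>' t"
      unfolding map_tree_map_tree using \<rho>(1)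
      by (intro map_tree_cong_leaves) (auto simp: \<sigma>_def bij_betw_def)
  qed
  finally show ?thesis .
qed

lemma null_on_interval:
  assumes "null_on G {1..n} p"
  shows "operad_ideal G n p"
  using null_on_relabel[OF assms, of "\<lambda>x. x"]
      by (simp add: map_basis_id tree.map_ident bij_betw_def)

lemma null_on_map:
  assumes "null_on G L p" "inj_on f L"
  shows "null_on G (f ` L) (map_basis (map_tree f) p)"
proof -
  have k: "Poly_Mapping.keys p \<subseteq> trees_on L" and fin: "finite L" using assms
      by (auto simp: null_on_def)
  obtain \<rho> where \<rho>: "bij_betw \<rho> L {1..card L}" using assms by (auto simp: null_on_def)
  have b: "bij_betw (\<rho> \<circ> inv_into L f) (f ` L) {1..card L}"
    using assms(2) \<rho> by (intro bij_betw_trans[OF bij_betw_inv_into]) (auto simp: bij_betw_def)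
  have "map_basis (map_tree (\<rho> \<circ> inv_into L f)) (map_basis (map_tree f) p) =
      map_basis (map_tree \<rho>) p"
    unfolding map_basis_map_basis
  proof (rule map_basis_cong)
    fix t assume "t \<in> Poly_Mapping.keys p"
    hence "set (leaves t) = L" using k by (auto simp: trees_on_def)
    thus "map_tree (\<rho> \<circ> inv_into L f) (map_tree f t) = map_tree \<rho> t"
      unfolding map_tree_map_tree using assms(2)
      by (intro map_tree_cong_leaves) auto
  qed
  moreover have "Poly_Mapping.keys (map_basis (map_tree f) p) \<subseteq> trees_on (f ` L)"
    using k map_tree_trees_on[OF assms(2)] by (intro order_trans[OF keys_map_basis]) auto
  ultimately show ?thesis
    using b null_on_relabel[OF assms(1) \<rho>] fin unfolding null_on_def
    by (simp add: card_image[OF assms(2)]) (metis comp_def)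
qed

text \<open>The leaf \<open>x\<close> is numbered last, so the branch of \<open>comp_leaf\<close>
  that shifts later inputs is never reached. The result carries \<rho> outside \<open>L\<close> and
  a shift of \<tau> by \<open>N - 1\<close> on \<open>L\<close>.\<close>

lemma tree_comp_relabel:
  assumes "T \<in> trees_on X" "t \<in> trees_on L" "x \<in> X" "(X - {x}) \<inter> L = {}"
    and \<rho>: "bij_betw \<rho> X {1..N}" "\<rho> x = N"
  shows "tree_comp N m (map_tree \<rho> T) (map_tree \<tau> t) =
    map_tree (\<lambda>y. if y \<in> L then \<tau> y + N - 1 else \<rho> y) (graft (Leaf(x := t)) T)"
  unfolding tree_comp_eq_graft graft_map_tree map_tree_graft'
proof (rule graft_cong)
  fix y assume "y \<in> set (leaves T)"
  hence y: "y \<in> X" using assms(1) by (simp add: trees_on_def)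
  show "comp_leaf N m (map_tree \<tau> t) (\<rho> y) =
    map_tree (\<lambda>y. if y \<in> L then \<tau> y + N - 1 else \<rho> y) ((Leaf(x := t)) y)"
  proof (cases "y = x")
    case True
    thus ?thesis using assms(2) \<rho>(2)
      by (auto simp: comp_leaf_def map_tree_map_tree trees_on_def intro!: map_tree_cong_leaves)
  next
    case False
    hence "\<rho> y \<noteq> \<rho> x" using \<rho>(1) y assms(3) by (auto simp: bij_betw_def inj_on_eq_iff)
    moreover have "\<rho> y \<in> {1..N}" using \<rho>(1) y by (auto simp: bij_betw_def)
    ultimately have "\<rho> y < N" using \<rho>(2) by simp
    thus ?thesis using False y assms(4) by (auto simp: comp_leaf_def)
  qed
qed

lemma bij_betw_relabel:
  assumes "finite X" "finite L" "x \<in> X" "(X - {x}) \<inter> L = {}"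
    and \<rho>: "bij_betw \<rho> X {1..card X}" "\<rho> x = card X" and \<tau>: "bij_betw \<tau> L {1..card L}"
  shows "card (X - {x} \<union> L) = card X + card L - 1"
    "bij_betw (\<lambda>y. if y \<in> L then \<tau> y + card X - 1 else \<rho> y) (X - {x} \<union> L) {1..card X + card L - 1}"
proof -
  have pos: "card X \<ge> 1" using assms(1,3) by (metis One_nat_def Suc_leI card_gt_0_iff empty_iff)
  thus "card (X - {x} \<union> L) = card X + card L - 1"
    using assms(1-4) by (subst card_Un_disjoint) auto
  let ?f = "\<lambda>y. if y \<in> L then \<tau> y + card X - 1 else \<rho> y"
  have "bij_betw \<rho> (X - {x}) ({1..card X} - {card X})"
    using assms(3) pos \<rho>(2) by (intro bij_betw_DiffI[OF \<rho>(1)]) (simp_all add: bij_betw_def)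
  also have "{1..card X} - {card X} = {1..card X - 1}" by auto
  finally have 1: "bij_betw ?f (X - {x}) {1..card X - 1}"
    by (subst bij_betw_cong[of _ _ \<rho>]) (use assms(4) in auto)
  have "bij_betw (\<lambda>k. k + card X - 1) {1..card L} {card X..card X + card L - 1}"
    by (rule bij_betw_byWitness[of _ "\<lambda>k. k + 1 - card X"]) (use pos in auto)
  from bij_betw_trans[OF \<tau> this] have 2: "bij_betw ?f L {card X..card X + card L - 1}"
    by (subst bij_betw_cong[of _ _ "(\<lambda>k. k + card X - 1) \<circ> \<tau>"]) auto
  have "{1..card X - 1} \<union> {card X..card X + card L - 1} = {1..card X + card L - 1}"
    using pos by auto
  moreover have "bij_betw ?f (X - {x} \<union> L) ({1..card X - 1} \<union> {card X..card X + card L - 1})"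
    using pos by (intro bij_betw_combine[OF 1 2]) auto
  ultimately show "bij_betw ?f (X - {x} \<union> L) {1..card X + card L - 1}" by simp
qed

lemma relabelling_with_last:
  assumes "finite X" "x \<in> X"
  obtains \<rho> where "bij_betw \<rho> X {1..card X}" "\<rho> x = card X"
proof -
  have "finite (X - {x})" using assms by simp
  then obtain \<rho> where \<rho>: "bij_betw \<rho> (X - {x}) {1..card (X - {x})}"
    using ex_bij_betw_nat_finite_1 bij_betw_inv by metis
  have pos: "card X \<ge> 1" using assms by (metis One_nat_def Suc_leI card_gt_0_iff empty_iff)
  have "bij_betw (\<rho>(x := card X)) (X - {x} \<union> {x}) ({1..card (X - {x})} \<union> {card X})"
    using \<rho> assms pos
    by (intro bij_betw_combine) (auto simp: bij_betw_def inj_on_def)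
  moreover have "{1..card (X - {x})} \<union> {card X} = {1..card X}"
    using assms pos by (auto simp: card_Diff_singleton)
  ultimately have "bij_betw (\<rho>(x := card X)) X {1..card X}"
    using assms(2) by (simp add: insert_absorb)
  thus ?thesis by (rule that) simp
qed

text \<open>The relabelled form of \<open>comp_left\<close>; \<open>null_on_plug\<close> is that of
  \<open>comp_right\<close>. In both, the composition takes place at the last input.\<close>

lemma null_on_graft1:
  assumes "null_on G L p" "x \<in> L" "s \<in> trees_on S" "(L - {x}) \<inter> S = {}"
  shows "null_on G (L - {x} \<union> S) (map_basis (graft (Leaf(x := s))) p)"
proof -
  have k: "Poly_Mapping.keys p \<subseteq> trees_on L" and fin: "finite L" "finite S"
    using assms finite_trees_on by (auto simp: null_on_def)
  obtain \<rho> where \<rho>: "bij_betw \<rho> L {1..card L}" "\<rho> x = card L"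
    using relabelling_with_last[OF fin(1) assms(2)] .
  obtain \<tau> where \<tau>: "bij_betw \<tau> S {1..card S}"
    using ex_bij_betw_nat_finite_1[OF fin(2)] bij_betw_inv by metis
  let ?f = "\<lambda>y. if y \<in> S then \<tau> y + card L - 1 else \<rho> y"
  note b = bij_betw_relabel[OF fin assms(2,4) \<rho> \<tau>]
  have "map_tree \<tau> s \<in> trees_on {1..card S}"
    using map_tree_trees_on[OF _ assms(3), of \<tau>] \<tau> by (simp add: bij_betw_def)
  hence "operad_ideal G (card L + card S - 1)
      (op_comp (card L) (card S) (map_basis (map_tree \<rho>) p) (monom1 (map_tree \<tau> s)))"
    using null_on_relabel[OF assms(1) \<rho>(1)] fin assms(2)
    by (intro operad_ideal.comp_left) (auto simp: tree_monomials_eq Suc_le_eq card_gt_0_iff)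
  also have "op_comp (card L) (card S) (map_basis (map_tree \<rho>) p) (monom1 (map_tree \<tau> s)) =
      map_basis (\<lambda>t. tree_comp (card L) (card S) (map_tree \<rho> t) (map_tree \<tau> s)) p"
    unfolding op_comp_def bilin_ext_def by (simp add: map_basis_map_basis)
  also have "\<dots> = map_basis (map_tree ?f) (map_basis (graft (Leaf(x := s))) p)"
    unfolding map_basis_map_basis
    by (intro map_basis_cong tree_comp_relabel[OF subsetD[OF k]] assms \<rho>)
  finally have "operad_ideal G (card (L - {x} \<union> S))
     (map_basis (map_tree ?f) (map_basis (graft (Leaf(x := s))) p))"
    unfolding b(1) .
  moreover have "Poly_Mapping.keys (map_basis (graft (Leaf(x := s))) p) \<subseteq> trees_on (L - {x} \<union> S)"
    using k graft1_trees_on[OF _ assms(2-4)] by (intro order_trans[OF keys_map_basis]) auto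
  ultimately show ?thesis unfolding null_on_def b(1) using b(2) fin by blast
qed

lemma null_on_plug:
  assumes "T \<in> trees_on X" "null_on G L p" "x \<in> X" "(X - {x}) \<inter> L = {}"
  shows "null_on G (X - {x} \<union> L) (map_basis (\<lambda>t. graft (Leaf(x := t)) T) p)"
proof -
  have k: "Poly_Mapping.keys p \<subseteq> trees_on L" and fin: "finite X" "finite L"
    using assms finite_trees_on by (auto simp: null_on_def)
  obtain \<rho> where \<rho>: "bij_betw \<rho> X {1..card X}" "\<rho> x = card X"
    using relabelling_with_last[OF fin(1) assms(3)] .
  obtain \<tau> where \<tau>: "bij_betw \<tau> L {1..card L}"
    using ex_bij_betw_nat_finite_1[OF fin(2)] bij_betw_inv by metis
  let ?f = "\<lambda>y. if y \<in> L then \<tau> y + card X - 1 else \<rho> y"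
  note b = bij_betw_relabel[OF fin assms(3,4) \<rho> \<tau>]
  have "map_tree \<rho> T \<in> trees_on {1..card X}"
    using map_tree_trees_on[OF _ assms(1), of \<rho>] \<rho> by (simp add: bij_betw_def)
  hence "operad_ideal G (card X + card L - 1)
      (op_comp (card X) (card L) (monom1 (map_tree \<rho> T)) (map_basis (map_tree \<tau>) p))"
    using null_on_relabel[OF assms(2) \<tau>(1)] fin assms(3)
    by (intro operad_ideal.comp_right) (auto simp: tree_monomials_eq Suc_le_eq card_gt_0_iff)
  also have "op_comp (card X) (card L) (monom1 (map_tree \<rho> T)) (map_basis (map_tree \<tau>) p) =
      map_basis (\<lambda>t. tree_comp (card X) (card L) (map_tree \<rho> T) (map_tree \<tau> t)) p"
    unfolding op_comp_def bilin_ext_def by (simp add: map_basis_map_basis)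
  also have "\<dots> = map_basis (map_tree ?f) (map_basis (\<lambda>t. graft (Leaf(x := t)) T) p)"
    unfolding map_basis_map_basis
    by (intro map_basis_cong tree_comp_relabel[OF assms(1) subsetD[OF k]] assms \<rho>)
  finally have "operad_ideal G (card (X - {x} \<union> L))
     (map_basis (map_tree ?f) (map_basis (\<lambda>t. graft (Leaf(x := t)) T) p))"
    unfolding b(1) .
  moreover have "Poly_Mapping.keys (map_basis (\<lambda>t. graft (Leaf(x :=
      t)) T) p) \<subseteq> trees_on (X - {x} \<union> L)"
    using k graft1_trees_on[OF assms(1,3) _ assms(4)] by (intro order_trans[OF keys_map_basis]) auto
  ultimately show ?thesis unfolding null_on_def b(1) using b(2) fin by blast
qed

text \<open>A simultaneous grafting is done one leaf at a time. Freshness of the new labels prevents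
  a later grafting from hitting a leaf that an earlier one has just inserted.\<close>

lemma null_on_graft_fresh:
  assumes "finite D" "null_on G L p" "D \<subseteq> L" "\<And>l. l \<in> D \<Longrightarrow> \<sigma> l \<in> trees_on (S l)"
    "disjoint_family_on S D" "(\<Union>l\<in>D. S l) \<inter> L = {}"
  shows "null_on G (L - D \<union> (\<Union>l\<in>D. S l)) (map_basis (graft (\<lambda>l. if l \<in> D then \<sigma> l else Leaf l)) p)"
  using assms(1,3-6)
proof (induction D)
  case empty
  have "map_basis (graft Leaf) p = p" by (rule map_basis_id) (simp add: graft_Leaf)
  thus ?case using assms(2) by simp
next
  case (insert x D)
  let ?g = "\<lambda>D. graft (\<lambda>l. if l \<in> D then \<sigma> l else Leaf l)"
  have IH: "null_on G (L - D \<union> (\<Union>l\<in>D. S l)) (map_basis (?g D) p)"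
    using insert.prems by (intro insert.IH) (auto simp: disjoint_family_on_def)
  have dis: "S x \<inter> (\<Union>l\<in>D. S l) = {}"
    using insert.prems(3) insert.hyps(2) by (fastforce simp: disjoint_family_on_def)
  have x: "x \<notin> (\<Union>l\<in>D. S l)" using insert.prems(1,4) by auto
  have eq: "L - D \<union> (\<Union>l\<in>D. S l) - {x} \<union> S x = L - insert x D \<union> (\<Union>l\<in>insert x D. S l)"
    using x by auto
  have "null_on G (L - D \<union> (\<Union>l\<in>D. S l) - {x} \<union> S x)
     (map_basis (graft (Leaf(x := \<sigma> x))) (map_basis (?g D) p))"
    using insert.prems insert.hyps(2) dis by (intro null_on_graft1[OF IH]) auto
  also have "map_basis (graft (Leaf(x := \<sigma> x))) (map_basis (?g D) p) =
      map_basis (?g (insert x D)) p"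
    unfolding map_basis_map_basis graft_graft
  proof (intro map_basis_cong graft_cong)
    fix t l assume "t \<in> Poly_Mapping.keys p" "l \<in> set (leaves t)"
    show "graft (Leaf(x := \<sigma> x)) (if l \<in> D then \<sigma> l else Leaf l) =
      (if l \<in> insert x D then \<sigma> l else Leaf l)"
    proof (cases "l \<in> D")
      case True
      hence "x \<notin> set (leaves (\<sigma> l))" using x insert.prems(2)[of l] by (auto simp: trees_on_def)
      thus ?thesis using True by (auto intro!: graft_Leaf)
    qed auto
  qed
  finally show ?case unfolding eq .
qed

text \<open>New labels may coincide with old ones. Shifting the old ones by a bound \<open>K\<close>
  beyond all new labels reduces this to the fresh case.\<close>

lemma null_on_graft:
  assumes "null_on G L p" "\<And>l. l \<in> L \<Longrightarrow> \<sigma> l \<in> trees_on (S l)" "disjoint_family_on S L"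
  shows "null_on G (\<Union>l\<in>L. S l) (map_basis (graft \<sigma>) p)"
proof -
  have k: "Poly_Mapping.keys p \<subseteq> trees_on L" and fin: "finite L" using assms
      by (auto simp: null_on_def)
  have "finite (\<Union>l\<in>L. S l)" using fin finite_trees_on[OF assms(2)] by (rule finite_UN_I)
  then obtain K where "\<forall>y\<in>(\<Union>l\<in>L. S l). y < K"
    unfolding finite_nat_set_iff_bounded ..
  hence K: "(\<Union>l\<in>L. S l) \<inter> (\<lambda>l. l + K) ` L = {}" by fastforce
  let ?L = "(\<lambda>l. l + K) ` L"
  have 1: "null_on G ?L (map_basis (map_tree (\<lambda>l. l + K)) p)"
    by (rule null_on_map[OF assms(1)]) (simp add: inj_on_def)
  have "null_on G (?L - ?L \<union> (\<Union>l\<in>?L. S (l - K)))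
    (map_basis (graft (\<lambda>l. if l \<in> ?L then \<sigma> (l - K) else Leaf l)) (map_basis (map_tree (\<lambda>l.
        l + K)) p))"
  proof (rule null_on_graft_fresh[OF _ 1])
    show "disjoint_family_on (\<lambda>l. S (l - K)) ?L"
      using assms(3) by (auto simp: disjoint_family_on_def)
    show "(\<Union>l\<in>?L. S (l - K)) \<inter> ?L = {}" using K by simp
  qed (use fin assms(2) in auto)
  also have "map_basis (graft (\<lambda>l. if l \<in> ?L then \<sigma> (l - K) else Leaf l)) (map_basis (map_tree (\<lambda>l.
      l + K)) p)
     = map_basis (graft \<sigma>) p"
    unfolding map_basis_map_basis graft_map_tree using k
    by (intro map_basis_cong graft_cong) (auto simp: trees_on_def)
  finally show ?thesis by simp
qed

section \<open>Functionals on the Livernet--Loday operad\<close>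

text \<open>One-hole contexts, extended at the hole and not at the root: induction then peels off
  the node next to the hole, which is how a product with a leaf is made to travel outwards.\<close>

inductive ctx :: "('l tree \<Rightarrow> 'l tree) \<Rightarrow> bool" where
  hole: "ctx (\<lambda>x. x)"
| DotL: "ctx C \<Longrightarrow> ctx (\<lambda>x. C (Dot x s))"
| DotR: "ctx C \<Longrightarrow> ctx (\<lambda>x. C (Dot s x))"
| BrkL: "ctx C \<Longrightarrow> ctx (\<lambda>x. C (Brk x s))"
| BrkR: "ctx C \<Longrightarrow> ctx (\<lambda>x. C (Brk s x))"

lemma ctx_outer:
  assumes "ctx C"
  shows "ctx (\<lambda>x. Dot (C x) s)" "ctx (\<lambda>x. Dot s (C x))" "ctx (\<lambda>x. Brk (C x) s)"
      "ctx (\<lambda>x. Brk s (C x))"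
  using assms by (induction; auto intro: ctx.intros ctx.DotL[of "\<lambda>x. x"] ctx.DotR[of "\<lambda>x. x"]
    ctx.BrkL[of "\<lambda>x. x"] ctx.BrkR[of "\<lambda>x. x"])+

lemma graft_Leaf_fun_upd: "x \<notin> set (leaves s) \<Longrightarrow> graft (Leaf(x := t)) s = s"
  by (rule graft_Leaf) auto

text \<open>\<open>K\<close> collects the leaves outside the hole. The second half presents the
  context as a tree with a marked fresh leaf, to which the grafting lemmas apply.\<close>

lemma ctx_frame:
  assumes "ctx C"
  shows "\<exists>K. (\<forall>t. mset (leaves (C t)) = mset (leaves t) + K) \<and>
    (\<forall>x t. x \<notin># K \<longrightarrow> graft (Leaf(x := t)) (C (Leaf x)) = C t)"
proof -
  \<comment> \<open>Stated for an arbitrary tree \<open>u\<close> in the hole, since extending a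
    context places a new node there.\<close>
  have "\<exists>K. (\<forall>t. mset (leaves (C t)) = mset (leaves t) + K) \<and>
      (\<forall>x t u. x \<notin># K \<longrightarrow> graft (Leaf(x := t)) (C u) = C (graft (Leaf(x := t)) u))"
    using assms
  proof induction
    case hole
    show ?case by (intro exI[of _ "{#}"]) auto
  next
    case (DotL C s)
    then obtain K where "\<forall>t. mset (leaves (C t)) = mset (leaves t) + K"
      "\<forall>x t u. x \<notin># K \<longrightarrow> graft (Leaf(x := t)) (C u) = C (graft (Leaf(x := t)) u)" by blast
    thus ?case
      by (intro exI[of _ "mset (leaves s) + K"]) (auto simp: add_ac graft_Leaf_fun_upd simp
          del: fun_upd_apply)
  next
    case (DotR C s)
    then obtain K where "\<forall>t. mset (leaves (C t)) = mset (leaves t) + K"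
      "\<forall>x t u. x \<notin># K \<longrightarrow> graft (Leaf(x := t)) (C u) = C (graft (Leaf(x := t)) u)" by blast
    thus ?case
      by (intro exI[of _ "mset (leaves s) + K"]) (auto simp: add_ac graft_Leaf_fun_upd simp
          del: fun_upd_apply)
  next
    case (BrkL C s)
    then obtain K where "\<forall>t. mset (leaves (C t)) = mset (leaves t) + K"
      "\<forall>x t u. x \<notin># K \<longrightarrow> graft (Leaf(x := t)) (C u) = C (graft (Leaf(x := t)) u)" by blast
    thus ?case
      by (intro exI[of _ "mset (leaves s) + K"]) (auto simp: add_ac graft_Leaf_fun_upd simp
          del: fun_upd_apply)
  next
    case (BrkR C s)
    then obtain K where "\<forall>t. mset (leaves (C t)) = mset (leaves t) + K"
      "\<forall>x t u. x \<notin># K \<longrightarrow> graft (Leaf(x := t)) (C u) = C (graft (Leaf(x := t)) u)" by blast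
    thus ?case
      by (intro exI[of _ "mset (leaves s) + K"]) (auto simp: add_ac graft_Leaf_fun_upd simp
          del: fun_upd_apply)
  qed
  then obtain K where K: "\<forall>t. mset (leaves (C t)) = mset (leaves t) + K"
      "\<forall>x t u. x \<notin># K \<longrightarrow> graft (Leaf(x := t)) (C u) = C (graft (Leaf(x := t)) u)" by blast
  thus ?thesis by auto
qed

lemma ctx_graft:
  assumes "ctx C"
  obtains C' where "ctx C'" "\<And>t. graft \<sigma> (C t) = C' (graft \<sigma> t)"
proof -
  have "\<exists>C'. ctx C' \<and> (\<forall>t. graft \<sigma> (C t) = C' (graft \<sigma> t))"
    using assms
  proof induction
    case hole
    show ?case by (rule exI[of _ "\<lambda>x. x"]) (auto intro: ctx.hole)
  next
    case (DotL C s)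
    then obtain C' where "ctx C'" "\<forall>t. graft \<sigma> (C t) = C' (graft \<sigma> t)" by blast
    thus ?case by (intro exI[of _ "\<lambda>x. C' (Dot x (graft \<sigma> s))"]) (auto intro: ctx.DotL)
  next
    case (DotR C s)
    then obtain C' where "ctx C'" "\<forall>t. graft \<sigma> (C t) = C' (graft \<sigma> t)" by blast
    thus ?case by (intro exI[of _ "\<lambda>x. C' (Dot (graft \<sigma> s) x)"]) (auto intro: ctx.DotR)
  next
    case (BrkL C s)
    then obtain C' where "ctx C'" "\<forall>t. graft \<sigma> (C t) = C' (graft \<sigma> t)" by blast
    thus ?case by (intro exI[of _ "\<lambda>x. C' (Brk x (graft \<sigma> s))"]) (auto intro: ctx.BrkL)
  next
    case (BrkR C s)
    then obtain C' where "ctx C'" "\<forall>t. graft \<sigma> (C t) = C' (graft \<sigma> t)" by blast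
    thus ?case by (intro exI[of _ "\<lambda>x. C' (Brk (graft \<sigma> s) x)"]) (auto intro: ctx.BrkR)
  qed
  thus ?thesis using that by blast
qed

text \<open>The subtrees are substituted by \<open>null_on_graft\<close> and the result is put into
  the context by \<open>null_on_plug\<close>. All terms of \<open>p\<close> have the same leaves, so
  it suffices to check the labels on one tree \<open>t\<close>.\<close>

lemma operad_ideal_instance:
  assumes C: "ctx C" and p: "p \<in> G k" "p \<in> free_op k" and t: "t \<in> tree_monomials k"
    and inst: "C (graft \<sigma> t) \<in> trees_on {1..n}"
  shows "operad_ideal G n (map_basis (\<lambda>t. C (graft \<sigma> t)) p)"
proof -
  obtain K where K: "\<And>t. mset (leaves (C t)) = mset (leaves t) + K"
    "\<And>x t. x \<notin># K \<Longrightarrow> graft (Leaf(x := t)) (C (Leaf x)) = C t"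
    using ctx_frame[OF C] by auto
  have m: "mset_set {1..n} = mset (leaves (graft \<sigma> t)) + K"
    using inst K(1) by (subst (asm) trees_on_iff_mset) auto
  have t': "set (leaves t) = {1..k}" using t by (simp add: tree_monomials_def)
  define S where "S l = set (leaves (\<sigma> l))" for l
  have count: "count (mset (leaves (graft \<sigma> t))) x + count K x = (if x \<in> {1..n} then 1 else 0)"
      for x
    using arg_cong[OF m, of "\<lambda>M. count M x"] by (simp add: count_mset_set')
  have U: "(\<Union>l\<in>{1..k}. S l) = set (leaves (graft \<sigma> t))" by (simp add: S_def t')
  have dist: "distinct (leaves (graft \<sigma> t))"
    unfolding distinct_count_atmost_1
  proof
    fix x show "count (mset (leaves (graft \<sigma> t))) x =
        (if x \<in> set (leaves (graft \<sigma> t)) then 1 else 0)"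
      using count[of x] count_greater_zero_iff[of "mset (leaves (graft \<sigma> t))" x]
        count_eq_zero_iff[of "mset (leaves (graft \<sigma> t))" x]
      by (auto split: if_splits simp del: count_greater_zero_iff count_eq_zero_iff set_leaves_graft)
  qed
  have sub: "set_mset K \<union> (\<Union>l\<in>{1..k}. S l) = {1..n}"
    using arg_cong[OF m, of set_mset] U by auto
  have disj: "set_mset K \<inter> (\<Union>l\<in>{1..k}. S l) = {}"
  proof -
    have "x \<notin> set (leaves (graft \<sigma> t))" if "x \<in># K" for x
    proof
      assume "x \<in> set (leaves (graft \<sigma> t))"
      hence "count (mset (leaves (graft \<sigma> t))) x > 0" "count K x > 0" using that
        by (simp_all only: set_mset_mset[symmetric] count_greater_zero_iff)
      moreover have "count (mset (leaves (graft \<sigma> t))) x + count K x \<le> 1"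
        unfolding count by simp
      ultimately show False by linarith
    qed
    thus ?thesis unfolding U by blast
  qed
  have K': "K = mset_set (set_mset K)"
  proof (rule multiset_eqI)
    fix x show "count K x = count (mset_set (set_mset K)) x"
      using count[of x] count_greater_zero_iff[of K x] count_eq_zero_iff[of K x]
      by (auto split: if_splits simp: count_mset_set' simp
          del: count_greater_zero_iff count_eq_zero_iff)
  qed
  \<comment> \<open>Inputs are numbered from 1, so 0 is free to mark the hole.\<close>
  have z: "0 \<notin># K" using sub by (metis UnCI atLeastAtMost_iff not_one_le_zero)
  have T: "C (Leaf 0) \<in> trees_on (insert 0 (set_mset K))"
    using z K(1)[of "Leaf 0"] K' by (simp add: trees_on_iff_mset)
  have "null_on G {1..k} p"
    unfolding null_on_def using p
    by (auto simp: free_op_def tree_monomials_eq map_basis_id tree.map_ident bij_betw_def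
        intro!: exI[of _ "\<lambda>x. x"] operad_ideal.gen)
  hence "null_on G (\<Union>l\<in>{1..k}. S l) (map_basis (graft \<sigma>) p)"
    using distinct_leaves_graftD[OF dist] t'
    by (intro null_on_graft) (auto simp: trees_on_def S_def)
  hence "null_on G (insert 0 (set_mset K) - {0} \<union> (\<Union>l\<in>{1..k}. S l))
      (map_basis (\<lambda>t. graft (Leaf(0 := t)) (C (Leaf 0))) (map_basis (graft \<sigma>) p))"
    using disj z by (intro null_on_plug[OF T]) auto
  thus ?thesis using sub z by (simp add: map_basis_map_basis K(2)[OF z] null_on_interval)
qed

text \<open>Vanishing on the ideal, rewritten as identities between values on trees, for any label
  set, so that leaves can be removed one by one. Membership is tested on one representative tree,
  since all terms of a relation have the same leaves.\<close>

definition LL_functional :: "'r \<Rightarrow> nat set \<Rightarrow> (nat tree \<Rightarrow> 'r::comm_ring_1) \<Rightarrow> bool" where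
  "LL_functional h L f \<longleftrightarrow> (\<forall>C. ctx C \<longrightarrow>
    (\<forall>a b. C (Dot a b) \<in> trees_on L \<longrightarrow>
      f (C (Dot a b)) = f (C (Dot b a)) \<and> f (C (Brk a b)) = - f (C (Brk b a))) \<and>
    (\<forall>a b c. C (Dot (Dot a b) c) \<in> trees_on L \<longrightarrow>
      f (C (Brk (Dot a b) c)) = f (C (Dot a (Brk b c))) + f (C (Dot (Brk a c) b)) \<and>
      f (C (Brk a (Brk b c))) + f (C (Brk b (Brk c a))) + f (C (Brk c (Brk a b))) = 0 \<and>
      f (C (Dot (Dot a b) c)) = f (C (Dot a (Dot b c))) + h\<^sup>2 * f (C (Brk b (Brk a c)))))"

lemma LL_functionalI:
  assumes "\<And>p. operad_ideal (LL_relations h) n p \<Longrightarrow> eval_lin f p = 0"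
  shows "LL_functional h {1..n} f"
proof -
  have *: "eval_lin (\<lambda>t. f (C (graft \<sigma> t))) p = 0"
    if "ctx C" "p \<in> LL_relations h k" "t \<in> tree_monomials k" "C (graft \<sigma> t) \<in> trees_on {1..n}"
    for C p k t \<sigma>
    using assms[OF operad_ideal_instance[where C = C and \<sigma> = \<sigma> and t = t and G =
        "LL_relations h", OF that(1,2) LL_relations_free_op[OF that(2)] that(3,4)]]
    by simp
  show ?thesis
    unfolding LL_functional_def
  proof (intro allI impI conjI, goal_cases)
    case (1 C a b)
    let ?\<sigma> = "\<lambda>l::nat. if l = 1 then a else b"
    have "eval_lin (\<lambda>t. f (C (graft ?\<sigma> t))) (monom1 (Dot (Leaf 1) (Leaf 2)) -
        monom1 (Dot (Leaf 2) (Leaf 1))) = 0"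
      using 1 by (intro *[where k = 2 and t = "Dot (Leaf 1) (Leaf 2)"])
        (auto simp: LL_relations_def tree_monomials_3 Let_def)
    thus ?case by simp
  next
    case (2 C a b)
    let ?\<sigma> = "\<lambda>l::nat. if l = 1 then a else b"
    have "eval_lin (\<lambda>t. f (C (graft ?\<sigma> t))) (monom1 (Brk (Leaf 1) (Leaf 2)) +
        monom1 (Brk (Leaf 2) (Leaf 1))) = 0"
      using 2 by (intro *[where k = 2 and t = "Dot (Leaf 1) (Leaf 2)"])
        (auto simp: LL_relations_def tree_monomials_3 Let_def)
    thus ?case by (simp add: eq_neg_iff_add_eq_0)
  next
    case (3 C a b c)
    let ?\<sigma> = "\<lambda>l::nat. if l = 1 then a else if l = 2 then b else c"
    have "eval_lin (\<lambda>t. f (C (graft ?\<sigma> t))) (monom1 (Brk (Dot (Leaf 1) (Leaf 2)) (Leaf 3)) -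
       (monom1 (Dot (Leaf 1) (Brk (Leaf 2) (Leaf 3))) +
           monom1 (Dot (Brk (Leaf 1) (Leaf 3)) (Leaf 2)))) = 0"
      using 3 by (intro *[where k = 3 and t = "Dot (Dot (Leaf 1) (Leaf 2)) (Leaf 3)"])
        (auto simp: LL_relations_def tree_monomials_3 Let_def)
    thus ?case by simp
  next
    case (4 C a b c)
    let ?\<sigma> = "\<lambda>l::nat. if l = 1 then a else if l = 2 then b else c"
    have "eval_lin (\<lambda>t. f (C (graft ?\<sigma> t))) (monom1 (Brk (Leaf 1) (Brk (Leaf 2) (Leaf 3))) +
       monom1 (Brk (Leaf 2) (Brk (Leaf 3) (Leaf 1))) +
           monom1 (Brk (Leaf 3) (Brk (Leaf 1) (Leaf 2)))) = 0"
      using 4 by (intro *[where k = 3 and t = "Dot (Dot (Leaf 1) (Leaf 2)) (Leaf 3)"])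
        (auto simp: LL_relations_def tree_monomials_3 Let_def)
    thus ?case by simp
  next
    case (5 C a b c)
    let ?\<sigma> = "\<lambda>l::nat. if l = 1 then a else if l = 2 then b else c"
    have "eval_lin (\<lambda>t. f (C (graft ?\<sigma> t))) (monom1 (Dot (Dot (Leaf 1) (Leaf 2)) (Leaf 3)) -
       monom1 (Dot (Leaf 1) (Dot (Leaf 2) (Leaf 3))) -
           scale (h\<^sup>2) (monom1 (Brk (Leaf 2) (Brk (Leaf 1) (Leaf 3))))) = 0"
      using 5 by (intro *[where k = 3 and t = "Dot (Dot (Leaf 1) (Leaf 2)) (Leaf 3)"])
        (auto simp: LL_relations_def tree_monomials_3 Let_def)
    thus ?case by (simp add: diff_diff_eq)
  qed
qed

lemma LL_functionalD:
  assumes "LL_functional h L f" "ctx C"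
  shows "C (Dot a b) \<in> trees_on L \<Longrightarrow> f (C (Dot a b)) = f (C (Dot b a))"
    "C (Dot a b) \<in> trees_on L \<Longrightarrow> f (C (Brk a b)) = - f (C (Brk b a))"
    "C (Dot (Dot a b) c) \<in> trees_on L \<Longrightarrow>
      f (C (Brk (Dot a b) c)) = f (C (Dot a (Brk b c))) + f (C (Dot (Brk a c) b))"
    "C (Dot (Dot a b) c) \<in> trees_on L \<Longrightarrow>
      f (C (Brk a (Brk b c))) + f (C (Brk b (Brk c a))) + f (C (Brk c (Brk a b))) = 0"
    "C (Dot (Dot a b) c) \<in> trees_on L \<Longrightarrow>
      f (C (Dot (Dot a b) c)) = f (C (Dot a (Dot b c))) + h\<^sup>2 * f (C (Brk b (Brk a c)))"
  using assms unfolding LL_functional_def by blast+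

text \<open>
  A bracket with the leaf \<open>z\<close> is a derivation, so it moves inwards until it meets another leaf.  A
  product with \<open>z\<close> moves outwards through the context, up to terms of the first kind.
\<close>

lemma vanish_Brk_leaf:
  assumes f: "LL_functional h (insert z L) f" and z: "z \<notin> L" "finite L"
    and van: "\<And>u i. u \<in> trees_on L \<Longrightarrow> i \<in> L \<Longrightarrow> f (graft (Leaf(i := Brk (Leaf i) (Leaf z))) u) = 0"
    and "ctx C" "C (Brk b (Leaf z)) \<in> trees_on (insert z L)"
  shows "f (C (Brk b (Leaf z))) = 0"
  using assms(5,6)
proof (induction b arbitrary: C)
  case (Leaf i)
  from ctx_frame[OF Leaf.prems(1)] obtain K where K: "\<And>t. mset (leaves (C t)) = mset (leaves t) + K"
    "\<And>x t. x \<notin># K \<Longrightarrow> graft (Leaf(x := t)) (C (Leaf x)) = C t" by auto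
  have m: "mset_set L = add_mset i K"
    using Leaf.prems(2) z by (simp add: trees_on_iff_mset K)
  hence "C (Leaf i) \<in> trees_on L" using z(2) by (simp add: trees_on_iff_mset K)
  moreover have "i \<in> L" using m z(2) by (metis elem_mset_set union_single_eq_member)
  moreover have "i \<notin># K"
    unfolding not_in_iff using arg_cong[OF m, of "\<lambda>M. count M i"]
    by (simp add: count_mset_set' split: if_splits)
  ultimately show ?case using van[of "C (Leaf i)" i] K(2) by simp
next
  case (Dot b c)
  from ctx_frame[OF Dot.prems(1)] obtain K where K: "\<And>t. mset (leaves (C t)) = mset (leaves t) + K"
      by auto
  have 1: "f (C (Dot b (Brk c (Leaf z)))) = 0" "f (C (Dot (Brk b (Leaf z)) c)) = 0"
    using Dot.prems z
    by (intro Dot.IH(2)[OF ctx.DotR[OF Dot.prems(1)]] Dot.IH(1)[OF ctx.DotL[OF Dot.prems(1)]];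
        simp add: trees_on_iff_mset K add_ac)+
  have "C (Dot (Dot b c) (Leaf z)) \<in> trees_on (insert z L)"
    using Dot.prems z by (simp add: trees_on_iff_mset K add_ac)
  thus ?case using LL_functionalD(3)[OF f Dot.prems(1)] 1 by simp
next
  case (Brk b c)
  from ctx_frame[OF Brk.prems(1)] obtain K where K: "\<And>t. mset (leaves (C t)) = mset (leaves t) + K"
      by auto
  note D = LL_functionalD[OF f]
  have 1: "f (C (Brk b (Brk c (Leaf z)))) = 0" "f (C (Brk c (Brk b (Leaf z)))) = 0"
    using Brk.prems z
    by (intro Brk.IH(2)[OF ctx.BrkR[OF Brk.prems(1)]] Brk.IH(1)[OF ctx.BrkR[OF Brk.prems(1)]];
        simp add: trees_on_iff_mset K add_ac)+
  \<comment> \<open>Skew symmetry and the Jacobi identity express \<open>[[b, c], z]\<close> by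
    \<open>[b, [c, z]]\<close> and \<open>[c, [b, z]]\<close>, where \<open>z\<close> has moved one
    level inwards.\<close>
  have "f (C (Brk c (Brk (Leaf z) b))) = - f (C (Brk c (Brk b (Leaf z))))"
    "f (C (Brk (Brk b c) (Leaf z))) = - f (C (Brk (Leaf z) (Brk b c)))"
    "f (C (Brk b (Brk c (Leaf z)))) + f (C (Brk c (Brk (Leaf z) b))) +
        f (C (Brk (Leaf z) (Brk b c))) = 0"
    using Brk.prems z
    by (intro D(2)[OF ctx.BrkR[OF Brk.prems(1)]] D(2)[OF Brk.prems(1)] D(4)[OF Brk.prems(1)];
        simp add: trees_on_iff_mset K add_ac)+
  thus ?case using 1 by simp
qed

lemma vanish_Dot_leaf:
  assumes f: "LL_functional h (insert z L) f" and z: "z \<notin> L" "finite L"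
    and van: "\<And>u i. u \<in> trees_on L \<Longrightarrow> i \<in> L \<Longrightarrow> f (graft (Leaf(i := Brk (Leaf i) (Leaf z))) u) = 0"
    and van': "\<And>u. u \<in> trees_on L \<Longrightarrow> f (Dot u (Leaf z)) = 0"
    and "ctx C" "C (Dot b (Leaf z)) \<in> trees_on (insert z L)"
  shows "f (C (Dot b (Leaf z))) = 0"
  using assms(6,7)
proof (induction arbitrary: b)
  case hole
  thus ?case using z by (intro van') (simp add: trees_on_iff_mset)
next
  note D = LL_functionalD[OF f]
  note brk = vanish_Brk_leaf[OF f z van]
  \<comment> \<open>The associator relation turns \<open>(z . b) . s\<close> into
    \<open>z . (b . s)\<close>, where \<open>z\<close> sits one level higher. The error term
    contains the bracket \<open>[z, s]\<close>, which is known to contribute 0.\<close>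
  have DotL_zero: "f (C (Dot (Dot b (Leaf z)) s)) = 0"
    if C: "ctx C" and IH: "\<And>b. C (Dot b (Leaf z)) \<in> trees_on (insert z L) \<Longrightarrow> f (C (Dot b (Leaf z))) =
        0"
      and mem: "C (Dot (Dot b (Leaf z)) s) \<in> trees_on (insert z L)" for C b s
  proof -
    from ctx_frame[OF C] obtain K where K: "\<And>t. mset (leaves (C t)) = mset (leaves t) + K" by auto
    note mem' = mem[unfolded trees_on_iff_mset[OF finite.insertI[OF z(2)]]
        K leaves.simps mset_append]
    have "f (C (Dot (Dot b (Leaf z)) s)) = f (C (Dot (Dot (Leaf z) b) s))"
      by (rule D(1)[OF ctx.DotL[OF C]]) (rule mem)
    also have "\<dots> = f (C (Dot (Leaf z) (Dot b s))) + h\<^sup>2 * f (C (Brk b (Brk (Leaf z) s)))"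
      using mem' z by (intro D(5)[OF C]) (simp add: trees_on_iff_mset K add_ac)
    also have "f (C (Dot (Leaf z) (Dot b s))) = f (C (Dot (Dot b s) (Leaf z)))"
      using mem' z by (intro D(1)[OF C]) (simp add: trees_on_iff_mset K add_ac)
    also have "\<dots> = 0"
      using mem' z by (intro IH) (simp add: trees_on_iff_mset K add_ac)
    also have "f (C (Brk b (Brk (Leaf z) s))) = - f (C (Brk b (Brk s (Leaf z))))"
      using mem' z by (intro D(2)[OF ctx.BrkR[OF C]]) (simp add: trees_on_iff_mset K add_ac)
    also have "f (C (Brk b (Brk s (Leaf z)))) = 0"
      using mem' z by (intro brk[OF _ _ ctx.BrkR[OF C]]) (simp_all add: trees_on_iff_mset K add_ac)
    finally show ?thesis by simp
  qed
  \<comment> \<open>The Leibniz rule gives \<open>b . [z, s] + [b, s] . z\<close>: a bracket with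
    the leaf, and a product with it one level higher.\<close>
  have BrkL_zero: "f (C (Brk (Dot b (Leaf z)) s)) = 0"
    if C: "ctx C" and IH: "\<And>b. C (Dot b (Leaf z)) \<in> trees_on (insert z L) \<Longrightarrow> f (C (Dot b (Leaf z))) =
        0"
      and mem: "C (Brk (Dot b (Leaf z)) s) \<in> trees_on (insert z L)" for C b s
  proof -
    from ctx_frame[OF C] obtain K where K: "\<And>t. mset (leaves (C t)) = mset (leaves t) + K" by auto
    note mem' = mem[unfolded trees_on_iff_mset[OF finite.insertI[OF z(2)]]
        K leaves.simps mset_append]
    have "f (C (Brk (Dot b (Leaf z)) s)) =
        f (C (Dot b (Brk (Leaf z) s))) + f (C (Dot (Brk b s) (Leaf z)))"
      using mem' z by (intro D(3)[OF C]) (simp add: trees_on_iff_mset K add_ac)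
    also have "f (C (Dot (Brk b s) (Leaf z))) = 0"
      using mem' z by (intro IH) (simp add: trees_on_iff_mset K add_ac)
    also have "f (C (Dot b (Brk (Leaf z) s))) = - f (C (Dot b (Brk s (Leaf z))))"
      using mem' z by (intro D(2)[OF ctx.DotR[OF C]]) (simp add: trees_on_iff_mset K add_ac)
    also have "f (C (Dot b (Brk s (Leaf z)))) = 0"
      using mem' z by (intro brk[OF _ _ ctx.DotR[OF C]]) (simp_all add: trees_on_iff_mset K add_ac)
    finally show ?thesis by simp
  qed
  {
    case (DotL C s)
    thus ?case using DotL_zero by blast
  next
    case (BrkL C s)
    thus ?case using BrkL_zero by blast
  next
    case (DotR C s)
    from ctx_frame[OF DotR.hyps] obtain K where K: "\<And>t. mset (leaves (C t)) = mset (leaves t) + K"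
        by auto
    have "C (Dot (Dot b (Leaf z)) s) \<in> trees_on (insert z L)"
      using DotR.prems z by (simp add: trees_on_iff_mset K add_ac)
    thus ?case using D(1)[OF DotR.hyps DotR.prems] DotL_zero[OF DotR.hyps DotR.IH] by simp
  next
    case (BrkR C s)
    from ctx_frame[OF BrkR.hyps] obtain K where K: "\<And>t. mset (leaves (C t)) = mset (leaves t) + K"
        by auto
    have "C (Brk (Dot b (Leaf z)) s) \<in> trees_on (insert z L)"
        "C (Dot s (Dot b (Leaf z))) \<in> trees_on (insert z L)"
      using BrkR.prems z by (simp_all add: trees_on_iff_mset K add_ac)
    thus ?case using D(2)[OF BrkR.hyps, of s "Dot b (Leaf z)"] BrkL_zero[OF BrkR.hyps BrkR.IH]
        by simp
  }
qed

lemma leaf_in_ctx: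
  assumes "z \<in> set (leaves t)" "t \<noteq> Leaf z"
  obtains C b where "ctx C"
    "t = C (Dot b (Leaf z)) \<or> t = C (Dot (Leaf z) b) \<or> t = C (Brk b (Leaf z)) \<or> t =
        C (Brk (Leaf z) b)"
proof -
  have "\<exists>C b. ctx C \<and> (t = C (Dot b (Leaf z)) \<or> t = C (Dot (Leaf z) b)
      \<or> t = C (Brk b (Leaf z)) \<or> t = C (Brk (Leaf z) b))"
    using assms
  proof (induction t)
    case (Dot s u)
    consider "s = Leaf z" | "u = Leaf z" | "z \<in> set (leaves s)" "s \<noteq> Leaf z" | "z \<in> set (leaves u)"
        "u \<noteq> Leaf z"
      using Dot.prems by auto
    thus ?case
    proof cases
      case 1 thus ?thesis by (intro exI[of _ "\<lambda>x. x"] exI[of _ u]) (auto intro: ctx.hole)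
    next
      case 2 thus ?thesis by (intro exI[of _ "\<lambda>x. x"] exI[of _ s]) (auto intro: ctx.hole)
    next
      case 3
      from Dot.IH(1)[OF this] obtain C b where "ctx C" "s = C (Dot b (Leaf z)) \<or> s =
          C (Dot (Leaf z) b)
        \<or> s = C (Brk b (Leaf z)) \<or> s = C (Brk (Leaf z) b)" by blast
      thus ?thesis by (intro exI[of _ "\<lambda>x. Dot (C x) u"] exI[of _ b]) (auto intro: ctx_outer)
    next
      case 4
      from Dot.IH(2)[OF this] obtain C b where "ctx C" "u = C (Dot b (Leaf z)) \<or> u =
          C (Dot (Leaf z) b)
        \<or> u = C (Brk b (Leaf z)) \<or> u = C (Brk (Leaf z) b)" by blast
      thus ?thesis by (intro exI[of _ "\<lambda>x. Dot s (C x)"] exI[of _ b]) (auto intro: ctx_outer)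
    qed
  next
    case (Brk s u)
    consider "s = Leaf z" | "u = Leaf z" | "z \<in> set (leaves s)" "s \<noteq> Leaf z" | "z \<in> set (leaves u)"
        "u \<noteq> Leaf z"
      using Brk.prems by auto
    thus ?case
    proof cases
      case 1 thus ?thesis by (intro exI[of _ "\<lambda>x. x"] exI[of _ u]) (auto intro: ctx.hole)
    next
      case 2 thus ?thesis by (intro exI[of _ "\<lambda>x. x"] exI[of _ s]) (auto intro: ctx.hole)
    next
      case 3
      from Brk.IH(1)[OF this] obtain C b where "ctx C" "s = C (Dot b (Leaf z)) \<or> s =
          C (Dot (Leaf z) b)
        \<or> s = C (Brk b (Leaf z)) \<or> s = C (Brk (Leaf z) b)" by blast
      thus ?thesis by (intro exI[of _ "\<lambda>x. Brk (C x) u"] exI[of _ b]) (auto intro: ctx_outer)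
    next
      case 4
      from Brk.IH(2)[OF this] obtain C b where "ctx C" "u = C (Dot b (Leaf z)) \<or> u =
          C (Dot (Leaf z) b)
        \<or> u = C (Brk b (Leaf z)) \<or> u = C (Brk (Leaf z) b)" by blast
      thus ?thesis by (intro exI[of _ "\<lambda>x. Brk s (C x)"] exI[of _ b]) (auto intro: ctx_outer)
    qed
  qed auto
  thus ?thesis using that by blast
qed

text \<open>The inductive step of spanning, in dual form. Since \<open>L\<close> is nonempty, the
  leaf \<open>z\<close> has a sibling \<open>b\<close>; up to sign the tree is
  \<open>C (b . z)\<close> or \<open>C [b, z]\<close>, and the two vanishing lemmas treat
  these.\<close>

theorem LL_functional_step:
  assumes f: "LL_functional h (insert z L) f" and z: "z \<notin> L" "finite L" "L \<noteq> {}"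
    and van: "\<And>u i. u \<in> trees_on L \<Longrightarrow> i \<in> L \<Longrightarrow> f (graft (Leaf(i := Brk (Leaf i) (Leaf z))) u) = 0"
    and van': "\<And>u. u \<in> trees_on L \<Longrightarrow> f (Dot u (Leaf z)) = 0"
    and t: "t \<in> trees_on (insert z L)"
  shows "f t = 0"
proof -
  note D = LL_functionalD[OF f]
  have "z \<in> set (leaves t)" "t \<noteq> Leaf z" using t z by (auto simp: trees_on_def)
  then obtain C b where C: "ctx C"
    "t = C (Dot b (Leaf z)) \<or> t = C (Dot (Leaf z) b) \<or> t = C (Brk b (Leaf z)) \<or> t =
        C (Brk (Leaf z) b)"
    by (rule leaf_in_ctx)
  from ctx_frame[OF C(1)] obtain K where K: "\<And>t. mset (leaves (C t)) = mset (leaves t) + K" by auto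
  have mem: "C (Dot b (Leaf z)) \<in> trees_on (insert z L)"
      "C (Brk b (Leaf z)) \<in> trees_on (insert z L)"
    using t C(2) z by (auto simp: trees_on_iff_mset K add_ac)
  have 1: "f (C (Dot b (Leaf z))) = 0"
    by (rule vanish_Dot_leaf[OF f z(1,2) van van' C(1) mem(1)])
  moreover have 2: "f (C (Brk b (Leaf z))) = 0"
    by (rule vanish_Brk_leaf[OF f z(1,2) van C(1) mem(2)])
  ultimately show ?thesis
    using C(2) D(1,2)[OF C(1) mem(1)] by auto
qed

section \<open>A basis of each component\<close>

text \<open>The entry in front of \<open>g\<close> belongs to the leaf m = length g + 2 and ranges
  over the m values 0, ..., m - 1. Hence there are n! indices of length n - 1.\<close>

primrec basis_index :: "nat list \<Rightarrow> bool" where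
  "basis_index [] \<longleftrightarrow> True"
| "basis_index (i # g) \<longleftrightarrow> i \<le> Suc (length g) \<and> basis_index g"

text \<open>
  The entry \<open>i\<close> at the front says where the leaf \<open>m\<close> is attached: bracketed with the leaf \<open>i\<close>, or,
  for \<open>i = 0\<close>, multiplied from outside.
\<close>
primrec basis_tree :: "nat list \<Rightarrow> nat tree" where
  "basis_tree [] = Leaf 1"
| "basis_tree (i # g) = (let m = Suc (Suc (length g)) in
     if i = 0 then Dot (basis_tree g) (Leaf m)
     else graft (Leaf(i := Brk (Leaf i) (Leaf m))) (basis_tree g))"

definition basis_indices :: "nat \<Rightarrow> nat list set"
  where "basis_indices n = {g. length g = n - 1 \<and> basis_index g}"

lemma finite_basis_indices [simp]: "finite (basis_indices n)"
proof -
  have "set g \<subseteq> {..length g}" if "basis_index g" for g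
    using that by (induction g) auto
  hence "basis_indices n \<subseteq> {g. set g \<subseteq> {..n} \<and> length g = n - 1}"
    by (force simp: basis_indices_def)
  thus ?thesis
    by (rule finite_subset) (simp add: finite_lists_length_eq)
qed

lemma graft_Brk_trees_on:
  assumes "t \<in> trees_on L" "i \<in> L" "z \<notin> L"
  shows "graft (Leaf(i := Brk (Leaf i) (Leaf z))) t \<in> trees_on (insert z L)"
proof -
  have "graft (Leaf(i := Brk (Leaf i) (Leaf z))) t \<in> trees_on (L - {i} \<union> {i, z})"
    using assms by (intro graft1_trees_on) (auto simp: trees_on_def)
  also have "L - {i} \<union> {i, z} = insert z L" using assms(2) by auto
  finally show ?thesis .
qed

lemma insert_Suc_interval: "{1..Suc (Suc k)} = insert (Suc (Suc k)) {1..Suc k}"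
  by auto

lemma basis_tree_trees_on: "basis_index g \<Longrightarrow> basis_tree g \<in> trees_on {1..Suc (length g)}"
proof (induction g)
  case (Cons i g)
  hence IH: "basis_tree g \<in> trees_on {1..Suc (length g)}" by simp
  show ?case
  proof (cases "i = 0")
    case True
    thus ?thesis using IH by (auto simp: trees_on_def)
  next
    case False
    thus ?thesis using IH Cons.prems graft_Brk_trees_on[OF IH, of i "Suc (Suc (length g))"]
      by (simp add: insert_Suc_interval[simplified])
  qed
qed (simp add: trees_on_def)

text \<open>Multiplying by a leaf at the root turns contexts into contexts, hence instances of the
  relations into instances. This feeds the induction on the number of leaves.\<close>

lemma LL_functional_Dot_leaf:
  assumes "LL_functional h (insert z L) f" "finite L" "z \<notin> L"
  shows "LL_functional h L (\<lambda>u. f (Dot u (Leaf z)))"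
proof -
  have mem: "Dot t (Leaf z) \<in> trees_on (insert z L)" if "t \<in> trees_on L" for t
    using that assms(3) by (auto simp: trees_on_def)
  show ?thesis
    unfolding LL_functional_def
  proof (intro allI impI)
    fix C :: "nat tree \<Rightarrow> nat tree" assume "ctx C"
    note D = LL_functionalD[OF assms(1) ctx_outer(1)[OF this, of "Leaf z"]]
    show "(\<forall>a b. C (Dot a b) \<in> trees_on L \<longrightarrow>
        f (Dot (C (Dot a b)) (Leaf z)) = f (Dot (C (Dot b a)) (Leaf z)) \<and>
        f (Dot (C (Brk a b)) (Leaf z)) = - f (Dot (C (Brk b a)) (Leaf z))) \<and>
      (\<forall>a b c. C (Dot (Dot a b) c) \<in> trees_on L \<longrightarrow>
        f (Dot (C (Brk (Dot a b) c)) (Leaf z)) =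
          f (Dot (C (Dot a (Brk b c))) (Leaf z)) + f (Dot (C (Dot (Brk a c) b)) (Leaf z)) \<and>
        f (Dot (C (Brk a (Brk b c))) (Leaf z)) + f (Dot (C (Brk b (Brk c a))) (Leaf z))
          + f (Dot (C (Brk c (Brk a b))) (Leaf z)) = 0 \<and>
        f (Dot (C (Dot (Dot a b) c)) (Leaf z)) =
          f (Dot (C (Dot a (Dot b c))) (Leaf z)) + h\<^sup>2 * f (Dot (C (Brk b (Brk a c))) (Leaf z)))"
      by (intro conjI allI impI D mem)
  qed
qed

text \<open>The same with a bracket at a leaf: grafting commutes with contexts by
  \<open>ctx_graft\<close>.\<close>

lemma LL_functional_graft_Brk:
  assumes "LL_functional h (insert z L) f" "i \<in> L" "z \<notin> L"
  shows "LL_functional h L (\<lambda>u. f (graft (Leaf(i := Brk (Leaf i) (Leaf z))) u))"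
  unfolding LL_functional_def
proof (intro allI impI)
  fix C :: "nat tree \<Rightarrow> nat tree" assume "ctx C"
  let ?\<sigma> = "Leaf(i := Brk (Leaf i) (Leaf z))"
  from \<open>ctx C\<close> obtain C' where C': "ctx C'" "\<And>t. graft ?\<sigma> (C t) = C' (graft ?\<sigma> t)"
    by (rule ctx_graft[where \<sigma> = ?\<sigma>]) (rule that)
  have mem: "C' (graft ?\<sigma> t) \<in> trees_on (insert z L)" if "C t \<in> trees_on L" for t
    using graft_Brk_trees_on[OF that assms(2,3)] by (simp only: C'(2))
  have mem2: "C' (Dot (graft ?\<sigma> a) (graft ?\<sigma> b)) \<in> trees_on (insert z L)"
      if "C (Dot a b) \<in> trees_on L" for a b
    using mem[OF that] by simp
  have mem3: "C' (Dot (Dot (graft ?\<sigma> a) (graft ?\<sigma> b)) (graft ?\<sigma> c)) \<in> trees_on (insert z L)"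
    if "C (Dot (Dot a b) c) \<in> trees_on L" for a b c
    using mem[OF that] by simp
  note D = LL_functionalD[OF assms(1) C'(1)]
  show "(\<forall>a b. C (Dot a b) \<in> trees_on L \<longrightarrow>
      f (graft ?\<sigma> (C (Dot a b))) = f (graft ?\<sigma> (C (Dot b a))) \<and>
      f (graft ?\<sigma> (C (Brk a b))) = - f (graft ?\<sigma> (C (Brk b a)))) \<and>
    (\<forall>a b c. C (Dot (Dot a b) c) \<in> trees_on L \<longrightarrow>
      f (graft ?\<sigma> (C (Brk (Dot a b) c))) =
          f (graft ?\<sigma> (C (Dot a (Brk b c)))) + f (graft ?\<sigma> (C (Dot (Brk a c) b))) \<and>
      f (graft ?\<sigma> (C (Brk a (Brk b c)))) + f (graft ?\<sigma> (C (Brk b (Brk c a)))) + f (graft ?\<sigma>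
          (C (Brk c (Brk a b)))) = 0 \<and>
      f (graft ?\<sigma> (C (Dot (Dot a b) c))) =
          f (graft ?\<sigma> (C (Dot a (Dot b c)))) + h\<^sup>2 * f (graft ?\<sigma> (C (Brk b (Brk a c)))))"
    unfolding C'(2) graft.simps
    by (intro conjI allI impI D mem2 mem3)
qed

text \<open>The dual form of the statement that the basis trees span the component. Both ways of
  attaching the last leaf pull \<open>f\<close> back to a functional on one leaf fewer.\<close>

theorem LL_functional_basis:
  assumes "LL_functional h {1..Suc k} f"
    "\<And>g. length g = k \<Longrightarrow> basis_index g \<Longrightarrow> f (basis_tree g) = 0" "t \<in> trees_on {1..Suc k}"
  shows "f t = 0"
  using assms
proof (induction k arbitrary: f t)
  case 0
  have "t = Leaf 1"
  proof (cases t)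
    case (Dot a b)
    thus ?thesis using 0(3) leaves_ne[of a] leaves_ne[of b]
      by (cases "leaves a"; cases "leaves b") (auto simp: trees_on_def)
  next
    case (Brk a b)
    thus ?thesis using 0(3) leaves_ne[of a] leaves_ne[of b]
      by (cases "leaves a"; cases "leaves b") (auto simp: trees_on_def)
  qed (use 0(3) in \<open>auto simp: trees_on_def\<close>)
  thus ?case using 0(2)[of "[]"] by simp
next
  case (Suc k)
  note f = Suc.prems(1)[unfolded insert_Suc_interval]
  have z: "Suc (Suc k) \<notin> {1..Suc k}" by simp
  show ?case
  proof (rule LL_functional_step[OF f z])
    fix u assume u: "u \<in> trees_on {1..Suc k}"
    show "f (Dot u (Leaf (Suc (Suc k)))) = 0"
    proof (rule Suc.IH[OF LL_functional_Dot_leaf[OF f finite_atLeastAtMost z] _ u])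
      fix g assume "length g = k" "basis_index g"
      thus "f (Dot (basis_tree g) (Leaf (Suc (Suc k)))) = 0"
        using Suc.prems(2)[of "0 # g"] by simp
    qed
    fix i assume i: "i \<in> {1..Suc k}"
    show "f (graft (Leaf(i := Brk (Leaf i) (Leaf (Suc (Suc k))))) u) = 0"
    proof (rule Suc.IH[OF LL_functional_graft_Brk[OF f i z] _ u])
      fix g assume "length g = k" "basis_index g"
      thus "f (graft (Leaf(i := Brk (Leaf i) (Leaf (Suc (Suc k))))) (basis_tree g)) = 0"
        using Suc.prems(2)[of "i # g"] i by simp
    qed
  qed (use Suc.prems(3) in \<open>simp_all only: insert_Suc_interval\<close>, simp_all)
qed

section \<open>The dual basis\<close>

lemma lookup_plus: "Poly_Mapping.lookup (M + N) =
    (\<lambda>e. Poly_Mapping.lookup M e + Poly_Mapping.lookup N e)"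
  by (rule ext) (rule lookup_add)

abbreviation poly_carrier :: "'v set \<Rightarrow> ('v, 'r::comm_ring_1) polynomial set"
  where "poly_carrier V \<equiv> carrier (poly_algebra V)"

lemma mem_poly_carrier:
  "P \<in> poly_carrier V \<longleftrightarrow> (\<forall>M\<in>Poly_Mapping.keys P. Poly_Mapping.keys M \<subseteq> V)"
  by (simp add: poly_algebra_def)

lemma poly_carrier_closed:
  fixes P Q :: "('v, 'r::comm_ring_1) polynomial"
  shows "0 \<in> poly_carrier V" "1 \<in> poly_carrier V"
    "P \<in> poly_carrier V \<Longrightarrow> Q \<in> poly_carrier V \<Longrightarrow> P + Q \<in> poly_carrier V"
    "P \<in> poly_carrier V \<Longrightarrow> Q \<in> poly_carrier V \<Longrightarrow> P - Q \<in> poly_carrier V"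
    "P \<in> poly_carrier V \<Longrightarrow> - P \<in> poly_carrier V"
    "P \<in> poly_carrier V \<Longrightarrow> scale c P \<in> poly_carrier V"
    "P \<in> poly_carrier V \<Longrightarrow> Q \<in> poly_carrier V \<Longrightarrow> P * Q \<in> poly_carrier V"
proof -
  show *: "P + Q \<in> poly_carrier V" if "P \<in> poly_carrier V" "Q \<in> poly_carrier V"
      for P Q :: "('v, 'r) polynomial"
    using that keys_add[of P Q] by (auto simp: mem_poly_carrier)
  show **: "scale c P \<in> poly_carrier V" if "P \<in> poly_carrier V" for c and P :: "('v, 'r) polynomial"
    using that keys_scale[of c P] by (auto simp: mem_poly_carrier)
  show "- P \<in> poly_carrier V" if "P \<in> poly_carrier V" for P :: "('v, 'r) polynomial"
    using **[OF that, of "- 1"] by (simp add: scale_minus_one)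
  thus "P - Q \<in> poly_carrier V" if "P \<in> poly_carrier V" "Q \<in> poly_carrier V"
    using *[of P "- Q"] that by simp
  show "P * Q \<in> poly_carrier V" if "P \<in> poly_carrier V" "Q \<in> poly_carrier V"
    unfolding mem_poly_carrier
  proof
    fix M assume "M \<in> Poly_Mapping.keys (P * Q)"
    then obtain A B where "M = A + B" "A \<in> Poly_Mapping.keys P" "B \<in> Poly_Mapping.keys Q"
      using keys_mult[of P Q] by auto
    thus "Poly_Mapping.keys M \<subseteq> V"
      using that keys_add[of A B] by (fastforce simp: mem_poly_carrier)
  qed
qed (auto simp: mem_poly_carrier)

lemma gen_x_carrier: "(i, j) \<in> V \<Longrightarrow> gen_x i j \<in> poly_carrier V"
  by (simp add: mem_poly_carrier)

lemma poly_carrier_sum: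
  "(\<And>a. a \<in> A \<Longrightarrow> f a \<in> poly_carrier V) \<Longrightarrow> sum f A \<in> poly_carrier V"
  by (induction A rule: infinite_finite_induct) (auto intro: poly_carrier_closed)

lemma poly_carrier_mono: "V \<subseteq> W \<Longrightarrow> poly_carrier V \<subseteq> poly_carrier W"
  unfolding subset_iff mem_poly_carrier by blast

lemma poly_algebra_ops [simp]:
  "monoid.mult (poly_algebra V) = (*)" "monoid.one (poly_algebra V) = 1"
  "ring.add (poly_algebra V) = (+)" "ring.zero (poly_algebra V) = 0"
  "module.smult (poly_algebra V) = scale"
  by (simp_all add: poly_algebra_def)

lemma poly_algebra_ring: "ring (poly_algebra V)"
proof (rule ringI)
  show "abelian_group (poly_algebra V)"
  proof (rule abelian_groupI)
    fix x assume "x \<in> poly_carrier V"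
    thus "\<exists>y\<in>poly_carrier V. y \<oplus>\<^bsub>poly_algebra V\<^esub> x = \<zero>\<^bsub>poly_algebra V\<^esub>"
      by (intro bexI[of _ "- x"] poly_carrier_closed) simp_all
  qed (simp_all add: poly_carrier_closed add_ac)
  show "Group.monoid (poly_algebra V)"
    by (rule monoidI) (simp_all add: poly_carrier_closed mult_ac)
qed (simp_all add: algebra_simps)

lemma gen_indices_mono: "m \<le> n \<Longrightarrow> gen_indices m \<subseteq> gen_indices n"
  by (auto simp: gen_indices_def)

section \<open>Pairing polynomials with trees, and the duality of the two families\<close>

context half_scalar
begin

definition pair_poly :: "('l \<times> 'l, 'r) polynomial \<Rightarrow> 'l tree \<Rightarrow> 'r"
  where "pair_poly P t = eval_lin (\<lambda>M. pairing (Poly_Mapping.lookup M) t) P"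

lemma pair_poly_simps [simp]:
  "pair_poly 0 t = 0" "pair_poly (P + Q) t = pair_poly P t + pair_poly Q t"
  "pair_poly (P - Q) t = pair_poly P t - pair_poly Q t"
  "pair_poly (- P) t = - pair_poly P t"
  "pair_poly (scale c P) t = c * pair_poly P t"
  by (simp_all add: pair_poly_def)

lemma pair_poly_sum: "pair_poly (sum f A) t = (\<Sum>a\<in>A. pair_poly (f a) t)"
  by (simp add: pair_poly_def eval_lin_sum)

lemma pair_poly_one:
  fixes t :: "'l tree"
  shows "pair_poly 1 t = pairing (\<lambda>e. 0) t"
proof -
  have "Poly_Mapping.lookup (0 :: 'l \<times> 'l \<Rightarrow>\<^sub>0 nat) = (\<lambda>e. 0)" by (rule ext) simp
  thus ?thesis by (simp add: pair_poly_def eval_lin_one)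
qed

lemma pair_poly_mult_gen_x:
  "pair_poly (P * gen_x i j) t =
    eval_lin (\<lambda>M. pairing (\<lambda>e. Poly_Mapping.lookup M e + unit_wt (i, j) e) t) P"
  by (simp add: pair_poly_def eval_lin_mult lookup_plus lookup_unit_wt)

lemma pair_poly_mult:
  "pair_poly (P * Q) t = eval_lin (\<lambda>(s, s'). pair_poly P s * pair_poly Q s') (tree_coprod h t)"
proof -
  have "pair_poly (P * Q) t = eval_lin (\<lambda>M. eval_lin (\<lambda>N. eval_lin
      (\<lambda>x. pairing (Poly_Mapping.lookup M) (fst x) *
          pairing (Poly_Mapping.lookup N) (snd x)) (tree_coprod h t)) Q) P"
    by (simp add: pair_poly_def eval_lin_mult lookup_plus pairing_coprod[symmetric] split_def)
  also have "\<dots> = eval_lin (\<lambda>M. eval_lin (\<lambda>x. eval_lin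
      (\<lambda>N. pairing (Poly_Mapping.lookup M) (fst x) *
          pairing (Poly_Mapping.lookup N) (snd x)) Q) (tree_coprod h t)) P"
    by (intro eval_lin_cong eval_lin_swap)
  also have "\<dots> = eval_lin (\<lambda>x. eval_lin (\<lambda>M. eval_lin
      (\<lambda>N. pairing (Poly_Mapping.lookup M) (fst x) *
          pairing (Poly_Mapping.lookup N) (snd x)) Q) P) (tree_coprod h t)"
    by (rule eval_lin_swap)
  also have "\<dots> = eval_lin (\<lambda>x. pair_poly P (fst x) * pair_poly Q (snd x)) (tree_coprod h t)"
    by (simp add: pair_poly_def eval_lin_fun_mult eval_lin_fun_mult_right)
  finally show ?thesis by (simp add: split_def)
qed

lemma pair_poly_dual_relations:
  assumes "P \<in> dual_relations h n" "t \<in> tree_monomials n"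
  shows "pair_poly P t = 0"
proof -
  have one: "pair_poly (gen_x i j) t = pairing (unit_wt (i, j)) t" for i j
    using pair_poly_mult_gen_x[of 1 i j t] by (simp add: eval_lin_one)
  have two: "pair_poly (gen_x i j * gen_x k l) t =
      pairing (\<lambda>e. unit_wt (i, j) e + unit_wt (k, l) e) t" for i j k l
    unfolding pair_poly_mult_gen_x by (simp add: lookup_unit_wt)
  have t: "distinct (leaves t)" "set (leaves t) = {1..n}" using assms(2)
      by (simp_all add: tree_monomials_def)
  from assms(1) show ?thesis
    unfolding dual_relations_def
  proof (elim UnE CollectE exE conjE)
    fix i j assume "P = gen_x i j + gen_x j i - scale h 1" "(i, j) \<in> gen_indices n"
    thus ?thesis using pairing_skew[OF t(1), of i j] t(2)
      by (simp add: gen_indices_def one pair_poly_one del: One_nat_def)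
  next
    fix i j assume "P = (gen_x i j)\<^sup>2 - scale h (gen_x i j)" "(i, j) \<in> gen_indices n"
    thus ?thesis using pairing_square[OF t(1), of i j] t(2)
      by (simp add: gen_indices_def one two power2_eq_square del: scale_simps One_nat_def)
  next
    fix i j k assume "P = gen_x i j * gen_x j k + scale h (gen_x i k) - (gen_x i j * gen_x i k +
        gen_x j k * gen_x i k)"
      "i \<in> {1..n}" "j \<in> {1..n}" "k \<in> {1..n}" "i \<noteq> j" "j \<noteq> k" "i \<noteq> k"
    thus ?thesis using pairing_triple[OF t(1), of i j k] t(2)
      by (simp add: one two del: scale_simps One_nat_def)
  qed
qed

text \<open>Both indices of a diagonal variable always lie in the same subtree. This is needed when
  \<open>i\<close> and \<open>z\<close> are merged into one block, because \<open>w (i, z)\<close>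
  then ends up in a diagonal exponent.\<close>

lemma pairing_cong_offdiag:
  assumes "distinct (leaves t)"
    "\<And>a b. a \<in> set (leaves t) \<Longrightarrow> b \<in> set (leaves t) \<Longrightarrow> a \<noteq> b \<Longrightarrow> v (a, b) = w (a, b)"
  shows "pairing v t = pairing w t"
  using assms
proof (induction t)
  case (Dot s t)
  have "cross v (set (leaves s)) (set (leaves t)) = cross w (set (leaves s)) (set (leaves t))"
    "cross v (set (leaves t)) (set (leaves s)) = cross w (set (leaves t)) (set (leaves s))"
    by (intro cross_cong; use Dot.prems in auto)+
  thus ?case using Dot by auto
next
  case (Brk s t)
  have "cross v (set (leaves s)) (set (leaves t)) = cross w (set (leaves s)) (set (leaves t))"
    "cross v (set (leaves t)) (set (leaves s)) = cross w (set (leaves t)) (set (leaves s))"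
    by (intro cross_cong; use Brk.prems in auto)+
  thus ?case using Brk by auto
qed auto

lemma pairing_Dot_leaf:
  "pairing w (Dot t (Leaf z)) =
    dot_wt (cross w (set (leaves t)) {z}) (cross w {z} (set (leaves t))) * pairing w t"
  by simp

lemma pairing_graft_Brk_gen:
  assumes t: "t \<in> trees_on L" and i: "i \<in> L" and z: "z \<notin> L"
  defines "B \<equiv> \<lambda>j. if j = i then {i, z} else {j}"
  shows "pairing w (graft (Leaf(i := Brk (Leaf i) (Leaf z))) t) =
    brk_wt (w (i, z)) (w (z, i)) * pairing (\<lambda>(j, k). cross w (B j) (B k)) t"
proof -
  let ?\<sigma> = "Leaf(i := Brk (Leaf i) (Leaf z))"
  have t': "distinct (leaves t)" "set (leaves t) = L" using t by (simp_all add: trees_on_def)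
  have iz: "i \<noteq> z" using i z by auto
  have "pairing w (graft ?\<sigma> t) = pairing (\<lambda>(j, k). cross w (B j) (B k)) t * (\<Prod>j\<in>L.
      pairing w (?\<sigma> j))"
    unfolding t'(2)[symmetric] using z t' iz
    by (intro pairing_graft) (auto simp: disjoint_family_on_def B_def)
  also have "(\<Prod>j\<in>L. pairing w (?\<sigma> j)) = (\<Prod>j\<in>L. if j = i then brk_wt (w (i, z)) (w (z, i)) else 1)"
    using iz by (intro prod.cong) auto
  also have "\<dots> = brk_wt (w (i, z)) (w (z, i))"
    using i finite_trees_on[OF t] by simp
  finally show ?thesis by (simp only: mult.commute)
qed

lemma pairing_graft_Brk:
  assumes t: "t \<in> trees_on L" and i: "i \<in> L" and z: "z \<notin> L"
  shows "(\<And>a. a \<in> L - {i} \<Longrightarrow> w (a, z) = 0 \<and> w (z, a) = 0) \<Longrightarrow>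
      pairing w (graft (Leaf(i := Brk (Leaf i) (Leaf z))) t) =
          brk_wt (w (i, z)) (w (z, i)) * pairing w t"
    and "w (i, z) = 0 \<Longrightarrow> w (z, i) = 0 \<Longrightarrow> pairing w (graft (Leaf(i := Brk (Leaf i) (Leaf z))) t) = 0"
proof -
  assume w: "\<And>a. a \<in> L - {i} \<Longrightarrow> w (a, z) = 0 \<and> w (z, a) = 0"
  let ?B = "\<lambda>j. if j = i then {i, z} else {j}"
  have iz: "i \<noteq> z" using i z by auto
  have "pairing (\<lambda>(j, k). cross w (?B j) (?B k)) t = pairing w t"
    using t w iz by (intro pairing_cong_offdiag) (auto simp: cross_pair trees_on_def)
  thus "pairing w (graft (Leaf(i := Brk (Leaf i) (Leaf z))) t) =
      brk_wt (w (i, z)) (w (z, i)) * pairing w t"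
    by (simp only: pairing_graft_Brk_gen[OF t i z])
qed (simp add: pairing_graft_Brk_gen[OF t i z] wt_simps del: fun_upd_apply)

text \<open>On linear orders this is \<open>h\<close> or \<open>- h\<close> according to the
  relative position of \<open>i\<close> and \<open>j\<close>.\<close>

definition gen_y :: "nat \<Rightarrow> nat \<Rightarrow> (nat \<times> nat, 'r) polynomial"
  where "gen_y i j = scale 2 (gen_x i j) - scale h 1"

lemma mult_gen_y: "P * gen_y i j = scale 2 (P * gen_x i j) - scale h P"
  by (simp add: gen_y_def right_diff_distrib del: scale_simps(5))

text \<open>The recursion for the pairing matrix: a factor 1 or \<open>y\<close> against a last leaf
  attached by product or by bracket. Without a variable at the new leaf a bracket has weight 0. With
  \<open>y\<close>, a product gives 2 (h/2) - h = 0; a bracket gives 1 if it sits at the same leaf,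
  and 0 otherwise.\<close>

lemma
  assumes P: "P \<in> poly_carrier (gen_indices k)" and t: "t \<in> trees_on {1..k}" and i: "i \<in> {1..k}"
  shows pair_poly_Dot_leaf: "pair_poly P (Dot t (Leaf (Suc k))) = pair_poly P t"
    and pair_poly_gen_y_Dot_leaf: "pair_poly (P * gen_y i (Suc k)) (Dot t (Leaf (Suc k))) = 0"
    and pair_poly_graft_Brk: "pair_poly P (graft (Leaf(i := Brk (Leaf i) (Leaf (Suc k)))) t) = 0"
    and pair_poly_gen_y_graft_Brk: "j \<in> {1..k} \<Longrightarrow>
      pair_poly (P * gen_y j (Suc k)) (graft (Leaf(i := Brk (Leaf i) (Leaf (Suc k)))) t) =
      (if i = j then pair_poly P t else 0)"
proof -
  let ?z = "Suc k" and ?u = "graft (Leaf(i := Brk (Leaf i) (Leaf (Suc k)))) t"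
  have t': "set (leaves t) = {1..k}" using t by (simp add: trees_on_def)
  have M0: "Poly_Mapping.lookup M (a, ?z) = 0" "Poly_Mapping.lookup M (?z, a) = 0"
    if "M \<in> Poly_Mapping.keys P" for M a
  proof -
    have "Poly_Mapping.keys M \<subseteq> gen_indices k" using that P by (simp add: mem_poly_carrier)
    hence "(a, ?z) \<notin> Poly_Mapping.keys M" "(?z, a) \<notin> Poly_Mapping.keys M"
        by (auto simp: gen_indices_def)
    thus "Poly_Mapping.lookup M (a, ?z) = 0" "Poly_Mapping.lookup M (?z, a) = 0"
        by (simp_all add: in_keys_iff)
  qed
  have cr: "cross (Poly_Mapping.lookup M) {1..k} {?z} = 0"
      "cross (Poly_Mapping.lookup M) {?z} {1..k} = 0"
    if "M \<in> Poly_Mapping.keys P" for M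
    using M0[OF that] by (simp_all add: cross_def)
  have z: "?z \<notin> {1..k}" by simp
  have dot1: "dot_wt 1 0 = half * h" using wt_simps(3)[of 0] by simp
  have unit_wt: "unit_wt (j, ?z) (a, b) = (if a = j \<and> b = ?z then 1 else 0)" for j a b
    by (simp add: unit_wt_def)
  have irr: "pairing (\<lambda>e. v e + unit_wt (j, ?z) e) t = pairing v t" for v j
    by (rule pairing_unit_wt_irrelevant) (simp add: t')
  show A: "pair_poly P (Dot t (Leaf ?z)) = pair_poly P t"
    unfolding pair_poly_def pairing_Dot_leaf t'
    by (intro eval_lin_cong) (simp add: cr wt_simps del: One_nat_def)
  show B: "pair_poly P ?u = 0"
  proof -
    have "pair_poly P ?u = eval_lin (\<lambda>M. 0) P"
      unfolding pair_poly_def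
      by (intro eval_lin_cong pairing_graft_Brk(2)[OF t i z]) (simp_all add: M0)
    thus ?thesis by simp
  qed
  have "pair_poly (P * gen_x i ?z) (Dot t (Leaf ?z)) =
      eval_lin (\<lambda>M. half * h * pairing (Poly_Mapping.lookup M) t) P"
    unfolding pair_poly_mult_gen_x pairing_Dot_leaf t' irr
    using i by (intro eval_lin_cong) (simp add: cr dot1 del: One_nat_def)
  hence "pair_poly (P * gen_x i ?z) (Dot t (Leaf ?z)) = half * h * pair_poly P t"
    by (simp add: eval_lin_fun_mult pair_poly_def)
  thus "pair_poly (P * gen_y i ?z) (Dot t (Leaf ?z)) = 0"
    using A half by (simp add: mult_gen_y mult.assoc[symmetric])
  assume j: "j \<in> {1..k}"
  have "pair_poly (P * gen_x j ?z) ?u = eval_lin (\<lambda>M. (if i =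
      j then half else 0) * pairing (Poly_Mapping.lookup M) t) P"
    unfolding pair_poly_mult_gen_x
  proof (intro eval_lin_cong)
    fix M assume M: "M \<in> Poly_Mapping.keys P"
    show "pairing (\<lambda>e. Poly_Mapping.lookup M e + unit_wt (j, ?z) e) ?u =
      (if i = j then half else 0) * pairing (Poly_Mapping.lookup M) t"
    proof (cases "i = j")
      case True
      thus ?thesis using i j M
          by (subst pairing_graft_Brk(1)[OF t i z]) (auto simp: M0 irr unit_wt wt_simps)
    next
      case False
      hence "pairing (\<lambda>e. Poly_Mapping.lookup M e + unit_wt (j, ?z) e) ?u = 0"
        using M i by (intro pairing_graft_Brk(2)[OF t i z]) (auto simp: M0 unit_wt_def)
      thus ?thesis using False by simp
    qed
  qed
  thus "pair_poly (P * gen_y j ?z) ?u = (if i = j then pair_poly P t else 0)"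
    using B half by (simp add: mult_gen_y eval_lin_fun_mult pair_poly_def[of P t, symmetric]
        mult.assoc[symmetric])
qed

primrec basis_poly :: "nat list \<Rightarrow> (nat \<times> nat, 'r) polynomial" where
  "basis_poly [] = 1"
| "basis_poly (i # g) = basis_poly g * (if i = 0 then 1 else gen_y i (Suc (Suc (length g))))"

lemma gen_y_carrier: "(i, j) \<in> V \<Longrightarrow> gen_y i j \<in> poly_carrier V"
  unfolding gen_y_def by (intro poly_carrier_closed gen_x_carrier)

lemma basis_poly_carrier: "basis_index g \<Longrightarrow>
    basis_poly g \<in> poly_carrier (gen_indices (Suc (length g)))"
proof (induction g)
  case (Cons i g)
  have "basis_poly g \<in> poly_carrier (gen_indices (Suc (length g)))" using Cons by simp
  hence 1: "basis_poly g \<in> poly_carrier (gen_indices (Suc (Suc (length g))))"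
    by (rule subsetD[OF poly_carrier_mono[OF gen_indices_mono], rotated]) simp
  show ?case
  proof (cases "i = 0")
    case False
    hence "gen_y i (Suc (Suc (length g))) \<in> poly_carrier (gen_indices (Suc (Suc (length g))))"
      using Cons.prems by (intro gen_y_carrier) (auto simp: gen_indices_def)
    thus ?thesis using 1 False poly_carrier_closed(7) by auto
  qed (use 1 in simp)
qed (simp add: poly_carrier_closed)

theorem pair_basis:
  "basis_index g \<Longrightarrow> basis_index g' \<Longrightarrow> length g = length g' \<Longrightarrow>
    pair_poly (basis_poly g) (basis_tree g') = (if g = g' then 1 else 0)"
proof (induction g arbitrary: g')
  case Nil
  thus ?case by (simp add: pair_poly_one)
next
  case (Cons i g)
  from Cons.prems(3) obtain j g'' where g': "g' = j # g''" by (cases g') auto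
  have len: "length g = length g''" using Cons.prems g' by simp
  have P: "basis_poly g \<in> poly_carrier (gen_indices (Suc (length g'')))"
    using basis_poly_carrier[of g] Cons.prems len by simp
  have t: "basis_tree g'' \<in> trees_on {1..Suc (length g'')}"
    using basis_tree_trees_on[of g''] Cons.prems g' by simp
  have IH: "pair_poly (basis_poly g) (basis_tree g'') = (if g = g'' then 1 else 0)"
    using Cons g' by simp
  have 1: "1 \<in> {1..Suc (length g'')}" by simp
  have i: "i \<noteq> 0 \<Longrightarrow> i \<in> {1..Suc (length g'')}" and j: "j \<noteq> 0 \<Longrightarrow> j \<in> {1..Suc (length g'')}"
    using Cons.prems g' len by auto
  show ?case
    unfolding g' using IH len i j
    by (cases "i = 0"; cases "j = 0")
      (auto simp: pair_poly_Dot_leaf[OF P t 1] pair_poly_graft_Brk[OF P t]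
        pair_poly_gen_y_Dot_leaf[OF P t] pair_poly_gen_y_graft_Brk[OF P t] simp del: fun_upd_apply)
qed

section \<open>Normal forms modulo the relations\<close>

definition rel_ideal :: "nat \<Rightarrow> (nat \<times> nat, 'r) polynomial set"
  where "rel_ideal n = Idl\<^bsub>poly_algebra (gen_indices n)\<^esub> (dual_relations h n)"

lemma dual_relationsI:
  "(i, j) \<in> gen_indices n \<Longrightarrow> gen_x i j + gen_x j i - scale h 1 \<in> dual_relations h n"
  "(i, j) \<in> gen_indices n \<Longrightarrow> (gen_x i j)\<^sup>2 - scale h (gen_x i j) \<in> dual_relations h n"
  "i \<in> {1..n} \<Longrightarrow> j \<in> {1..n} \<Longrightarrow> k \<in> {1..n} \<Longrightarrow> i \<noteq> j \<Longrightarrow> j \<noteq> k \<Longrightarrow> i \<noteq> k \<Longrightarrow>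
    gen_x i j * gen_x j k + scale h (gen_x i k) - (gen_x i j * gen_x i k + gen_x j k * gen_x i k)
      \<in> dual_relations h n"
  unfolding dual_relations_def by blast+

lemma dual_relations_carrier: "dual_relations h n \<subseteq> poly_carrier (gen_indices n)"
proof
  fix P assume "P \<in> dual_relations h n"
  thus "P \<in> poly_carrier (gen_indices n)"
    unfolding dual_relations_def
    by (elim UnE CollectE exE conjE; hypsubst; unfold power2_eq_square;
        intro poly_carrier_closed gen_x_carrier; auto simp: gen_indices_def)
qed

lemma rel_ideal: "ideal (rel_ideal n) (poly_algebra (gen_indices n))"
  unfolding rel_ideal_def by (rule ring.genideal_ideal[OF poly_algebra_ring dual_relations_carrier])

lemma rel_ideal_rules:
  shows "dual_relations h n \<subseteq> rel_ideal n" "rel_ideal n \<subseteq> poly_carrier (gen_indices n)"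
    "0 \<in> rel_ideal n"
    "P \<in> rel_ideal n \<Longrightarrow> Q \<in> rel_ideal n \<Longrightarrow> P + Q \<in> rel_ideal n"
    "P \<in> rel_ideal n \<Longrightarrow> Q \<in> poly_carrier (gen_indices n) \<Longrightarrow> P * Q \<in> rel_ideal n"
proof -
  interpret ideal "rel_ideal n" "poly_algebra (gen_indices n)" by (rule rel_ideal)
  show "dual_relations h n \<subseteq> rel_ideal n"
    unfolding rel_ideal_def
        by (rule ring.genideal_self[OF poly_algebra_ring dual_relations_carrier])
  show "rel_ideal n \<subseteq> poly_carrier (gen_indices n)" by (rule a_subset)
  show "0 \<in> rel_ideal n" using additive_subgroup.zero_closed[OF is_additive_subgroup] by simp
  show "P \<in> rel_ideal n \<Longrightarrow> Q \<in> rel_ideal n \<Longrightarrow> P + Q \<in> rel_ideal n"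
    using additive_subgroup.a_closed[OF is_additive_subgroup] by simp
  show "P \<in> rel_ideal n \<Longrightarrow> Q \<in> poly_carrier (gen_indices n) \<Longrightarrow> P * Q \<in> rel_ideal n"
    using I_r_closed by simp
qed

text \<open>The span of the basis polynomials on the indices up to \<open>k + 1\<close>, modulo the
  ideal. \<open>n\<close> fixes the ideal and stays put while \<open>k\<close> grows.\<close>

inductive_set nf_span :: "nat \<Rightarrow> nat \<Rightarrow> (nat \<times> nat, 'r) polynomial set" for n k where
  rel: "P \<in> rel_ideal n \<Longrightarrow> P \<in> nf_span n k"
| basis: "basis_index g \<Longrightarrow> length g = k \<Longrightarrow> scale c (basis_poly g) \<in> nf_span n k"
| add: "P \<in> nf_span n k \<Longrightarrow> Q \<in> nf_span n k \<Longrightarrow> P + Q \<in> nf_span n k"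

text \<open>Modulo the ideal, the polynomials of degree at most one in the variables
  \<open>x_iz\<close> with z = k + 1, with coefficients that do not involve the index z.\<close>

inductive_set linear_in_last :: "nat \<Rightarrow> nat \<Rightarrow> (nat \<times> nat, 'r) polynomial set" for n k where
  rel: "P \<in> rel_ideal n \<Longrightarrow> P \<in> linear_in_last n k"
| const: "P \<in> poly_carrier (gen_indices k) \<Longrightarrow> P \<in> linear_in_last n k"
| gen: "P \<in> poly_carrier (gen_indices k) \<Longrightarrow> i \<in> {1..k} \<Longrightarrow> P * gen_x i (Suc k) \<in> linear_in_last n k"
| add: "P \<in> linear_in_last n k \<Longrightarrow> Q \<in> linear_in_last n k \<Longrightarrow> P + Q \<in> linear_in_last n k"

text \<open>With z = k + 1, each relation removes one source of nonlinearity: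
  \<open>x_za = h - x_az\<close>, \<open>x_az^2 = h x_az\<close>, and the three-term relation for i,
  a, z gives \<open>x_iz x_az = x_ia x_az + h x_iz - x_ia x_iz\<close>.\<close>

lemma linear_in_last_mult_gen_x:
  assumes k: "Suc k \<le> n" and e: "(i, j) \<in> gen_indices (Suc k)" and P: "P \<in> linear_in_last n k"
  shows "P * gen_x i j \<in> linear_in_last n k"
proof -
  let ?z = "Suc k"
  have sub: "gen_indices k \<subseteq> gen_indices n" "gen_indices ?z \<subseteq> gen_indices n"
    using k by (auto intro!: gen_indices_mono)
  note sub' = subsetD[OF poly_carrier_mono[OF sub(1)]]
  have x: "gen_x a b \<in> poly_carrier (gen_indices n)" if "(a, b) \<in> gen_indices ?z" for a b
    using that sub(2) by (intro gen_x_carrier) auto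
  have old: "P * gen_x a b \<in> linear_in_last n k" if ab: "(a, b) \<in> gen_indices k" and
      "P \<in> linear_in_last n k" for a b P
    using that(2)
  proof induction
    case (rel P)
    thus ?case using ab by (intro linear_in_last.rel rel_ideal_rules x) (auto simp: gen_indices_def)
  next
    case (const P)
    thus ?case using ab by (intro linear_in_last.const poly_carrier_closed gen_x_carrier)
  next
    case (gen P i)
    have "(P * gen_x a b) * gen_x i ?z \<in> linear_in_last n k"
      using gen ab by (intro linear_in_last.gen poly_carrier_closed gen_x_carrier)
    thus ?case by (simp only: mult_ac)
  next
    case (add P Q)
    thus ?case by (simp add: distrib_right linear_in_last.add)
  qed
  have scaleI: "scale c P \<in> linear_in_last n k" if "P \<in> linear_in_last n k" for c P
    using that
  proof induction
    case (rel P)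
    have "P * scale c 1 \<in> rel_ideal n" using rel by (intro rel_ideal_rules poly_carrier_closed)
    thus ?case by (intro linear_in_last.rel) simp
  next
    case (gen P i)
    have "scale c P * gen_x i ?z \<in> linear_in_last n k"
      using gen by (intro linear_in_last.gen poly_carrier_closed)
    thus ?case by (simp only: scale_mult)
  qed (auto intro: linear_in_last.intros poly_carrier_closed simp: scale_distrib)
  have minusI: "P - Q \<in> linear_in_last n k" if "P \<in> linear_in_last n k" "Q \<in> linear_in_last n k"
      for P Q
    using linear_in_last.add[OF that(1) scaleI[OF that(2), of "- 1"]] by (simp add: scale_minus_one)
  have relmult: "R * P \<in> linear_in_last n k" if "R \<in> dual_relations h n"
      "P \<in> poly_carrier (gen_indices k)" for R P
    using that sub' rel_ideal_rules(1) by (intro linear_in_last.rel rel_ideal_rules) auto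
  have new: "P * gen_x a ?z \<in> linear_in_last n k" if a: "a \<in> {1..k}" and "P \<in> linear_in_last n k"
      for a P
    using that(2)
  proof induction
    case (rel P)
    thus ?case using a by (intro linear_in_last.rel rel_ideal_rules x) (auto simp: gen_indices_def)
  next
    case (const P)
    thus ?case using a by (intro linear_in_last.gen)
  next
    case (gen P i)
    show ?case
    proof (cases "i = a")
      case True
      have "(gen_x i ?z)\<^sup>2 - scale h (gen_x i ?z) \<in> dual_relations h n"
        using a True k by (intro dual_relationsI) (auto simp: gen_indices_def)
      from linear_in_last.add[OF relmult[OF this gen(1)] scaleI[OF linear_in_last.gen[OF gen],
          of h]]
      show ?thesis unfolding True
          by (simp add: algebra_simps power2_eq_square del: scale_simps One_nat_def)
    next
      case False
      have "gen_x i a * gen_x a ?z + scale h (gen_x i ?z) - (gen_x i a * gen_x i ?z + gen_x a ?z *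
          gen_x i ?z)
          \<in> dual_relations h n"
        using a gen(2) k False by (intro dual_relationsI) auto
      note r = relmult[OF this gen(1)]
      have "(i, a) \<in> gen_indices k" using a gen(2) False by (auto simp: gen_indices_def)
      hence x': "P * gen_x i a \<in> poly_carrier (gen_indices k)"
        using gen(1) by (intro poly_carrier_closed gen_x_carrier)
      have "(P * gen_x i a) * gen_x a ?z + scale h (P * gen_x i ?z) - (P * gen_x i a) * gen_x i ?z
        - (gen_x i a * gen_x a ?z + scale h (gen_x i ?z) - (gen_x i a * gen_x i ?z + gen_x a ?z *
            gen_x i ?z)) * P
        \<in> linear_in_last n k"
        by (intro minusI linear_in_last.add scaleI linear_in_last.gen r x' gen a)
      also have "(P * gen_x i a) * gen_x a ?z + scale h (P * gen_x i ?z) - (P * gen_x i a) *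
          gen_x i ?z
        - (gen_x i a * gen_x a ?z + scale h (gen_x i ?z) - (gen_x i a * gen_x i ?z + gen_x a ?z *
            gen_x i ?z)) * P
        = P * gen_x i ?z * gen_x a ?z"
        by (simp add: algebra_simps del: scale_simps One_nat_def)
      finally show ?thesis .
    qed
  next
    case (add P Q)
    thus ?case by (simp add: distrib_right linear_in_last.add)
  qed
  have new': "P * gen_x ?z a \<in> linear_in_last n k" if a: "a \<in> {1..k}" and P:
      "P \<in> linear_in_last n k" for a P
  proof -
    have "gen_x a ?z + gen_x ?z a - scale h 1 \<in> dual_relations h n"
      using a k by (intro dual_relationsI) (auto simp: gen_indices_def)
    hence rel: "gen_x a ?z + gen_x ?z a - scale h 1 \<in> rel_ideal n" using rel_ideal_rules(1) by blast
    have "P \<in> poly_carrier (gen_indices n)" using P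
    proof induction
      case (rel P) thus ?case using rel_ideal_rules(2) by blast
    next
      case (gen P i)
      show ?case using gen(2)
        by (intro poly_carrier_closed(7)[OF sub'[OF gen(1)] x]) (auto simp: gen_indices_def)
    qed (auto intro: poly_carrier_closed sub')
    hence "(gen_x a ?z + gen_x ?z a - scale h 1) * P \<in> linear_in_last n k"
      using rel by (intro linear_in_last.rel rel_ideal_rules)
    hence "(gen_x a ?z + gen_x ?z a - scale h 1) * P - P * gen_x a ?z + scale h P \<in>
        linear_in_last n k"
      using new[OF a P] scaleI[OF P] by (intro minusI linear_in_last.add)
    also have "(gen_x a ?z + gen_x ?z a - scale h 1) * P - P * gen_x a ?z + scale h P =
        P * gen_x ?z a"
      by (simp add: algebra_simps del: scale_simps(5) One_nat_def)
    finally show ?thesis .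
  qed
  consider "(i, j) \<in> gen_indices k" | "i \<in> {1..k}" "j = ?z" | "j \<in> {1..k}" "i = ?z"
    using e by (auto simp: gen_indices_def le_Suc_eq)
  thus ?thesis using old new new' P by cases auto
qed

lemma poly_carrier_linear_in_last:
  assumes "Suc k \<le> n"
  shows "poly_carrier (gen_indices (Suc k)) \<subseteq> linear_in_last n k"
proof
  have mono: "P * monom1 M \<in> linear_in_last n k"
    if "Poly_Mapping.keys M \<subseteq> gen_indices (Suc k)" "P \<in> linear_in_last n k" for M P
    using that(2)
  \<comment> \<open>An exponent vector is itself a formal sum of variables with natural
    coefficients, so the same induction rule splits a monomial into powers.\<close>
  proof (induction M arbitrary: P rule: linear_induct)
    case (single e c)
    show ?case using single.prems
    proof (induction c arbitrary: P)
      case (Suc c)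
      obtain i j where e: "e = (i, j)" by (cases e)
      have "P * monom1 (Poly_Mapping.single e c) * gen_x i j \<in> linear_in_last n k"
        using Suc single.hyps that(1) e by (intro linear_in_last_mult_gen_x[OF assms]) auto
      thus ?case by (simp add: mult.assoc mult_single e flip: single_add)
    qed simp
  next
    case (add A B)
    have "P * monom1 A * monom1 B \<in> linear_in_last n k" using add by blast
    thus ?case by (simp add: mult.assoc mult_single)
  qed simp
  fix P :: "(nat \<times> nat, 'r) polynomial" assume P: "P \<in> poly_carrier (gen_indices (Suc k))"
  show "P \<in> linear_in_last n k"
  proof (induction P rule: linear_induct)
    case zero
    show ?case by (intro linear_in_last.rel rel_ideal_rules)
  next
    case (single M c)
    have "scale c 1 * monom1 M \<in> linear_in_last n k"
      using single P by (intro mono linear_in_last.const poly_carrier_closed) (auto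
          simp: mem_poly_carrier)
    thus ?case by simp
  qed (rule linear_in_last.add)
qed

lemma poly_carrier_span: "Suc k \<le> n \<Longrightarrow> poly_carrier (gen_indices (Suc k)) \<subseteq> nf_span n k"
proof (induction k)
  case 0
  have "gen_indices 1 = {}" by (auto simp: gen_indices_def)
  show ?case
  proof
    fix P :: "(nat \<times> nat, 'r) polynomial" assume "P \<in> poly_carrier (gen_indices (Suc 0))"
    hence P: "Poly_Mapping.keys P \<subseteq> {0}"
      using \<open>gen_indices 1 = {}\<close> by (auto simp: mem_poly_carrier)
    have "P = scale (Poly_Mapping.lookup P 0) (basis_poly [])"
      by (rule poly_mapping_eqI) (use P in \<open>auto simp: lookup_one when_def in_keys_iff\<close>)
    also have "\<dots> \<in> nf_span n 0" by (rule nf_span.basis) simp_all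
    finally show "P \<in> nf_span n 0" .
  qed
next
  case (Suc k)
  have IH: "poly_carrier (gen_indices (Suc k)) \<subseteq> nf_span n k" using Suc by simp
  have lift: "P \<in> nf_span n (Suc k)" if "P \<in> nf_span n k" for P
    using that
  proof induction
    case (basis g c)
    have "scale c (basis_poly (0 # g)) \<in> nf_span n (Suc k)" using basis
        by (intro nf_span.basis) auto
    thus ?case by simp
  qed (auto intro: nf_span.intros)
  have lift': "P * gen_x i (Suc (Suc k)) \<in> nf_span n (Suc k)" if "P \<in> nf_span n k" "i \<in> {1..Suc k}"
      for P i
    using that(1)
  proof induction
    case (rel P)
    thus ?case using that(2) Suc.prems
      by (intro nf_span.rel rel_ideal_rules gen_x_carrier) (auto simp: gen_indices_def)
  next
    case (basis g c)
    \<comment> \<open>Solving the definition of \<open>gen_y\<close> for the variable gives x = half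
      y + half h.\<close>
    have "scale (c * half) (basis_poly (i # g)) + scale (c * half * h) (basis_poly (0 # g)) \<in>
        nf_span n (Suc k)"
      using basis that(2) by (intro nf_span.add nf_span.basis) auto
    also have "scale (c * half) (basis_poly (i # g)) + scale (c * half * h) (basis_poly (0 # g))
        = scale c (basis_poly g * scale (2 * half) (gen_x i (Suc (Suc k))))"
      using that(2) basis(2)
      by (simp add: gen_y_def scale_distrib right_diff_distrib mult_ac del: scale_simps(5))
    finally show ?case using half by (simp del: scale_simps(5))
  next
    case (add P Q)
    thus ?case by (simp add: distrib_right nf_span.add)
  qed
  show ?case
  proof
    fix P :: "(nat \<times> nat, 'r) polynomial" assume "P \<in> poly_carrier (gen_indices (Suc (Suc k)))"
    hence "P \<in> linear_in_last n (Suc k)" using poly_carrier_linear_in_last[OF Suc.prems] by blast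
    thus "P \<in> nf_span n (Suc k)"
    proof induction
      case (rel P) thus ?case by (rule nf_span.rel)
    next
      case (const P) thus ?case using IH lift by blast
    next
      case (gen P i) thus ?case using IH lift' by blast
    next
      case (add P Q) thus ?case using nf_span.add by blast
    qed
  qed
qed

text \<open>The annihilator of all trees is an ideal: a product is evaluated through the coproduct
  of the tree, whose first factors are again tree monomials of arity \<open>n\<close>. It therefore
  suffices to test the generating relations.\<close>

lemma rel_ideal_subset_kernel:
  assumes "P \<in> rel_ideal n" "t \<in> tree_monomials n"
  shows "pair_poly P t = 0"
proof -
  let ?K = "{P \<in> poly_carrier (gen_indices n). \<forall>t\<in>tree_monomials n. pair_poly P t = 0}"
  have mult: "pair_poly (P * Q) t = 0" if "P \<in> ?K" "t \<in> tree_monomials n" for P Q t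
  proof -
    have "pair_poly (P * Q) t = eval_lin (\<lambda>x. 0) (tree_coprod h t)"
      unfolding pair_poly_mult using that
      by (intro eval_lin_cong) (auto simp: tree_monomials_def dest!: keys_coprod)
    thus ?thesis by simp
  qed
  have "ideal ?K (poly_algebra (gen_indices n))"
  proof (rule idealI[OF poly_algebra_ring])
    show "subgroup ?K (add_monoid (poly_algebra (gen_indices n)))"
    proof (rule group.subgroupI)
      show "Group.group (add_monoid (poly_algebra (gen_indices n)))"
        using poly_algebra_ring by (rule ring.is_abelian_group[THEN abelian_group.a_group])
      show "?K \<noteq> {}" using poly_carrier_closed(1) by force
      fix a assume a: "a \<in> ?K"
      hence "inv\<^bsub>add_monoid (poly_algebra (gen_indices n))\<^esub> a = - a"
        using ring.is_abelian_group[OF poly_algebra_ring, THEN abelian_group.a_group]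
        by (intro group.inv_equality) (auto intro: poly_carrier_closed)
      thus "inv\<^bsub>add_monoid (poly_algebra (gen_indices n))\<^esub> a \<in> ?K"
        using a by (auto intro: poly_carrier_closed)
    qed (auto intro: poly_carrier_closed)
  next
    fix a x :: "(nat \<times> nat, 'r) polynomial" assume a: "a \<in> ?K" and x:
        "x \<in> poly_carrier (gen_indices n)"
    show "a \<otimes>\<^bsub>poly_algebra (gen_indices n)\<^esub> x \<in> ?K"
      using a x mult[OF a] by (auto intro: poly_carrier_closed)
    thus "x \<otimes>\<^bsub>poly_algebra (gen_indices n)\<^esub> a \<in> ?K"
      by (simp add: mult.commute)
  qed
  moreover have "dual_relations h n \<subseteq> ?K"
    using dual_relations_carrier pair_poly_dual_relations by blast
  ultimately have "rel_ideal n \<subseteq> ?K"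
    unfolding rel_ideal_def by (rule ring.genideal_minimal[OF poly_algebra_ring])
  thus ?thesis using assms by blast
qed

text \<open>The coefficients are forced, since pairing with basis trees kills the ideal and is dual
  to the basis polynomials. The claim is additive in \<open>P\<close>, so it is checked on the
  generators of \<open>nf_span\<close>.\<close>

lemma normal_form:
  assumes "P \<in> poly_carrier (gen_indices n)" "n \<ge> 1"
  shows "P - (\<Sum>g\<in>basis_indices n. scale (pair_poly P (basis_tree g)) (basis_poly g)) \<in> rel_ideal n"
proof -
  have mem: "basis_tree g \<in> tree_monomials n" if "g \<in> basis_indices n" for g
    using basis_tree_trees_on[of g] that assms(2) by (simp add: basis_indices_def tree_monomials_eq)
  have "P \<in> nf_span n (n - 1)"
    using poly_carrier_span[of "n - 1" n] assms by auto
  thus ?thesis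
  proof induction
    case (rel P)
    have "(\<Sum>g\<in>basis_indices n. scale (pair_poly P (basis_tree g)) (basis_poly g)) = 0"
      using rel_ideal_subset_kernel[OF rel] mem by (intro sum.neutral) auto
    thus ?case using rel by simp
  next
    case (basis g c)
    have "(\<Sum>g'\<in>basis_indices n.
        scale (pair_poly (scale c (basis_poly g)) (basis_tree g')) (basis_poly g')) =
        (\<Sum>g'\<in>basis_indices n. if g = g' then scale c (basis_poly g) else 0)"
      using basis by (intro sum.cong) (auto simp: basis_indices_def pair_basis)
    also have "\<dots> = scale c (basis_poly g)"
      using basis by (simp add: basis_indices_def[symmetric] sum.delta') (simp
          add: basis_indices_def)
    finally show ?case by (simp add: rel_ideal_rules)
  next
    case (add P Q)
    show ?case using rel_ideal_rules(4)[OF add.IH]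
      by (simp add: scale_distrib sum.distrib algebra_simps)
  qed
qed

text \<open>A polynomial that annihilates the basis trees has only zero coefficients in its normal
  form.\<close>

theorem rel_ideal_eq_kernel:
  assumes "n \<ge> 1"
  shows "rel_ideal n = {P \<in> poly_carrier (gen_indices n). \<forall>t\<in>tree_monomials n. pair_poly P t = 0}"
proof (intro equalityI subsetI)
  fix P assume "P \<in> rel_ideal n"
  thus "P \<in> {P \<in> poly_carrier (gen_indices n). \<forall>t\<in>tree_monomials n. pair_poly P t = 0}"
    using rel_ideal_rules(2) rel_ideal_subset_kernel by blast
next
  fix P assume P: "P \<in> {P \<in> poly_carrier (gen_indices n). \<forall>t\<in>tree_monomials n. pair_poly P t = 0}"
  have "(\<Sum>g\<in>basis_indices n. scale (pair_poly P (basis_tree g)) (basis_poly g)) = 0"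
  proof (intro sum.neutral ballI)
    fix g assume "g \<in> basis_indices n"
    hence "basis_tree g \<in> tree_monomials n"
      using basis_tree_trees_on[of g] assms by (simp add: basis_indices_def tree_monomials_eq)
    thus "scale (pair_poly P (basis_tree g)) (basis_poly g) = 0" using P by simp
  qed
  thus "P \<in> rel_ideal n" using normal_form[of P n] P assms by simp
qed

end

section \<open>The dual algebra of a component\<close>

lemma LL_class_eq:
  assumes "p \<in> free_op n"
  shows "LL_class h n p = {q \<in> free_op n. operad_ideal (LL_relations h) n (p - q)}"
  using assms by (auto simp: LL_class_def LL_rel_def)

lemma LL_class_self: "p \<in> free_op n \<Longrightarrow> p \<in> LL_class h n p"
  by (simp add: LL_class_eq operad_ideal.zero)

lemma LL_eq: "LL h n = LL_class h n ` free_op n"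
  by (auto simp: LL_def LL_class_def quotient_def)

lemma LL_class_in_LL: "p \<in> free_op n \<Longrightarrow> LL_class h n p \<in> LL h n"
  by (simp add: LL_eq)

lemma LL_class_cong:
  assumes "p \<in> free_op n" "q \<in> free_op n" "operad_ideal (LL_relations h) n (p - q)"
  shows "LL_class h n p = LL_class h n q"
proof -
  have "operad_ideal (LL_relations h) n (p - r) \<longleftrightarrow> operad_ideal (LL_relations h) n (q - r)" for r
  proof
    assume "operad_ideal (LL_relations h) n (p - r)"
    from operad_ideal.add[OF this operad_ideal.scale[OF assms(3), of "- 1"]]
    show "operad_ideal (LL_relations h) n (q - r)" by (simp add: scale_minus_one)
  next
    assume "operad_ideal (LL_relations h) n (q - r)"
    from operad_ideal.add[OF this assms(3)]
    show "operad_ideal (LL_relations h) n (p - r)" by (simp add: add.commute)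
  qed
  thus ?thesis using assms by (simp add: LL_class_eq)
qed

lemma LL_dual_eval:
  assumes "f \<in> LL_dual h n" "p \<in> free_op n"
  shows "f (LL_class h n p) = eval_lin (\<lambda>t. f (LL_class h n (monom1 t))) p"
proof -
  have f_add: "f (LL_class h n (p + q)) = f (LL_class h n p) + f (LL_class h n q)"
    if "p \<in> free_op n" "q \<in> free_op n" for p q
    using assms(1) that by (auto simp: LL_dual_def)
  have sc: "f (LL_class h n (scale a p)) = a * f (LL_class h n p)" if "p \<in> free_op n" for a p
    using assms(1) that by (auto simp: LL_dual_def)
  have "p \<in> free_op n \<and> f (LL_class h n p) = eval_lin (\<lambda>t. f (LL_class h n (monom1 t))) p"
  proof (induction p rule: linear_induct)
    case zero
    have "f (LL_class h n (scale 0 0)) = 0 * f (LL_class h n 0)" by (intro sc) auto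
    thus ?case by auto
  next
    case (single t c)
    hence t: "t \<in> tree_monomials n" using assms(2) by (auto simp: free_op_def)
    hence "f (LL_class h n (scale c (monom1 t))) = c * f (LL_class h n (monom1 t))"
        by (intro sc) auto
    thus ?case using t by auto
  next
    case (add p q)
    thus ?case by (auto simp: f_add)
  qed
  thus ?thesis ..
qed

context half_scalar
begin

text \<open>The choice of a representative is harmless, because the pairing is constant on classes
  (\<open>pair_poly_LL_class\<close>).\<close>

definition dual_elem :: "nat \<Rightarrow> (nat \<times> nat, 'r) polynomial \<Rightarrow> (nat tree \<Rightarrow>\<^sub>0 'r) set \<Rightarrow> 'r"
  where "dual_elem n P = (\<lambda>X\<in>LL h n. eval_lin (pair_poly P) (SOME p. p \<in> X))"

lemma pair_poly_operad_ideal: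
  assumes "operad_ideal (LL_relations h) n p"
  shows "eval_lin (pair_poly P) p = 0"
proof -
  have "eval_lin (pair_poly P) p = eval_lin (\<lambda>M. eval_lin (pairing (Poly_Mapping.lookup M)) p) P"
    unfolding pair_poly_def by (rule eval_lin_swap)
  thus ?thesis using pairing_operad_ideal[OF assms] by simp
qed

lemma pair_poly_LL_class:
  assumes "p \<in> free_op n" "q \<in> LL_class h n p"
  shows "eval_lin (pair_poly P) q = eval_lin (pair_poly P) p"
  using pair_poly_operad_ideal[of n "p - q" P] assms by (simp add: LL_class_eq)

lemma dual_elem_class:
  assumes "p \<in> free_op n"
  shows "dual_elem n P (LL_class h n p) = eval_lin (pair_poly P) p"
proof -
  have "(SOME q. q \<in> LL_class h n p) \<in> LL_class h n p"
    using LL_class_self[OF assms] by (rule someI)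
  thus ?thesis
    using pair_poly_LL_class[OF assms] LL_class_in_LL[OF assms] by (simp add: dual_elem_def)
qed

lemma dual_elem_tree: "t \<in> tree_monomials n \<Longrightarrow> dual_elem n P (LL_class h n (monom1 t)) =
    pair_poly P t"
  by (subst dual_elem_class) auto

lemma dual_elem_in_LL_dual: "dual_elem n P \<in> LL_dual h n"
proof -
  have "dual_elem n P \<in> LL h n \<rightarrow>\<^sub>E UNIV" by (simp add: dual_elem_def)
  thus ?thesis
    unfolding LL_dual_def by (auto simp: dual_elem_class free_op_closed)
qed

lemma LL_fun_eqI:
  assumes "f \<in> extensional (LL h n)" "g \<in> extensional (LL h n)"
    "\<And>p. p \<in> free_op n \<Longrightarrow> f (LL_class h n p) = g (LL_class h n p)"
  shows "f = g"
  using assms by (intro extensionalityI[of _ "LL h n"]) (auto simp: LL_eq)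

lemma dual_elem_extensional: "dual_elem n P \<in> extensional (LL h n)"
  by (simp add: dual_elem_def)

text \<open>Supplies the constancy on a class that product and unit of the dual algebra, defined
  through \<open>the_elem\<close>, rely on.\<close>

lemma the_elem_LL_class:
  assumes "p \<in> free_op n" "\<And>q. q \<in> free_op n \<Longrightarrow> F q = eval_lin (pair_poly P) q"
  shows "the_elem (F ` LL_class h n p) = eval_lin (pair_poly P) p"
proof -
  have "F q = eval_lin (pair_poly P) p" if "q \<in> LL_class h n p" for q
  proof -
    have "q \<in> free_op n" using that by (simp add: LL_class_eq[OF assms(1)])
    from assms(2)[OF this] pair_poly_LL_class[OF assms(1) that] show ?thesis by (rule trans)
  qed
  hence "F ` LL_class h n p = (\<lambda>q. eval_lin (pair_poly P) p) ` LL_class h n p"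
    by (rule image_cong[OF refl])
  also have "\<dots> = {eval_lin (pair_poly P) p}"
    by (rule image_constant[OF LL_class_self[OF assms(1)]])
  finally have "F ` LL_class h n p = {eval_lin (pair_poly P) p}" .
  thus ?thesis by simp
qed

lemma tensor_eval_dual_elem:
  assumes "p \<in> free_op n"
  shows "tensor_eval h n (dual_elem n P) (dual_elem n Q) (coprod h p) =
      eval_lin (pair_poly (P * Q)) p"
proof -
  have "tensor_eval h n (dual_elem n P) (dual_elem n Q) (coprod h p) = eval_lin (\<lambda>t. eval_lin
      (\<lambda>x. dual_elem n P (LL_class h n (monom1 (fst x))) *
          dual_elem n Q (LL_class h n (monom1 (snd x))))
      (tree_coprod h t)) p"
    unfolding tensor_eval_def coprod_def eval_lin_lin_ext[symmetric]
    by (simp add: eval_lin_def split_def mult.assoc)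
  also have "\<dots> = eval_lin (\<lambda>t. eval_lin (\<lambda>x. pair_poly P (fst x) *
      pair_poly Q (snd x)) (tree_coprod h t)) p"
  proof (intro eval_lin_cong)
    fix t x assume t: "t \<in> Poly_Mapping.keys p" and x: "x \<in> Poly_Mapping.keys (tree_coprod h t)"
    have "t \<in> tree_monomials n" using t assms by (auto simp: free_op_def)
    hence "fst x \<in> tree_monomials n" "snd x \<in> tree_monomials n"
      using keys_coprod[of "fst x" "snd x" h t] x by (auto simp: tree_monomials_def)
    thus "dual_elem n P (LL_class h n (monom1 (fst x))) *
        dual_elem n Q (LL_class h n (monom1 (snd x))) =
      pair_poly P (fst x) * pair_poly Q (snd x)"
      by (simp add: dual_elem_tree)
  qed
  also have "\<dots> = eval_lin (pair_poly (P * Q)) p"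
    by (rule eval_lin_cong) (simp add: pair_poly_mult split_def)
  finally show ?thesis .
qed

lemma dual_elem_ops:
  shows "dual_elem n (P * Q) = dual_elem n P \<otimes>\<^bsub>LL_dual_algebra h n\<^esub> dual_elem n Q"
    "dual_elem n (P + Q) = dual_elem n P \<oplus>\<^bsub>LL_dual_algebra h n\<^esub> dual_elem n Q"
    "dual_elem n 1 = \<one>\<^bsub>LL_dual_algebra h n\<^esub>"
    "dual_elem n (scale a P) = a \<odot>\<^bsub>LL_dual_algebra h n\<^esub> dual_elem n P"
proof -
  have fn: "pair_poly (P + Q) = (\<lambda>t. pair_poly P t + pair_poly Q t)"
    "pair_poly (scale a P) = (\<lambda>t. a * pair_poly P t)"
    by (rule ext, simp)+
  have one: "counit q = eval_lin (pair_poly 1) q" for q :: "nat tree \<Rightarrow>\<^sub>0 'r"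
    by (simp add: counit_def eval_lin_def pair_poly_one pairing_counit)
  show "dual_elem n (P * Q) = dual_elem n P \<otimes>\<^bsub>LL_dual_algebra h n\<^esub> dual_elem n Q"
    by (intro LL_fun_eqI[where n = n] dual_elem_extensional)
      (simp_all add: LL_dual_algebra_def dual_elem_class LL_class_in_LL
        the_elem_LL_class[where P = "P * Q"] tensor_eval_dual_elem)
  show "dual_elem n (P + Q) = dual_elem n P \<oplus>\<^bsub>LL_dual_algebra h n\<^esub> dual_elem n Q"
    by (intro LL_fun_eqI[where n = n] dual_elem_extensional)
      (simp_all add: LL_dual_algebra_def dual_elem_class LL_class_in_LL fn eval_lin_fun_add)
  show "dual_elem n 1 = \<one>\<^bsub>LL_dual_algebra h n\<^esub>"
    by (intro LL_fun_eqI[where n = n] dual_elem_extensional)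
      (simp_all add: LL_dual_algebra_def dual_elem_class LL_class_in_LL the_elem_LL_class[where P =
          1] one)
  show "dual_elem n (scale a P) = a \<odot>\<^bsub>LL_dual_algebra h n\<^esub> dual_elem n P"
    by (intro LL_fun_eqI[where n = n] dual_elem_extensional)
      (simp_all add: LL_dual_algebra_def dual_elem_class LL_class_in_LL fn eval_lin_fun_mult)
qed

lemma dual_elem_alg_hom: "dual_elem n \<in> alg_hom (poly_algebra V) (LL_dual_algebra h n)"
proof -
  have "dual_elem n P \<in> carrier (LL_dual_algebra h n)" for P
    using dual_elem_in_LL_dual by (simp add: LL_dual_algebra_def)
  thus ?thesis
    unfolding alg_hom_def by (auto intro!: ring_hom_memI simp: dual_elem_ops)
qed

text \<open>Interpolation: the coefficients of \<open>P\<close> are the values of \<open>f\<close>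
  on the basis trees. The difference \<open>D\<close> respects the relations and vanishes on these
  trees, hence on all trees by \<open>LL_functional_basis\<close>.\<close>

lemma dual_elem_surj:
  assumes f: "f \<in> LL_dual h n" and n: "n \<ge> 1"
  obtains P where "P \<in> poly_carrier (gen_indices n)" "f = dual_elem n P"
proof -
  define F where "F t = f (LL_class h n (monom1 t))" for t
  define P where "P = (\<Sum>g\<in>basis_indices n. scale (F (basis_tree g)) (basis_poly g))"
  define D where "D t = F t - pair_poly P t" for t
  obtain k where k: "n = Suc k" using n by (cases n) auto
  have "eval_lin D p = 0" if "operad_ideal (LL_relations h) n p" for p
  proof -
    have p: "p \<in> free_op n" using operad_ideal_free_op[OF that] .
    have "LL_class h n p = LL_class h n 0" using p that by (intro LL_class_cong) auto
    hence "f (LL_class h n p) = eval_lin F 0"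
      using LL_dual_eval[OF f free_op_closed(1)] by simp
    hence "eval_lin F p = 0" using LL_dual_eval[OF f p] by (simp add: F_def[abs_def])
    thus ?thesis using pair_poly_operad_ideal[OF that, of P]
      unfolding D_def by (simp add: eval_lin_fun_diff)
  qed
  hence D: "LL_functional h {1..Suc k} D" unfolding k by (rule LL_functionalI)
  have "D (basis_tree g) = 0" if g: "length g = k" "basis_index g" for g
  proof -
    have g': "g \<in> basis_indices n" using g k by (simp add: basis_indices_def)
    have "pair_poly P (basis_tree g) = (\<Sum>g'\<in>basis_indices n.
        if g' = g then F (basis_tree g) else 0)"
      unfolding P_def pair_poly_sum using g k
      by (intro sum.cong) (auto simp: basis_indices_def pair_basis)
    thus ?thesis using g' by (simp add: D_def)
  qed
  hence D0: "D t = 0" if "t \<in> tree_monomials n" for t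
    using LL_functional_basis[OF D] that unfolding k tree_monomials_eq by blast
  have "f = dual_elem n P"
  proof (rule LL_fun_eqI[OF _ dual_elem_extensional])
    show "f \<in> extensional (LL h n)" using f by (auto simp: LL_dual_def PiE_def)
    fix p :: "nat tree \<Rightarrow>\<^sub>0 'r" assume p: "p \<in> free_op n"
    have "eval_lin F p = eval_lin (pair_poly P) p"
      using D0 p by (intro eval_lin_cong) (auto simp: D_def free_op_def)
    thus "f (LL_class h n p) = dual_elem n P (LL_class h n p)"
      using LL_dual_eval[OF f p] by (simp add: dual_elem_class[OF p] F_def[abs_def])
  qed
  moreover have "P \<in> poly_carrier (gen_indices n)"
    unfolding P_def k
    by (intro poly_carrier_sum poly_carrier_closed) (auto simp: basis_indices_def dest:
        basis_poly_carrier)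
  ultimately show ?thesis using that by blast
qed

lemma dual_elem_eq_iff:
  "dual_elem n P = dual_elem n Q \<longleftrightarrow> (\<forall>t\<in>tree_monomials n. pair_poly P t = pair_poly Q t)"
proof
  assume *: "dual_elem n P = dual_elem n Q"
  show "\<forall>t\<in>tree_monomials n. pair_poly P t = pair_poly Q t"
  proof
    fix t assume "t \<in> tree_monomials n"
    from dual_elem_tree[OF this, of P] dual_elem_tree[OF this, of Q] *
    show "pair_poly P t = pair_poly Q t" by simp
  qed
next
  assume *: "\<forall>t\<in>tree_monomials n. pair_poly P t = pair_poly Q t"
  show "dual_elem n P = dual_elem n Q"
  proof (rule LL_fun_eqI[OF dual_elem_extensional dual_elem_extensional])
    fix p :: "nat tree \<Rightarrow>\<^sub>0 'r" assume p: "p \<in> free_op n"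
    show "dual_elem n P (LL_class h n p) = dual_elem n Q (LL_class h n p)"
      unfolding dual_elem_class[OF p] using * p by (intro eval_lin_cong) (auto simp: free_op_def)
  qed
qed

lemma dual_elem_image:
  assumes "n \<ge> 1"
  shows "dual_elem n ` poly_carrier (gen_indices n) = carrier (LL_dual_algebra h n)"
proof (intro equalityI subsetI)
  fix f assume "f \<in> carrier (LL_dual_algebra h n)"
  hence "f \<in> LL_dual h n" by (simp add: LL_dual_algebra_def)
  thus "f \<in> dual_elem n ` poly_carrier (gen_indices n)"
    using dual_elem_surj[OF _ assms] by blast
qed (auto simp: LL_dual_algebra_def dual_elem_in_LL_dual)

theorem LL_dual_presentation:
  assumes "n \<ge> 1"
  shows "presented_by (LL_dual_algebra h n) (gen_indices n) (dual_relations h n)"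
  unfolding presented_by_def
proof (intro bexI conjI)
  show "dual_elem n \<in> alg_hom (poly_algebra (gen_indices n)) (LL_dual_algebra h n)"
    by (rule dual_elem_alg_hom)
  show "dual_elem n ` poly_carrier (gen_indices n) = carrier (LL_dual_algebra h n)"
    by (rule dual_elem_image[OF assms])
  have "\<zero>\<^bsub>LL_dual_algebra h n\<^esub> = dual_elem n 0"
    by (intro LL_fun_eqI[where n = n] dual_elem_extensional)
      (simp_all add: LL_dual_algebra_def dual_elem_class LL_class_in_LL pair_poly_simps(1)[abs_def])
  hence "dual_elem n P = \<zero>\<^bsub>LL_dual_algebra h n\<^esub> \<longleftrightarrow> (\<forall>t\<in>tree_monomials n. pair_poly P t = 0)" for P
    by (simp add: dual_elem_eq_iff)
  hence "a_kernel (poly_algebra (gen_indices n)) (LL_dual_algebra h n) (dual_elem n) = rel_ideal n"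
    unfolding rel_ideal_eq_kernel[OF assms] by (simp add: a_kernel_def kernel_def)
  thus "a_kernel (poly_algebra (gen_indices n)) (LL_dual_algebra h n) (dual_elem n) =
    Idl\<^bsub>poly_algebra (gen_indices n)\<^esub> (dual_relations h n)"
    by (simp add: rel_ideal_def)
qed

end

section \<open>Evaluation at linear orders\<close>

context half_scalar
begin

text \<open>On a list without repetitions, a monomial in variables between distinct entries takes
  the value \<open>h\<close> to its degree if every variable points forward in the list, and 0
  otherwise.\<close>

primrec list_wt :: "('l \<times> 'l \<Rightarrow> nat) \<Rightarrow> 'l list \<Rightarrow> 'r" where
  "list_wt w [] = 1"
| "list_wt w (l # ls) = fwd (cross w {l} (set ls)) (cross w (set ls) {l}) * list_wt w ls"

lemma fwd_simps [simp]: "fwd 0 0 = 1" "fwd a 0 = h ^ a" "fwd 0 (Suc b) = 0" "fwd a (Suc b) = 0"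
  by (simp_all add: fwd_def)

lemma fwd_add: "fwd (a + a') (b + b') = fwd a b * fwd a' b'"
  by (simp add: fwd_def power_add)

lemma list_wt_add: "list_wt (\<lambda>e. v e + w e) ls = list_wt v ls * list_wt w ls"
  by (induction ls) (simp_all add: fwd_add)

lemma list_wt_zero: "list_wt (\<lambda>e. 0) ls = 1"
  by (induction ls) simp_all

lemma list_wt_append:
  "distinct (ls @ ls') \<Longrightarrow> list_wt w (ls @ ls') =
    fwd (cross w (set ls) (set ls')) (cross w (set ls') (set ls)) * list_wt w ls * list_wt w ls'"
proof (induction ls)
  case (Cons l ls)
  have "cross w {l} (set ls \<union> set ls') = cross w {l} (set ls) + cross w {l} (set ls')"
    "cross w (set ls \<union> set ls') {l} = cross w (set ls) {l} + cross w (set ls') {l}"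
    "cross w (insert l (set ls)) (set ls') = cross w {l} (set ls') + cross w (set ls) (set ls')"
    "cross w (set ls') (insert l (set ls)) = cross w (set ls') {l} + cross w (set ls') (set ls)"
    using Cons.prems by (intro cross_Un cross_insert; force)+
  thus ?case using Cons by (simp add: fwd_add mult_ac)
qed simp

definition list_poly :: "('l \<times> 'l, 'r) polynomial \<Rightarrow> 'l list \<Rightarrow> 'r"
  where "list_poly P ls = eval_lin (\<lambda>M. list_wt (Poly_Mapping.lookup M) ls) P"

lemma list_poly_simps [simp]:
  "list_poly 0 ls = 0" "list_poly (P + Q) ls = list_poly P ls + list_poly Q ls"
  "list_poly (P - Q) ls = list_poly P ls - list_poly Q ls"
  "list_poly (scale c P) ls = c * list_poly P ls"
  by (simp_all add: list_poly_def)

lemma list_poly_mult [simp]: "list_poly (P * Q) ls = list_poly P ls * list_poly Q ls"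
  by (simp add: list_poly_def eval_lin_mult lookup_plus list_wt_add eval_lin_fun_mult
      eval_lin_fun_mult_right)

lemma list_poly_one [simp]: "list_poly 1 ls = 1"
proof -
  have "Poly_Mapping.lookup (0 :: 'a \<times> 'a \<Rightarrow>\<^sub>0 nat) = (\<lambda>e. 0)" by (rule ext) simp
  thus ?thesis by (simp add: list_poly_def eval_lin_one list_wt_zero)
qed

lemma list_poly_prod: "list_poly (\<Prod>a\<in>A. f a) ls = (\<Prod>a\<in>A. list_poly (f a) ls)"
  by (induction A rule: infinite_finite_induct) auto

lemma list_poly_sum: "list_poly (\<Sum>a\<in>A. f a) ls = (\<Sum>a\<in>A. list_poly (f a) ls)"
  by (induction A rule: infinite_finite_induct) auto

lemma list_poly_gen_x:
  fixes x :: "nat \<Rightarrow> real"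
  assumes "sorted_wrt (\<lambda>a b. x a < x b) ls" "i \<in> set ls" "j \<in> set ls" "i \<noteq> j"
  shows "list_poly (gen_x i j) ls = (if x i < x j then h else 0)"
proof -
  have irr: "list_wt (unit_wt (i, j)) ls = 1" if "i \<notin> set ls \<or> j \<notin> set ls" for ls
    using that by (induction ls) auto
  have "list_wt (unit_wt (i, j)) ls = (if x i < x j then h else 0)"
    using assms
  proof (induction ls)
    case (Cons l ls)
    consider "l = i" | "l = j" | "l \<noteq> i" "l \<noteq> j" by blast
    thus ?case
    proof cases
      case 1
      hence "x i < x j" "i \<notin> set ls" "j \<in> set ls" using Cons.prems by auto
      thus ?thesis using 1 irr[of ls] Cons.prems by simp
    next
      case 2
      hence "\<not> x i < x j" "j \<notin> set ls" "i \<in> set ls" using Cons.prems by force+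
      thus ?thesis using 2 irr[of ls] Cons.prems by (simp add: fwd_def)
    next
      case 3
      thus ?thesis using Cons by simp
    qed
  qed simp
  thus ?thesis by (simp add: list_poly_def lookup_unit_wt)
qed

text \<open>Expanding x * t = x . t + h [x, t] letter by letter from the right writes a linear order
  as a combination of trees that does not depend on \<open>w\<close>.\<close>

lemma list_wt_eq_pairing:
  assumes "ls \<noteq> []" "distinct ls"
  shows "\<exists>p. Poly_Mapping.keys p \<subseteq> trees_on (set ls) \<and> (\<forall>w. list_wt w ls = eval_lin (pairing w) p)"
  using assms
proof (induction ls rule: list_nonempty_induct)
  case (single x)
  show ?case by (rule exI[of _ "monom1 (Leaf x)"]) (auto simp: trees_on_def)
next
  case (cons x ls)
  then obtain p where p: "Poly_Mapping.keys p \<subseteq> trees_on (set ls)" "\<And>w. list_wt w ls =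
      eval_lin (pairing w) p"
    by auto
  let ?q = "map_basis (Dot (Leaf x)) p + scale h (map_basis (Brk (Leaf x)) p)"
  have "Poly_Mapping.keys ?q \<subseteq> Dot (Leaf x) ` Poly_Mapping.keys p \<union> Brk (Leaf x) `
      Poly_Mapping.keys p"
    using keys_add[of "map_basis (Dot (Leaf x)) p" "scale h (map_basis (Brk (Leaf x)) p)"]
      keys_scale[of h "map_basis (Brk (Leaf x)) p"] keys_map_basis[of "Dot (Leaf x)" p]
      keys_map_basis[of "Brk (Leaf x)" p] by blast
  also have "\<dots> \<subseteq> trees_on (set (x # ls))"
    using p(1) cons.prems by (auto simp: trees_on_def)
  finally have keys: "Poly_Mapping.keys ?q \<subseteq> trees_on (set (x # ls))" .
  have "list_wt w (x # ls) = eval_lin (pairing w) ?q" for w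
  proof -
    let ?a = "cross w {x} (set ls)" and ?b = "cross w (set ls) {x}"
    have "eval_lin (pairing w) (map_basis (Dot (Leaf x)) p) =
        eval_lin (\<lambda>t. dot_wt ?a ?b * pairing w t) p"
      "eval_lin (pairing w) (map_basis (Brk (Leaf x)) p) =
          eval_lin (\<lambda>t. brk_wt ?a ?b * pairing w t) p"
      unfolding eval_lin_lin_ext using p(1) by (auto simp: trees_on_def intro!: eval_lin_cong)
    thus ?thesis
      by (simp add: p(2) eval_lin_fun_mult wt_fwd[symmetric] distrib_right mult.assoc)
  qed
  with keys show ?case by blast
qed

text \<open>The converse expansion, a . b = (a * b + b * a) / 2 and [a, b] = (a * b - b * a) / (2
  h). This is where \<open>h\<close> must be invertible.\<close>

lemma pairing_eq_list_wt:
  fixes t :: "'l tree"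
  assumes hi: "h * hi = 1" and "distinct (leaves t)"
  shows "\<exists>p. Poly_Mapping.keys p \<subseteq> {ls. distinct ls \<and> set ls = set (leaves t)} \<and>
    (\<forall>w. pairing w t = eval_lin (list_wt w) p)"
  using assms(2)
proof (induction t)
  case (Leaf x)
  show ?case by (rule exI[of _ "monom1 [x]"]) auto
next
  \<comment> \<open>The two concatenations enter with coefficients \<open>c\<close> and
    \<open>c * d\<close>: \<open>d = 1\<close> serves the dot and \<open>d = - 1\<close> the
    bracket.\<close>
  have combine: "\<exists>r. Poly_Mapping.keys r \<subseteq> {ls. distinct ls \<and> set ls = A \<union> B} \<and>
      (\<forall>w. eval_lin (list_wt w) r =
          c * (fwd (cross w A B) (cross w B A) + d * fwd (cross w B A) (cross w A B))
        * eval_lin (list_wt w) p * eval_lin (list_wt w) q)"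
    if p: "Poly_Mapping.keys p \<subseteq> {ls. distinct ls \<and> set ls = A}"
      and q: "Poly_Mapping.keys q \<subseteq> {ls. distinct ls \<and> set ls = B}" and "A \<inter> B = {}"
    for p q :: "'l list \<Rightarrow>\<^sub>0 'r" and A B c d
  proof -
    let ?r = "lin_ext (\<lambda>a. lin_ext (\<lambda>b. scale c (monom1 (a @ b)) + scale (c * d) (monom1 (b @
        a))) q) p"
    have "Poly_Mapping.keys ?r \<subseteq> (\<Union>a\<in>Poly_Mapping.keys p. \<Union>b\<in>Poly_Mapping.keys q.
        Poly_Mapping.keys (scale c (monom1 (a @ b)) + scale (c * d) (monom1 (b @ a))))"
      by (intro order_trans[OF keys_lin_ext] UN_mono order_refl keys_lin_ext)
    also have "\<dots> \<subseteq> (\<Union>a\<in>Poly_Mapping.keys p. \<Union>b\<in>Poly_Mapping.keys q. {a @ b, b @ a})"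
      by (intro UN_mono order_refl order_trans[OF keys_add]) (auto split: if_splits)
    also have "\<dots> \<subseteq> {ls. distinct ls \<and> set ls = A \<union> B}"
      using p q that(3) by fastforce
    finally have keys: "Poly_Mapping.keys ?r \<subseteq> {ls. distinct ls \<and> set ls = A \<union> B}" .
    have "eval_lin (list_wt w) ?r =
        c * (fwd (cross w A B) (cross w B A) + d * fwd (cross w B A) (cross w A B))
        * eval_lin (list_wt w) p * eval_lin (list_wt w) q" for w
    proof -
      let ?k = "c * (fwd (cross w A B) (cross w B A) + d * fwd (cross w B A) (cross w A B))"
      have "eval_lin (list_wt w) ?r =
          eval_lin (\<lambda>a. eval_lin (\<lambda>b. ?k * list_wt w a * list_wt w b) q) p"
        unfolding eval_lin_lin_ext
      proof (intro eval_lin_cong)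
        fix a b assume "a \<in> Poly_Mapping.keys p" "b \<in> Poly_Mapping.keys q"
        hence "distinct (a @ b)" "distinct (b @ a)" "set a = A" "set b = B" using p q that(3)
            by auto
        thus "eval_lin (list_wt w) (scale c (monom1 (a @ b)) + scale (c * d) (monom1 (b @ a))) =
            ?k * list_wt w a * list_wt w b"
          by (simp add: list_wt_append algebra_simps)
      qed
      also have "\<dots> = ?k * eval_lin (list_wt w) p * eval_lin (list_wt w) q"
        by (simp add: eval_lin_fun_mult eval_lin_fun_mult_right)
      finally show ?thesis .
    qed
    with keys show ?thesis by blast
  qed
  have brk: "brk_wt a b = half * hi * (fwd a b + (- 1) * fwd b a)" for a b
  proof -
    have cancel: "h * (half * (hi * x)) = half * x" for x
      using hi by (metis mult.assoc mult.left_commute mult_1)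
    show ?thesis by (cases a; cases b) (simp_all add: wt_simps mult_ac cancel)
  qed
  {
    case (Dot s t)
    then obtain p q where p: "Poly_Mapping.keys p \<subseteq> {ls. distinct ls \<and> set ls = set (leaves s)}"
        "\<forall>w. pairing w s = eval_lin (list_wt w) p"
      and q: "Poly_Mapping.keys q \<subseteq> {ls. distinct ls \<and> set ls = set (leaves t)}"
        "\<forall>w. pairing w t = eval_lin (list_wt w) q" by auto
    from Dot.prems have "set (leaves s) \<inter> set (leaves t) = {}" by simp
    from combine[OF p(1) q(1) this, of half 1] obtain r
      where "Poly_Mapping.keys r \<subseteq> {ls. distinct ls \<and> set ls = set (leaves s) \<union> set (leaves t)} \<and>
          (\<forall>w. eval_lin (list_wt w) r =
          half * (fwd (cross w (set (leaves s)) (set (leaves t))) (cross w (set (leaves t)) (set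
          (leaves s)))
          + 1 * fwd (cross w (set (leaves t)) (set (leaves s))) (cross w (set (leaves s)) (set
              (leaves t))))
        * eval_lin (list_wt w) p * eval_lin (list_wt w) q)" ..
    thus ?case by (intro exI[of _ r]) (simp add: p(2) q(2) dot_wt_def)
  next
    case (Brk s t)
    then obtain p q where p: "Poly_Mapping.keys p \<subseteq> {ls. distinct ls \<and> set ls = set (leaves s)}"
        "\<forall>w. pairing w s = eval_lin (list_wt w) p"
      and q: "Poly_Mapping.keys q \<subseteq> {ls. distinct ls \<and> set ls = set (leaves t)}"
        "\<forall>w. pairing w t = eval_lin (list_wt w) q" by auto
    from Brk.prems have "set (leaves s) \<inter> set (leaves t) = {}" by simp
    from combine[OF p(1) q(1) this, of "half * hi" "- 1"] obtain r
      where "Poly_Mapping.keys r \<subseteq> {ls. distinct ls \<and> set ls = set (leaves s) \<union> set (leaves t)} \<and>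
          (\<forall>w. eval_lin (list_wt w) r =
          (half * hi) * (fwd (cross w (set (leaves s)) (set (leaves t))) (cross w (set (leaves t))
          (set (leaves s)))
          + (- 1) * fwd (cross w (set (leaves t)) (set (leaves s))) (cross w (set (leaves s)) (set
              (leaves t))))
        * eval_lin (list_wt w) p * eval_lin (list_wt w) q)" ..
    thus ?case by (intro exI[of _ r]) (simp add: p(2) q(2) brk)
  }
qed

text \<open>Trees and orders are fixed linear combinations of each other, so they have the same
  annihilator.\<close>

lemma pair_poly_vanish_iff:
  assumes hi: "h * hi = 1" and L: "L \<noteq> {}"
  shows "(\<forall>t\<in>trees_on L. pair_poly P t = 0) \<longleftrightarrow> (\<forall>ls. distinct ls \<and> set ls = L \<longrightarrow> list_poly P ls = 0)"
proof (intro iffI ballI allI impI)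
  fix ls assume *: "\<forall>t\<in>trees_on L. pair_poly P t = 0" and ls: "distinct ls \<and> set ls = L"
  with L have "ls \<noteq> []" by auto
  from list_wt_eq_pairing[OF this] ls obtain p where
    p: "Poly_Mapping.keys p \<subseteq> trees_on L" "\<forall>w. list_wt w ls = eval_lin (pairing w) p" by auto
  have "list_poly P ls = eval_lin (pair_poly P) p"
    unfolding list_poly_def pair_poly_def p(2)[rule_format] by (rule eval_lin_swap)
  also have "\<dots> = eval_lin (\<lambda>t. 0) p" using p(1) * by (intro eval_lin_cong) auto
  finally show "list_poly P ls = 0" by simp
next
  fix t assume *: "\<forall>ls. distinct ls \<and> set ls = L \<longrightarrow> list_poly P ls = 0" and t: "t \<in> trees_on L"
  from pairing_eq_list_wt[OF hi, of t] t obtain p where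
    p: "Poly_Mapping.keys p \<subseteq> {ls. distinct ls \<and> set ls = L}" "\<forall>w. pairing w t =
        eval_lin (list_wt w) p"
    by (auto simp: trees_on_def)
  have "pair_poly P t = eval_lin (list_poly P) p"
    unfolding list_poly_def pair_poly_def p(2)[rule_format] by (rule eval_lin_swap)
  also have "\<dots> = eval_lin (\<lambda>t. 0) p" using p(1) * by (intro eval_lin_cong) auto
  finally show "pair_poly P t = 0" by simp
qed

end

section \<open>The chambers of the braid arrangement\<close>

lemma braid_complement_iff:
  "x \<in> braid_complement n \<longleftrightarrow> x \<in> extensional {1..n} \<and> inj_on x {1..n}"
proof -
  have "inj_on x {1..n} \<longleftrightarrow> (\<forall>i j. 1 \<le> i \<and> i < j \<and> j \<le> n \<longrightarrow> x i \<noteq> x j)"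
  proof
    assume "inj_on x {1..n}"
    thus "\<forall>i j. 1 \<le> i \<and> i < j \<and> j \<le> n \<longrightarrow> x i \<noteq> x j" by (auto simp: inj_on_eq_iff)
  next
    assume *: "\<forall>i j. 1 \<le> i \<and> i < j \<and> j \<le> n \<longrightarrow> x i \<noteq> x j"
    show "inj_on x {1..n}"
    proof (rule inj_onI, rule ccontr)
      fix i j assume "i \<in> {1..n}" "j \<in> {1..n}" "x i = x j" "i \<noteq> j"
      thus False using *[rule_format, of i j] *[rule_format, of j i] by (cases "i < j") auto
    qed
  qed
  thus ?thesis
    by (auto simp: braid_complement_def braid_arrangement_def PiE_def)
qed

definition order_list :: "nat \<Rightarrow> (nat \<Rightarrow> real) \<Rightarrow> nat list"
  where "order_list n x = sort_key x [1..<Suc n]"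

lemma order_list:
  "set (order_list n x) = {1..n}" "distinct (order_list n x)" "sorted (map x (order_list n x))"
  by (auto simp: order_list_def)

lemma sorted_wrt_order_list:
  assumes "inj_on x {1..n}"
  shows "sorted_wrt (\<lambda>a b. x a < x b) (order_list n x)"
proof -
  have "distinct (map x (order_list n x))" using assms by (simp add: distinct_map order_list)
  hence "sorted_wrt (<) (map x (order_list n x))"
    using order_list(3)[where n = n and x = x] by (simp add: strict_sorted_iff)
  thus ?thesis by (simp add: sorted_wrt_map)
qed

lemma order_list_eqI:
  assumes "inj_on x {1..n}" "distinct ls" "set ls = {1..n}" "sorted (map x ls)"
  shows "order_list n x = ls"
  using assms order_list[where n = n and x = x]
  by (intro map_sorted_distinct_set_unique[of x]) (simp_all add: distinct_map)

lemma order_list_surj: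
  assumes "distinct ls" "set ls = {1..n}"
  obtains x where "x \<in> braid_complement n" "order_list n x = ls"
proof -
  define x where "x = (\<lambda>i\<in>{1..n}. real (inv_into {..<length ls} ((!) ls) i))"
  have inj: "inj_on ((!) ls) {..<length ls}" using assms(1) by (simp add: inj_on_nth)
  have x: "x (ls ! k) = real k" if "k < length ls" for k
  proof -
    have "ls ! k \<in> {1..n}" using that assms(2) nth_mem by blast
    thus ?thesis using inv_into_f_f[OF inj, of k] that by (simp add: x_def)
  qed
  have "inj_on x (set ls)"
    by (auto simp: inj_on_def in_set_conv_nth x)
  moreover have "sorted (map x ls)"
    by (auto simp: sorted_iff_nth_mono x)
  moreover have "x \<in> extensional {1..n}" by (simp add: x_def)
  ultimately show ?thesis
    using assms by (intro that[of x] order_list_eqI) (simp_all add: braid_complement_iff)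
qed

text \<open>A chamber is recorded by its sign vector, as the set of strict inequalities that hold on
  it.\<close>

definition chamber :: "nat \<Rightarrow> (nat \<Rightarrow> real) \<Rightarrow> (nat \<times> nat) set"
  where "chamber n x = {(i, j) \<in> gen_indices n. x i < x j}"

lemma finite_gen_indices [simp]: "finite (gen_indices n)"
  by (rule finite_subset[of _ "{1..n} \<times> {1..n}"]) (auto simp: gen_indices_def)

lemma finite_chamber [simp]: "finite (chamber n x)"
  by (rule finite_subset[of _ "gen_indices n"]) (auto simp: chamber_def)

text \<open>For any two distinct indices, exactly one of the two possible inequalities holds at a
  point of the complement, so no sign vector properly contains another.\<close>

lemma chamber_subset_iff:
  assumes "x \<in> braid_complement n" "y \<in> braid_complement n"
  shows "chamber n x \<subseteq> chamber n y \<longleftrightarrow> chamber n x = chamber n y"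
proof
  assume sub: "chamber n x \<subseteq> chamber n y"
  have "e \<in> chamber n x" if "e \<in> chamber n y" for e
  proof (rule ccontr)
    obtain i j where e: "e = (i, j)" by (cases e)
    assume "e \<notin> chamber n x"
    moreover have "i \<in> {1..n}" "j \<in> {1..n}" "i \<noteq> j" "y i < y j"
      using that e by (auto simp: chamber_def gen_indices_def)
    moreover have "x i \<noteq> x j"
      using assms(1) calculation by (auto simp: braid_complement_iff inj_on_eq_iff)
    ultimately have "(j, i) \<in> chamber n x" by (auto simp: e chamber_def gen_indices_def)
    hence "y j < y i" using sub by (auto simp: chamber_def)
    thus False using \<open>y i < y j\<close> by simp
  qed
  thus "chamber n x = chamber n y" using sub by blast
qed simp

lemma order_list_cong:
  assumes "x \<in> braid_complement n" "y \<in> braid_complement n" "chamber n x = chamber n y"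
  shows "order_list n x = order_list n y"
proof (rule order_list_eqI)
  show "inj_on x {1..n}" using assms(1) by (simp add: braid_complement_iff)
  have le: "x i \<le> x j" if "i \<in> {1..n}" "j \<in> {1..n}" "y i \<le> y j" for i j
  proof (rule ccontr)
    assume "\<not> x i \<le> x j"
    hence "(j, i) \<in> chamber n x" using that by (auto simp: chamber_def gen_indices_def)
    thus False using that unfolding assms(3) by (simp add: chamber_def)
  qed
  have "sorted_wrt (\<lambda>a b. y a \<le> y b) (order_list n y)"
    using order_list(3)[where n = n and x = y] by (simp add: sorted_map)
  hence "sorted_wrt (\<lambda>a b. x a \<le> x b) (order_list n y)"
    by (rule sorted_wrt_mono_rel[rotated]) (simp add: order_list le)
  thus "sorted (map x (order_list n y))" by (simp add: sorted_map)
qed (simp_all add: order_list)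

text \<open>A finite intersection of open half-spaces gives inclusion of sign vectors, and inclusion
  already forces equality.\<close>

lemma openin_chamber:
  assumes "x \<in> braid_complement n"
  shows "openin (subtopology (powertop_real {1..n}) (braid_complement n))
    {y \<in> braid_complement n. chamber n y = chamber n x}"
proof -
  let ?T = "powertop_real {1..n}"
  let ?U = "\<lambda>e. {y \<in> topspace ?T. y (snd e) - y (fst e) \<in> {0<..}}"
  have op: "openin ?T (?U e)" if "e \<in> chamber n x" for e
  proof -
    have "fst e \<in> {1..n}" "snd e \<in> {1..n}" using that by (auto simp: chamber_def gen_indices_def)
    thus ?thesis
      by (intro openin_continuous_map_preimage[where Y = euclideanreal] continuous_map_diff
          continuous_map_product_projection) auto
  qed
  have "openin ?T (topspace ?T \<inter> \<Inter>(?U ` chamber n x))"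
  proof (rule openin_Int_Inter[OF _ openin_topspace])
    fix X assume "X \<in> ?U ` chamber n x"
    thus "openin ?T X" using op by (elim imageE) simp
  qed simp
  hence "openin (subtopology ?T (braid_complement n)) (braid_complement n \<inter> (topspace ?T \<inter> \<Inter>(?U `
      chamber n x)))"
    by (rule openin_subtopology_Int2)
  also have "braid_complement n \<inter> (topspace ?T \<inter> \<Inter>(?U ` chamber n x)) =
      {y \<in> braid_complement n. chamber n x \<subseteq> chamber n y}"
  proof (intro equalityI subsetI)
    fix y assume y: "y \<in> braid_complement n \<inter> (topspace ?T \<inter> \<Inter>(?U ` chamber n x))"
    have "e \<in> chamber n y" if "e \<in> chamber n x" for e
    proof -
      have "y \<in> ?U e" using y that by blast
      thus ?thesis using that by (auto simp: chamber_def)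
    qed
    thus "y \<in> {y \<in> braid_complement n. chamber n x \<subseteq> chamber n y}" using y by blast
  next
    fix y assume y: "y \<in> {y \<in> braid_complement n. chamber n x \<subseteq> chamber n y}"
    hence "y \<in> topspace ?T" by (simp add: braid_complement_def)
    moreover have "y (snd e) - y (fst e) \<in> {0<..}" if "e \<in> chamber n x" for e
    proof -
      have "e \<in> chamber n y" using y that by blast
      thus ?thesis by (auto simp: chamber_def)
    qed
    ultimately show "y \<in> braid_complement n \<inter> (topspace ?T \<inter> \<Inter>(?U ` chamber n x))" using y by auto
  qed
  also have "\<dots> = {y \<in> braid_complement n. chamber n y = chamber n x}"
    using chamber_subset_iff[OF assms] by auto
  finally show ?thesis .
qed

text \<open>Chambers are convex: the segment \<gamma> from \<open>x\<close> to \<open>y\<close>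
  keeps all strict inequalities and stays in the complement, and a locally constant function on the
  connected unit interval is constant.\<close>

lemma locally_constant_chamber:
  assumes f: "locally_constant_on (subtopology (powertop_real {1..n}) (braid_complement n)) f"
    and x: "x \<in> braid_complement n" and y: "y \<in> braid_complement n" and eq: "chamber n x =
        chamber n y"
  shows "f x = f y"
proof -
  let ?C = "braid_complement n" and ?T = "powertop_real {1..n}"
  define \<gamma> where "\<gamma> u = (\<lambda>i\<in>{1..n}. (1 - u) * x i + u * y i)" for u :: real
  have \<gamma>C: "\<gamma> u \<in> ?C" if u: "u \<in> {0..1}" for u
    unfolding braid_complement_iff
  proof
    show "inj_on (\<gamma> u) {1..n}"
    proof (rule inj_onI, rule ccontr)
      have less: "\<gamma> u i < \<gamma> u j" if "(i, j) \<in> chamber n x" for i j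
      proof -
        have "x i < x j" "y i < y j" "i \<in> {1..n}" "j \<in> {1..n}"
          using that that[unfolded eq] by (auto simp: chamber_def gen_indices_def)
        moreover from this have "(1 - u) * x i + u * y i < (1 - u) * x j + u * y j"
        \<comment> \<open>For \<open>u > 0\<close> the strictness comes from the term with
          \<open>y\<close>; at \<open>u = 0\<close> only the term with \<open>x\<close> is
          left.\<close>
        proof (cases "u = 0")
          case False
          thus ?thesis using u \<open>x i < x j\<close> \<open>y i < y j\<close>
            by (intro add_le_less_mono mult_left_mono mult_strict_left_mono) auto
        qed simp
        ultimately show ?thesis by (simp add: \<gamma>_def)
      qed
      fix i j assume ij: "i \<in> {1..n}" "j \<in> {1..n}" "\<gamma> u i = \<gamma> u j" "i \<noteq> j"
      have "x i \<noteq> x j" using x ij by (auto simp: braid_complement_iff inj_on_eq_iff)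
      hence "(i, j) \<in> chamber n x \<or> (j, i) \<in> chamber n x"
        using ij by (auto simp: chamber_def gen_indices_def)
      thus False using less ij(3) by fastforce
    qed
  qed (simp add: \<gamma>_def)
  have "continuous_map (top_of_set {0..1}) ?T \<gamma>"
    unfolding continuous_map_componentwise
  proof (intro conjI ballI)
    fix k assume k: "k \<in> {1..n}"
    have "continuous_on {0..1} (\<lambda>u. (1 - u) * x k + u * y k)" by (intro continuous_intros)
    thus "continuous_map (top_of_set {0..1}) euclideanreal (\<lambda>u. \<gamma> u k)"
      using k by (simp add: \<gamma>_def)
  qed (auto simp: \<gamma>_def)
  hence cont: "continuous_map (top_of_set {0..1}) (subtopology ?T ?C) \<gamma>"
    using \<gamma>C by (auto simp: continuous_map_in_subtopology)
  have "(f \<circ> \<gamma>) 0 = (f \<circ> \<gamma>) 1"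
  proof (rule connected_local_const[of "{0..1::real}"])
    show "\<forall>a\<in>{0..1}. \<forall>\<^sub>F b in at a within {0..1}. (f \<circ> \<gamma>) a = (f \<circ> \<gamma>) b"
    proof
      fix a :: real assume a: "a \<in> {0..1}"
      have "\<gamma> a \<in> topspace (subtopology ?T ?C)"
        using \<gamma>C[OF a] by (auto simp: braid_complement_def)
      then obtain U where U: "openin (subtopology ?T ?C) U" "\<gamma> a \<in> U" "f constant_on U"
        using f unfolding locally_constant_on_def by blast
      from openin_continuous_map_preimage[OF cont U(1)]
      have "openin (top_of_set {0..1}) {u \<in> {0..1}. \<gamma> u \<in> U}" by simp
      then obtain V where V: "open V" "{u \<in> {0..1}. \<gamma> u \<in> U} = {0..1} \<inter> V"
        by (auto simp: openin_open)
      have "a \<in> V" using V(2) a U(2) by blast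
      moreover have "(f \<circ> \<gamma>) a = (f \<circ> \<gamma>) b" if "b \<in> V" "b \<in> {0..1}" for b
      proof -
        have "\<gamma> b \<in> U" using V(2) that by blast
        thus ?thesis using U(2,3) by (auto simp: constant_on_def)
      qed
      ultimately show "\<forall>\<^sub>F b in at a within {0..1}. (f \<circ> \<gamma>) a = (f \<circ> \<gamma>) b"
        unfolding eventually_at_topological using V(1) by blast
    qed
  qed auto
  moreover have "\<gamma> 0 = x" "\<gamma> 1 = y"
    using x y by (auto simp: \<gamma>_def braid_complement_iff extensional_def)
  ultimately show ?thesis by simp
qed

section \<open>Algebras with the same presentation\<close>

text \<open>The isomorphism is \<psi> applied to any preimage under \<phi>. The condition compares
  fibres and not kernels, since \<open>A\<close> and \<open>B\<close> are merely structures with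
  operations.\<close>

lemma alg_isomorphic_common_kernel:
  assumes \<phi>: "\<phi> \<in> alg_hom (poly_algebra V) A" "\<phi> ` poly_carrier V = carrier A"
    and \<psi>: "\<psi> \<in> alg_hom (poly_algebra V) B" "\<psi> ` poly_carrier V = carrier B"
    and ker: "\<And>P Q. P \<in> poly_carrier V \<Longrightarrow> Q \<in> poly_carrier V \<Longrightarrow> \<phi> P = \<phi> Q \<longleftrightarrow> \<psi> P = \<psi> Q"
  shows "alg_isomorphic A B"
proof -
  define F where "F a = \<psi> (SOME P. P \<in> poly_carrier V \<and> \<phi> P = a)" for a
  have F: "F (\<phi> P) = \<psi> P" if "P \<in> poly_carrier V" for P
  proof -
    have "(SOME Q. Q \<in> poly_carrier V \<and> \<phi> Q = \<phi> P) \<in> poly_carrier V \<and>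
        \<phi> (SOME Q. Q \<in> poly_carrier V \<and> \<phi> Q = \<phi> P) = \<phi> P"
      by (rule someI[of _ P]) (use that in simp)
    thus ?thesis using ker that unfolding F_def by blast
  qed
  have \<phi>': "\<phi> (P * Q) = \<phi> P \<otimes>\<^bsub>A\<^esub> \<phi> Q" "\<phi> (P + Q) = \<phi> P \<oplus>\<^bsub>A\<^esub> \<phi> Q" "\<phi> 1 = \<one>\<^bsub>A\<^esub>" "\<phi> (scale c P) =
      c \<odot>\<^bsub>A\<^esub> \<phi> P"
    if "P \<in> poly_carrier V" "Q \<in> poly_carrier V" for P Q c
    using \<phi>(1) that unfolding alg_hom_def ring_hom_def by auto
  have \<psi>': "\<psi> (P * Q) = \<psi> P \<otimes>\<^bsub>B\<^esub> \<psi> Q" "\<psi> (P + Q) = \<psi> P \<oplus>\<^bsub>B\<^esub> \<psi> Q" "\<psi> 1 = \<one>\<^bsub>B\<^esub>" "\<psi> (scale c P) =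
      c \<odot>\<^bsub>B\<^esub> \<psi> P"
    if "P \<in> poly_carrier V" "Q \<in> poly_carrier V" for P Q c
    using \<psi>(1) that unfolding alg_hom_def ring_hom_def by auto
  have onto: "\<exists>P\<in>poly_carrier V. a = \<phi> P" if "a \<in> carrier A" for a
    using that \<phi>(2) by blast
  have "F \<in> ring_hom A B"
  proof (rule ring_hom_memI)
    fix a b assume ab: "a \<in> carrier A" "b \<in> carrier A"
    obtain P where P: "P \<in> poly_carrier V" "a = \<phi> P" using onto[OF ab(1)] by blast
    obtain Q where Q: "Q \<in> poly_carrier V" "b = \<phi> Q" using onto[OF ab(2)] by blast
    show "F (a \<otimes>\<^bsub>A\<^esub> b) = F a \<otimes>\<^bsub>B\<^esub> F b" "F (a \<oplus>\<^bsub>A\<^esub> b) = F a \<oplus>\<^bsub>B\<^esub> F b"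
      unfolding P(2) Q(2) F[OF P(1)] F[OF Q(1)] \<phi>'(1,2)[OF P(1) Q(1), symmetric]
        \<psi>'(1,2)[OF P(1) Q(1), symmetric]
      by (rule F poly_carrier_closed P(1) Q(1))+
    show "F a \<in> carrier B" unfolding P(2) F[OF P(1)] using \<psi>(2) P(1) by blast
  next
    note one = poly_carrier_closed(2)[of V]
    show "F \<one>\<^bsub>A\<^esub> = \<one>\<^bsub>B\<^esub>"
      unfolding \<phi>'(3)[OF one one, symmetric] \<psi>'(3)[OF one one, symmetric] by (rule F[OF one])
  qed
  moreover have "F (c \<odot>\<^bsub>A\<^esub> a) = c \<odot>\<^bsub>B\<^esub> F a" if a: "a \<in> carrier A" for c a
  proof -
    obtain P where P: "P \<in> poly_carrier V" "a = \<phi> P" using onto[OF a] by blast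
    show ?thesis
      unfolding P(2) F[OF P(1)] \<phi>'(4)[OF P(1) P(1), symmetric] \<psi>'(4)[OF P(1) P(1), symmetric]
      by (intro F poly_carrier_closed P(1))
  qed
  moreover have "bij_betw F (carrier A) (carrier B)"
    unfolding bij_betw_def
  proof
    show "inj_on F (carrier A)"
    proof (rule inj_onI)
      fix a b assume ab: "a \<in> carrier A" "b \<in> carrier A" and eq: "F a = F b"
      obtain P where P: "P \<in> poly_carrier V" "a = \<phi> P" using onto[OF ab(1)] by blast
      obtain Q where Q: "Q \<in> poly_carrier V" "b = \<phi> Q" using onto[OF ab(2)] by blast
      show "a = b" using eq unfolding P(2) Q(2) F[OF P(1)] F[OF Q(1)] ker[OF P(1) Q(1)] .
    qed
    have "F ` carrier A = F ` \<phi> ` poly_carrier V" by (simp only: \<phi>(2))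
    also have "\<dots> = \<psi> ` poly_carrier V" unfolding image_image using F by (intro image_cong) auto
    finally show "F ` carrier A = carrier B" by (simp only: \<psi>(2))
  qed
  ultimately show ?thesis
    unfolding alg_isomorphic_def alg_hom_def by blast
qed

section \<open>Comparison with the Gelfand--Varchenko algebra\<close>

theorem LL_dual_GV:
  fixes c :: "'k::field_char_0"
  assumes c: "c \<noteq> 0" and n: "n \<ge> 1"
  shows "alg_isomorphic (LL_dual_algebra c n) (GV_algebra n :: ('k, (nat \<Rightarrow> real) \<Rightarrow> 'k) module)"
proof -
  interpret half_scalar c "1 / 2" by unfold_locales simp
  let ?V = "gen_indices n" and ?C = "braid_complement n" and ?GV =
      "GV_algebra n :: ('k, (nat \<Rightarrow> real) \<Rightarrow> 'k) module"
  define \<psi> where "\<psi> P = (\<lambda>x\<in>?C. list_poly P (order_list n x))" for P :: "(nat \<times> nat, 'k) polynomial"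
  have \<psi>_GV: "\<psi> P \<in> carrier ?GV" for P
  proof -
    have "locally_constant_on (subtopology (powertop_real {1..n}) ?C) (\<psi> P)"
      unfolding locally_constant_on_def
    proof
      fix x assume "x \<in> topspace (subtopology (powertop_real {1..n}) ?C)"
      hence x: "x \<in> ?C" by simp
      show "\<exists>U. openin (subtopology (powertop_real {1..n}) ?C) U \<and> x \<in> U \<and> \<psi> P constant_on U"
      proof (intro exI conjI)
        show "openin (subtopology (powertop_real {1..n}) ?C) {y \<in> ?C. chamber n y = chamber n x}"
          by (rule openin_chamber[OF x])
        show "\<psi> P constant_on {y \<in> ?C. chamber n y = chamber n x}"
          unfolding constant_on_def using order_list_cong[OF _ x]
          by (intro exI[of _ "list_poly P (order_list n x)"]) (simp add: \<psi>_def)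
      qed (use x in simp)
    qed
    thus ?thesis by (simp add: GV_algebra_def Let_def \<psi>_def)
  qed
  have "\<psi> \<in> alg_hom (poly_algebra ?V) ?GV"
    unfolding alg_hom_def
    by (auto intro!: ring_hom_memI \<psi>_GV, auto simp: \<psi>_def GV_algebra_def Let_def)
  moreover have "\<psi> ` poly_carrier ?V = carrier ?GV"
  proof (intro equalityI subsetI)
    fix f assume "f \<in> carrier ?GV"
    hence f: "f \<in> extensional ?C" and loc:
        "locally_constant_on (subtopology (powertop_real {1..n}) ?C) f"
      by (auto simp: GV_algebra_def Let_def PiE_def)
    define rep where "rep b = (SOME x. x \<in> ?C \<and> chamber n x = b)" for b
    \<comment> \<open>Lagrange interpolation on the chambers: the product of the
      \<open>x_ij / c\<close> over the sign vector \<open>b\<close> takes the value 1 on that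
      chamber and 0 on all others.\<close>
    define P where "P = (\<Sum>b\<in>chamber n ` ?C. scale (f (rep b)) (\<Prod>e\<in>b.
        scale (1 / c) (gen_x (fst e) (snd e))))"
    have fin: "finite (chamber n ` ?C)"
      by (rule finite_subset[of _ "Pow ?V"]) (auto simp: chamber_def)
    have prodI: "(\<Prod>e\<in>b. scale (1 / c) (gen_x (fst e) (snd e))) \<in> poly_carrier ?V" if "b \<subseteq> ?V" for b
    proof -
      have "finite b" using that finite_gen_indices by (rule finite_subset)
      thus ?thesis using that
      proof induction
        case (insert e b)
        have "scale (1 / c) (gen_x (fst e) (snd e)) * (\<Prod>e\<in>b. scale (1 / c) (gen_x (fst e) (snd e)))
            \<in> poly_carrier ?V"
          using insert by (intro poly_carrier_closed gen_x_carrier) auto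
        thus ?case using insert.hyps by simp
      qed (simp add: poly_carrier_closed)
    qed
    have "P \<in> poly_carrier ?V"
      unfolding P_def by (intro poly_carrier_sum poly_carrier_closed prodI) (auto simp: chamber_def)
    moreover have "f = \<psi> P"
    proof (rule extensionalityI[OF f])
      fix y assume y: "y \<in> ?C"
      have rep: "rep (chamber n x) \<in> ?C \<and> chamber n (rep (chamber n x)) = chamber n x" if "x \<in> ?C"
          for x
        unfolding rep_def by (rule someI[of _ x]) (use that in simp)
      have gen: "list_poly (gen_x (fst e) (snd e)) (order_list n y) =
          (if e \<in> chamber n y then c else 0)" if "e \<in> ?V" for e
      proof -
        have "inj_on y {1..n}" using y by (simp add: braid_complement_iff)
        from list_poly_gen_x[OF sorted_wrt_order_list[OF this], of "fst e" "snd e"] that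
        show ?thesis by (auto simp: order_list gen_indices_def chamber_def split: if_splits)
      qed
      have prod: "list_poly (\<Prod>e\<in>b. scale (1 / c) (gen_x (fst e) (snd e))) (order_list n y) =
          (if b = chamber n y then 1 else 0)" if b: "b \<in> chamber n ` ?C" for b
      proof -
        have "b \<subseteq> ?V" using b by (auto simp: chamber_def)
        hence fb: "finite b" using finite_gen_indices by (rule finite_subset)
        have "list_poly (\<Prod>e\<in>b. scale (1 / c) (gen_x (fst e) (snd e))) (order_list n y) =
            (\<Prod>e\<in>b. if e \<in> chamber n y then 1 else 0)"
          unfolding list_poly_prod list_poly_simps
        proof (intro prod.cong refl)
          fix e assume "e \<in> b"
          hence "e \<in> ?V" using \<open>b \<subseteq> ?V\<close> by blast
          show "1 / c * list_poly (gen_x (fst e) (snd e)) (order_list n y) =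
              (if e \<in> chamber n y then 1 else 0)"
            unfolding gen[OF \<open>e \<in> ?V\<close>] using c by simp
        qed
        also have "\<dots> = (if b \<subseteq> chamber n y then 1 else 0)"
          using fb by (auto intro!: prod.neutral prod_zero)
        \<comment> \<open>The product only tests inclusion of sign vectors; it is an indicator
          function because inclusion means equality.\<close>
        also have "b \<subseteq> chamber n y \<longleftrightarrow> b = chamber n y"
          using b chamber_subset_iff[OF _ y] by auto
        finally show ?thesis .
      qed
      have "\<psi> P y = list_poly P (order_list n y)" using y by (simp add: \<psi>_def)
      also have "\<dots> = (\<Sum>b\<in>chamber n ` ?C. f (rep b) * (if b = chamber n y then 1 else 0))"
        unfolding P_def list_poly_sum list_poly_simps by (intro sum.cong refl) (simp only: prod)
      also have "\<dots> = (\<Sum>b\<in>chamber n ` ?C. if b = chamber n y then f (rep b) else 0)"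
        by (intro sum.cong) auto
      also have "\<dots> = f (rep (chamber n y))"
        using y fin by simp
      also have "\<dots> = f y"
        using rep[OF y] y by (intro locally_constant_chamber[OF loc]) auto
      finally show "f y = \<psi> P y" by simp
    qed (simp add: \<psi>_def)
    ultimately show "f \<in> \<psi> ` poly_carrier ?V" by blast
  qed (use \<psi>_GV in auto)
  moreover have "dual_elem n P = dual_elem n Q \<longleftrightarrow> \<psi> P = \<psi> Q" for P Q
  proof -
    \<comment> \<open>Equality is tested first on trees, then on linear orders since
      \<open>c\<close> is invertible, and finally at points, since every order is realised by a
      point of the complement.\<close>
    have "dual_elem n P = dual_elem n Q \<longleftrightarrow> (\<forall>t\<in>trees_on {1..n}. pair_poly (P - Q) t = 0)"
      by (simp add: dual_elem_eq_iff tree_monomials_eq)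
    also have "\<dots> \<longleftrightarrow> (\<forall>ls. distinct ls \<and> set ls = {1..n} \<longrightarrow> list_poly (P - Q) ls = 0)"
      using c n by (intro pair_poly_vanish_iff[of "1 / c"]) auto
    also have "\<dots> \<longleftrightarrow> (\<forall>x\<in>?C. list_poly (P - Q) (order_list n x) = 0)"
    proof
      assume *: "\<forall>x\<in>?C. list_poly (P - Q) (order_list n x) = 0"
      show "\<forall>ls. distinct ls \<and> set ls = {1..n} \<longrightarrow> list_poly (P - Q) ls = 0"
      proof (intro allI impI)
        fix ls assume "distinct ls \<and> set ls = {1..n}"
        then obtain x where "x \<in> ?C" "order_list n x = ls" using order_list_surj by metis
        thus "list_poly (P - Q) ls = 0" using * by blast
      qed
    qed (simp add: order_list)
    also have "\<dots> \<longleftrightarrow> (\<forall>x\<in>?C. \<psi> P x = \<psi> Q x)"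
      by (simp add: \<psi>_def)
    also have "\<dots> \<longleftrightarrow> \<psi> P = \<psi> Q"
      by (auto simp: \<psi>_def fun_eq_iff restrict_def)
    finally show ?thesis .
  qed
  ultimately show ?thesis
    by (intro alg_isomorphic_common_kernel[OF dual_elem_alg_hom dual_elem_image[OF n]])
qed

theorem theorem1:
  fixes n :: nat
  assumes "n \<ge> 1"
  shows "presented_by (LL_dual_algebra (fps_X :: 'k::field_char_0 fps) n)
           (gen_indices n) (dual_relations (fps_X :: 'k fps) n)
    \<and> (\<forall>c::'k. presented_by (LL_dual_algebra c n) (gen_indices n) (dual_relations c n))
    \<and> (\<forall>c::'k. c \<noteq> 0 \<longrightarrow>
           alg_isomorphic (LL_dual_algebra c n) (GV_algebra n :: ('k, (nat \<Rightarrow> real) \<Rightarrow> 'k) module))"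
proof (intro conjI allI impI)
  have "2 * fps_const (1 / 2) = (1 :: 'k fps)"
    by (simp add: numeral_fps_const)
  then interpret formal: half_scalar "fps_X :: 'k fps" "fps_const (1 / 2)"
    by unfold_locales
  show "presented_by (LL_dual_algebra (fps_X :: 'k fps) n) (gen_indices n) (dual_relations (fps_X ::
      'k fps) n)"
    by (rule formal.LL_dual_presentation[OF assms])
next
  fix c :: 'k
  interpret half_scalar c "1 / 2" by unfold_locales simp
  show "presented_by (LL_dual_algebra c n) (gen_indices n) (dual_relations c n)"
    by (rule LL_dual_presentation[OF assms])
qed (rule LL_dual_GV[OF _ assms])

end
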